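(* Fix $1<p\le q<\infty$ and $0<\alpha<n$ with $\Theta(\alpha):=\alpha+n\left(\frac1q-\frac1p\right)>0$ and $p'\,\Theta(\alpha)<n$, where $\frac1p+\frac1{p'}=1$. Then, given $u\in A_1(\mathbb{R}^n)$ and $g\in L^1(\mathbb{R}^n)$, the pair $$(u,v)=\left(u,\ \mathcal{M}(g)^{-\Theta(\alpha)p/n}\,u^{p/q}\right)$$ satisfies $$[(u,v)]_{A_{p,q}^{\alpha}}:=\sup_Q|Q|^{\Theta(\alpha)/n}\left(\frac1{|Q|}\int_Q u\right)^{1/q}\left(\frac1{|Q|}\int_Q v^{-p'/p}\right)^{1/p'}<\infty$$ with the estimate $$[(u,v)]_{A_{p,q}^{\alpha}}\le C\,\|g\|_{L^1(\mathbb{R}^n)}^{\Theta(\alpha)/n},$$ where $C>0$ depends only on $n$, $\alpha$, $p$, $q$, and $[u]_{A_1}$. In particular, one has the weighted inequality $$\left(\int_{\mathbb{R}^n}|I_\alpha(f)(x)|^q u(x)\,dx\right)^{1/q}\le C\,\|g\|_{L^1(\mathbb{R}^n)}^{\Theta(\alpha)/n}\left(\int_{\mathbb{R}^n}|f(x)|^p\,\mathcal{M}(g)(x)^{-\Theta(\alpha)p/n}\,u(x)^{p/q}\,dx\right)^{1/p}$$ for every $g\in L^1(\mathbb{R}^n)$ and every measurable $f$, where $C>0$ depends only on $n$, $\alpha$, $p$, $q$, and $[u]_{A_1}$.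
   Context: $Q$ always denotes a cube in $\mathbb{R}^n$ with sides parallel to the coordinate axes, and suprema over $Q$ are over all such cubes. $\mathcal{M}(g)(x)=\sup_{Q\ni x}\frac1{|Q|}\int_Q|g(y)|\,dy$ is the Hardy--Littlewood maximal function, and $I_\alpha(f)(x)=\int_{\mathbb{R}^n}\frac{f(y)}{|x-y|^{n-\alpha}}\,dy$ is the fractional integral operator. A weight is a function $w\in L^1_{\rm loc}(\mathbb{R}^n)$ with $w\ge0$ a.e.; a weight $w$ belongs to $A_1(\mathbb{R}^n)$ if $[w]_{A_1}:=\sup_Q\left(\frac1{|Q|}\int_Q w\right)\left(\operatorname{ess\,inf}_Q w\right)^{-1}<\infty$.
   Formalization: In the weighted inequality, the case where g = 0 a.e. and the weighted norm of f on the right is infinite is excluded: the right side is then the indeterminate 0·∞, and read as 0 the claim fails (g = 0, u = 1, f the indicator of a ball). *)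

theory Defs
  imports "HOL-Analysis.Analysis"
begin

text \<open>
  Conventions. \<open>\<real>\<^sup>n\<close> is \<^typ>\<open>real ^ 'n\<close> with \<open>n = CARD('n)\<close>; all measurability and all integrals
  refer to Lebesgue measure. Nonnegative quantities (suprema, averages, norms, powers of
  \<open>M(g)\<close>) live in \<^typ>\<open>ennreal\<close>, where \<open>0 * \<infinity> = 0\<close> and \<open>inverse 0 = \<infinity>\<close>.
\<close>

text \<open>Real powers on \<open>[0, \<infinity>]\<close>, with \<open>0\<^sup>a = \<infinity>\<close> and \<open>\<infinity>\<^sup>a = 0\<close> for \<open>a < 0\<close> (unlike \<^const>\<open>powr\<close>
  on the reals, where \<open>0 powr a = 0\<close>).\<close>

definition epow :: "ennreal \<Rightarrow> real \<Rightarrow> ennreal" where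
  "epow x a =
     (if a = 0 then 1
      else if x = 0 then (if a > 0 then 0 else \<infinity>)
      else if x = \<infinity> then (if a > 0 then \<infinity> else 0)
      else ennreal (enn2real x powr a))"

text \<open>Closed cubes of positive side length; open or half-open cubes give the same suprema below.\<close>

definition cubes :: "(real ^ 'n) set set" where
  "cubes = {cbox a b | a b. \<exists>l>0. \<forall>i. b $ i - a $ i = l}"

definition avg :: "(real ^ 'n) set \<Rightarrow> (real ^ 'n \<Rightarrow> ennreal) \<Rightarrow> ennreal" where
  "avg Q h = (\<integral>\<^sup>+x\<in>Q. h x \<partial>lebesgue) / emeasure lebesgue Q"

definition ess_inf_on :: "(real ^ 'n) set \<Rightarrow> (real ^ 'n \<Rightarrow> ennreal) \<Rightarrow> ennreal" where
  "ess_inf_on Q h = Sup {c. AE x in lebesgue. x \<in> Q \<longrightarrow> c \<le> h x}"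

definition maximal_function :: "(real ^ 'n \<Rightarrow> complex) \<Rightarrow> real ^ 'n \<Rightarrow> ennreal" where
  "maximal_function g x = (SUP Q\<in>{Q\<in>cubes. x \<in> Q}. avg Q (\<lambda>y. ennreal (norm (g y))))"

definition frac_kernel_prod :: "real \<Rightarrow> (real ^ 'n \<Rightarrow> complex) \<Rightarrow> real ^ 'n \<Rightarrow> real ^ 'n \<Rightarrow> complex" where
  "frac_kernel_prod \<alpha> f x y = f y / complex_of_real (norm (x - y) powr (real CARD('n) - \<alpha>))"

definition frac_integral :: "real \<Rightarrow> (real ^ 'n \<Rightarrow> complex) \<Rightarrow> real ^ 'n \<Rightarrow> complex" where
  "frac_integral \<alpha> f x = (LINT y|lebesgue. frac_kernel_prod \<alpha> f x y)"

text \<open>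
  \<open>|I\<^sub>\<alpha>(f)(x)|\<close> as an extended number. The Bochner integral has the default value 0 where the
  integral is not absolutely convergent; there the value here is \<open>\<infinity>\<close>, so an upper bound for it
  also asserts convergence. For \<open>f \<ge> 0\<close> this is the usual \<open>[0, \<infinity>]\<close>-valued integral.
\<close>

definition abs_frac_integral :: "real \<Rightarrow> (real ^ 'n \<Rightarrow> complex) \<Rightarrow> real ^ 'n \<Rightarrow> ennreal" where
  "abs_frac_integral \<alpha> f x =
     (if integrable lebesgue (frac_kernel_prod \<alpha> f x)
      then ennreal (norm (frac_integral \<alpha> f x)) else \<infinity>)"

definition weight :: "(real ^ 'n \<Rightarrow> real) \<Rightarrow> bool" where
  "weight w \<longleftrightarrow>
     (\<forall>K. compact K \<longrightarrow> set_integrable lebesgue K w) \<and> (AE x in lebesgue. 0 \<le> w x)"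

definition A1_const :: "(real ^ 'n \<Rightarrow> real) \<Rightarrow> ennreal" where
  "A1_const w =
     (SUP Q\<in>cubes. avg Q (\<lambda>x. ennreal (w x)) * inverse (ess_inf_on Q (\<lambda>x. ennreal (w x))))"

definition A1 :: "(real ^ 'n \<Rightarrow> real) set" where
  "A1 = {w. weight w \<and> A1_const w < \<infinity>}"

definition Theta :: "real \<Rightarrow> real \<Rightarrow> real \<Rightarrow> real \<Rightarrow> real" where
  "Theta n \<alpha> p q = \<alpha> + n * (1 / q - 1 / p)"

definition conj_exponent :: "real \<Rightarrow> real" where
  "conj_exponent p = p / (p - 1)"

definition Apq_const ::
    "real \<Rightarrow> real \<Rightarrow> real \<Rightarrow> (real ^ 'n \<Rightarrow> ennreal) \<Rightarrow> (real ^ 'n \<Rightarrow> ennreal) \<Rightarrow> ennreal" where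
  "Apq_const \<alpha> p q u v =
     (SUP Q\<in>cubes.
        epow (emeasure lebesgue Q) (Theta (real CARD('n)) \<alpha> p q / real CARD('n))
        * epow (avg Q u) (1 / q)
        * epow (avg Q (\<lambda>x. epow (v x) (- (conj_exponent p / p)))) (1 / conj_exponent p))"

definition maximal_weight ::
    "real \<Rightarrow> real \<Rightarrow> real \<Rightarrow> (real ^ 'n \<Rightarrow> complex) \<Rightarrow> (real ^ 'n \<Rightarrow> real) \<Rightarrow> real ^ 'n \<Rightarrow> ennreal" where
  "maximal_weight \<alpha> p q g u x =
     epow (maximal_function g x) (- (Theta (real CARD('n)) \<alpha> p q * p / real CARD('n)))
     * epow (ennreal (u x)) (p / q)"

definition L1_norm :: "(real ^ 'n \<Rightarrow> complex) \<Rightarrow> real" where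
  "L1_norm g = (LINT x|lebesgue. norm (g x))"

definition weighted_norm :: "real \<Rightarrow> (real ^ 'n \<Rightarrow> ennreal) \<Rightarrow> (real ^ 'n \<Rightarrow> ennreal) \<Rightarrow> ennreal" where
  "weighted_norm r h w = epow (\<integral>\<^sup>+x. epow (h x) r * w x \<partial>lebesgue) (1 / r)"

end

(*
  The pair is two-weight admissible because M(g)^d is locally integrable for d < 1 with
  int_E M(g)^d <= C |E|^(1-d) |g|_1^d (Kolmogorov), while the A_1 condition bounds u from below
  on Q by its average; this is the first estimate.

  For the fractional integral the A_{p,q}^alpha condition alone is not enough, but since
  p' Theta < n is strict, the same two facts with Hoelder's inequality at an exponent s < p,
  s' Theta < n, give on every ball B, with kappa = 1/p - 1/q and u(B) the u-mass of B,
    |B|^(alpha/n - 1) int_B |f| <= C |g|_1^(Theta/n) u(B)^kappa (avg_{B,u} h)^(1/s),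
  where int h^(p/s) u dx is the p-th power of the right-hand norm. The operator I_alpha is dominated
  pointwise by a sum of the left-hand sides over a sparse family of dyadic cubes, and a sparse family
  is handled in L^q(u) by the maximal theorem for the doubling measure u dx; A_1 carries
  sparseness over from Lebesgue measure to u dx.
*)

theory Submission
  imports Defs
begin

section \<open>Powers of extended nonnegative reals\<close>

text \<open>Maximal functions are built over balls for an abstract doubling measure because they are
  used for two measures: for Lebesgue measure, to make the selected cubes sparse and to integrate
  powers of M(g), and for u dx, to sum over the selected cubes. The exponent s < p is what provides
  room: h has to be controlled in L^(p/s)(u), and the maximal theorem holds there because p/s > 1.
  With s = p only a weak type bound would be left. The identity 1/p - 1/q + \<Theta>(\<alpha>)/n =
  \<alpha>/n makes the powers of |B| cancel. Selecting maximal cubes requires that the averages of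
  |f| tend to 0 at large scales. This is derived from the local bound: when the right-hand norm is
  finite, avg_B |f| is at most a constant, depending on f, times |B|^(-\<alpha>/n) u(B)^(-1/q), and
  u(B) increases with B. In [0, \<infinity>] the convention 0 * \<infinity> = 0 is not always
  harmless, so the cases u = 0 a.e., g = 0 a.e. and infinite right-hand norm are settled separately
  before any division.\<close>

lemma epow_0_right [simp]: "epow x 0 = 1"
  by (simp add: epow_def)

lemma epow_1_right [simp]: "epow x 1 = x"
  by (cases x) (auto simp: epow_def top_unique)

lemma epow_0_left [simp]: "a > 0 \<Longrightarrow> epow 0 a = 0"
  by (simp add: epow_def)

lemma epow_0_left_neg [simp]: "a < 0 \<Longrightarrow> epow 0 a = \<infinity>"
  by (simp add: epow_def)

lemma epow_top_left [simp]: "a > 0 \<Longrightarrow> epow top a = \<infinity>"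
  by (simp add: epow_def)

lemma epow_top_left_neg [simp]: "a < 0 \<Longrightarrow> epow top a = 0"
  by (simp add: epow_def)

lemma epow_ennreal: "x > 0 \<Longrightarrow> epow (ennreal x) a = ennreal (x powr a)"
  by (simp add: epow_def)

lemma epow_ennreal_nonneg: "x \<ge> 0 \<Longrightarrow> a > 0 \<Longrightarrow> epow (ennreal x) a = ennreal (x powr a)"
  by (cases "x = 0") (simp_all add: epow_ennreal)

lemma ennreal_cases_pos:
  obtains "x = 0" | "x = \<infinity>" | r where "r > 0" "x = ennreal r"
  by (cases x) (auto simp: le_less)

text \<open>Negative exponents have to be excluded: for \<open>a < 0\<close>, \<open>x = 0\<close>
  and \<open>y = \<infinity>\<close> the left side is \<open>\<infinity>\<close>, the right side
  \<open>\<infinity> * 0 = 0\<close>.\<close>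

lemma epow_mult:
  assumes "a \<ge> 0"
  shows "epow (x * y) a = epow x a * epow y a"
proof (cases "a = 0")
  case False
  with assms have a: "a > 0" by simp
  show ?thesis
    by (cases x rule: ennreal_cases_pos; cases y rule: ennreal_cases_pos)
       (use a in \<open>auto simp: epow_ennreal ennreal_mult[symmetric] powr_mult
          ennreal_mult_top ennreal_top_mult\<close>)
qed simp

lemma epow_epow: "epow (epow x a) b = epow x (a * b)"
proof -
  consider "a = 0" | "b = 0" | "a \<noteq> 0" "b \<noteq> 0" by blast
  then show ?thesis
  proof cases
    case 1
    then show ?thesis by (simp add: epow_def)
  next
    case 3
    then show ?thesis
      by (cases x rule: ennreal_cases_pos; cases "a > 0"; cases "b > 0")
         (auto simp: epow_ennreal powr_powr epow_def mult_pos_pos mult_neg_neg zero_less_mult_iff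
           mult_less_0_iff)
  qed simp
qed

lemma epow_add:
  assumes "a \<ge> 0" "b \<ge> 0"
  shows "epow x (a + b) = epow x a * epow x b"
proof (cases "a = 0 \<or> b = 0")
  case False
  with assms have "a > 0" "b > 0" by auto
  then show ?thesis
    by (cases x rule: ennreal_cases_pos)
       (auto simp: epow_ennreal powr_add ennreal_mult[symmetric])
qed auto

text \<open>Exponents of opposite sign add only away from 0 and \<open>\<infinity>\<close>; at these
  two points they would give \<open>0 * \<infinity> = 0\<close> in place of 1.\<close>

lemma epow_add_finite:
  assumes "0 < x" "x < \<infinity>"
  shows "epow x (a + b) = epow x a * epow x b"
  using assms
  by (cases x rule: ennreal_cases_pos)
     (auto simp: epow_ennreal powr_add ennreal_mult[symmetric])

lemma epow_mono:
  assumes "x \<le> y" "a \<ge> 0"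
  shows "epow x a \<le> epow y a"
proof (cases "a = 0")
  case False
  with assms have "a > 0" by simp
  with assms show ?thesis
    by (cases x rule: ennreal_cases_pos; cases y rule: ennreal_cases_pos)
       (auto simp: epow_ennreal intro!: ennreal_leI powr_mono2 simp: top_unique)
qed simp

lemma epow_antimono:
  assumes "x \<le> y" "a \<le> 0"
  shows "epow y a \<le> epow x a"
proof (cases "a = 0")
  case False
  with assms have "a < 0" by simp
  with assms show ?thesis
    by (cases x rule: ennreal_cases_pos; cases y rule: ennreal_cases_pos)
       (auto simp: epow_ennreal intro!: ennreal_leI powr_mono2' simp: top_unique)
qed simp

lemma epow_eq_0_iff: "a > 0 \<Longrightarrow> epow x a = 0 \<longleftrightarrow> x = 0"
  by (cases x rule: ennreal_cases_pos) (auto simp: epow_ennreal)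

lemma epow_eq_top_iff: "a > 0 \<Longrightarrow> epow x a = \<infinity> \<longleftrightarrow> x = \<infinity>"
  by (cases x rule: ennreal_cases_pos) (auto simp: epow_ennreal)

lemma epow_less_top: "a > 0 \<Longrightarrow> x < \<infinity> \<Longrightarrow> epow x a < \<infinity>"
  using epow_eq_top_iff[of a x] by (auto simp: less_top)

lemma epow_pos: "0 < x \<Longrightarrow> x < \<infinity> \<Longrightarrow> 0 < epow x a"
  by (cases x rule: ennreal_cases_pos) (auto simp: epow_ennreal)

lemma epow_finite: "0 < x \<Longrightarrow> x < \<infinity> \<Longrightarrow> epow x a < \<infinity>"
  by (cases x rule: ennreal_cases_pos) (auto simp: epow_ennreal)

lemma epow_neg_mult_self: "0 < x \<Longrightarrow> x < \<infinity> \<Longrightarrow> epow x (- a) * epow x a = 1"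
  by (subst epow_add_finite[symmetric]) auto

lemma measurable_epow [measurable]:
  assumes "f \<in> borel_measurable M"
  shows "(\<lambda>x. epow (f x) a) \<in> borel_measurable M"
proof -
  have "(\<lambda>x. epow x a) \<in> borel_measurable borel"
    unfolding epow_def by measurable
  from measurable_compose[OF assms this] show ?thesis .
qed

text \<open>The inverse map, the power \<open>1 / a\<close>, is monotone too, so a positive power is
  an order isomorphism of [0, \<infinity>] and commutes with suprema.\<close>

lemma epow_SUP:
  assumes "a > 0" "I \<noteq> {}"
  shows "epow (SUP i\<in>I. f i) a = (SUP i\<in>I. epow (f i) a)"
proof (rule antisym)
  define y where "y = (SUP i\<in>I. epow (f i) a)"
  have "f i \<le> epow y (1 / a)" if "i \<in> I" for i
  proof -
    have "f i = epow (epow (f i) a) (1 / a)"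
      using assms by (simp add: epow_epow)
    also have "\<dots> \<le> epow y (1 / a)"
      using assms that by (intro epow_mono) (auto simp: y_def intro: SUP_upper)
    finally show ?thesis .
  qed
  then have "epow (SUP i\<in>I. f i) a \<le> epow (epow y (1 / a)) a"
    using assms by (intro epow_mono SUP_least) auto
  then show "epow (SUP i\<in>I. f i) a \<le> (SUP i\<in>I. epow (f i) a)"
    using assms by (simp add: epow_epow y_def)
  show "(SUP i\<in>I. epow (f i) a) \<le> epow (SUP i\<in>I. f i) a"
    using assms by (intro SUP_least epow_mono SUP_upper) auto
qed

section \<open>Inequalities of Young and Hoelder, and the layer formula for powers\<close>

lemma Youngs_inequality_epow:
  fixes x y :: ennreal
  assumes p: "p > 1" and p': "1 / p + 1 / p' = 1"
  shows "x * y \<le> ennreal (1 / p) * epow x p + ennreal (1 / p') * epow y p'"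
proof -
  have p'1: "p' > 1"
    using assms by (smt (verit) divide_less_eq_1 divide_nonneg_pos divide_le_0_iff less_divide_eq_1)
  show ?thesis
  proof (cases "x = 0 \<or> y = 0 \<or> x = \<infinity> \<or> y = \<infinity>")
    case True
    then show ?thesis
      using p p'1 by (auto simp: ennreal_mult_top)
  next
    case False
    then obtain a b where ab: "a > 0" "x = ennreal a" "b > 0" "y = ennreal b"
      by (metis ennreal_cases_pos)
    have "a * b \<le> a powr p / p + b powr p' / p'"
      using Youngs_inequality[of p p' a b] p p'1 p' ab by auto
    then have "ennreal (a * b) \<le> ennreal (a powr p / p + b powr p' / p')"
      by (rule ennreal_leI)
    also have "\<dots> = ennreal (1 / p) * epow x p + ennreal (1 / p') * epow y p'"
      using ab p p'1
      by (simp add: epow_ennreal ennreal_plus[symmetric] ennreal_mult[symmetric] del: ennreal_plus)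
    finally show ?thesis
      using ab by (simp add: ennreal_mult)
  qed
qed

lemma Holder_nn_integral:
  fixes F H :: "'a \<Rightarrow> ennreal"
  assumes p: "p > 1" and p': "1 / p + 1 / p' = 1"
    and [measurable]: "F \<in> borel_measurable M" "H \<in> borel_measurable M"
  shows "(\<integral>\<^sup>+x. F x * H x \<partial>M)
    \<le> epow (\<integral>\<^sup>+x. epow (F x) p \<partial>M) (1 / p) * epow (\<integral>\<^sup>+x. epow (H x) p' \<partial>M) (1 / p')"
proof -
  have p'1: "p' > 1"
    using p p' by (smt (verit) divide_less_eq_1 divide_nonneg_pos divide_le_0_iff less_divide_eq_1)
  define A where "A = (\<integral>\<^sup>+x. epow (F x) p \<partial>M)"
  define B where "B = (\<integral>\<^sup>+x. epow (H x) p' \<partial>M)"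
  \<comment> \<open>A vanishing integral takes precedence over an infinite one: the product is then
    0 a.e., in agreement with \<open>0 * \<infinity> = 0\<close>. Only when both are positive and
    finite can the functions be normalised.\<close>
  consider "A = 0 \<or> B = 0" | "A \<noteq> 0" "B \<noteq> 0" "A = \<infinity> \<or> B = \<infinity>"
    | "A \<noteq> 0" "B \<noteq> 0" "A \<noteq> \<infinity>" "B \<noteq> \<infinity>" by blast
  then show ?thesis
  proof cases
    case 1
    then have "AE x in M. F x * H x = 0"
    proof
      assume "A = 0"
      then have "AE x in M. epow (F x) p = 0"
        unfolding A_def by (subst (asm) nn_integral_0_iff_AE) auto
      then show ?thesis
        using p by (auto simp: epow_eq_0_iff)
    next
      assume "B = 0"
      then have "AE x in M. epow (H x) p' = 0"
        unfolding B_def by (subst (asm) nn_integral_0_iff_AE) auto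
      then show ?thesis
        using p'1 by (auto simp: epow_eq_0_iff)
    qed
    then have "(\<integral>\<^sup>+x. F x * H x \<partial>M) = 0"
      by (subst nn_integral_0_iff_AE) auto
    then show ?thesis by simp
  next
    case 2
    have "epow A (1 / p) * epow B (1 / p') = \<infinity>"
      using 2 p p'1 by (auto simp: ennreal_mult_eq_top_iff epow_eq_0_iff epow_eq_top_iff[simplified])
    then show ?thesis by (simp add: A_def B_def)
  next
    case 3
    define a where "a = epow A (1 / p)"
    define b where "b = epow B (1 / p')"
    have fin: "0 < A" "A < \<infinity>" "0 < B" "B < \<infinity>"
      using 3 by (auto simp: less_top zero_less_iff_neq_zero)
    have ab: "0 < a" "a < \<infinity>" "0 < b" "b < \<infinity>"
      unfolding a_def b_def using fin by (simp_all only: epow_pos epow_finite)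
    have ai: "epow a (-1) * a = 1" "epow b (-1) * b = 1"
      using epow_neg_mult_self[OF ab(1,2), of 1] epow_neg_mult_self[OF ab(3,4), of 1] by auto
    have aA: "epow (epow a (-1)) p * A = 1" "epow (epow b (-1)) p' * B = 1"
      using epow_neg_mult_self[OF fin(1,2), of 1] epow_neg_mult_self[OF fin(3,4), of 1] p p'1
      by (auto simp: a_def b_def epow_epow)
    have "(\<integral>\<^sup>+x. (epow a (-1) * F x) * (epow b (-1) * H x) \<partial>M)
      \<le> (\<integral>\<^sup>+x. ennreal (1 / p) * epow (epow a (-1) * F x) p
            + ennreal (1 / p') * epow (epow b (-1) * H x) p' \<partial>M)"
      by (intro nn_integral_mono Youngs_inequality_epow p p')
    also have "\<dots> = ennreal (1 / p) * (epow (epow a (-1)) p * A)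
          + ennreal (1 / p') * (epow (epow b (-1)) p' * B)"
      using p p'1 by (simp add: nn_integral_add nn_integral_cmult epow_mult A_def B_def)
    also have "\<dots> = ennreal (1 / p + 1 / p')"
      unfolding aA using p p'1 by (subst ennreal_plus) auto
    finally have *: "(\<integral>\<^sup>+x. (epow a (-1) * F x) * (epow b (-1) * H x) \<partial>M) \<le> 1"
      by (simp add: p')
    have "(\<integral>\<^sup>+x. F x * H x \<partial>M)
      = (\<integral>\<^sup>+x. ((epow a (-1) * a) * (epow b (-1) * b)) * (F x * H x) \<partial>M)"
      unfolding ai by simp
    also have "\<dots> = (\<integral>\<^sup>+x. (a * b) * ((epow a (-1) * F x) * (epow b (-1) * H x)) \<partial>M)"
      by (simp add: ac_simps)
    also have "\<dots> = (a * b) * (\<integral>\<^sup>+x. (epow a (-1) * F x) * (epow b (-1) * H x) \<partial>M)"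
      by (intro nn_integral_cmult) measurable
    also have "\<dots> \<le> (a * b) * 1"
      by (intro mult_left_mono *) auto
    finally show ?thesis by (simp add: a_def b_def A_def B_def)
  qed
qed

text \<open>This is the fundamental theorem of calculus for \<open>t powr a\<close> on
  \<open>(0, z)\<close>. For \<open>z = \<infinity>\<close> the integral exceeds its value at every
  integer, and \<open>epow_SUP\<close> identifies the limit.\<close>

lemma nn_integral_powr_layer:
  fixes z :: ennreal
  assumes a: "a > 0"
  shows "(\<integral>\<^sup>+t. ennreal (a * t powr (a - 1)) * indicator {t. 0 < t \<and> ennreal t < z} t \<partial>lborel)
    = epow z a"
proof -
  have fin: "(\<integral>\<^sup>+t. ennreal (a * t powr (a - 1)) * indicator {t. 0 < t \<and> ennreal t < ennreal c} t \<partial>lborel)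
    = ennreal (c powr a)" if c: "c \<ge> 0" for c
  proof -
    have "((\<lambda>t. a * t powr (a - 1)) has_integral a * (c powr (a - 1 + 1) / (a - 1 + 1))) {0..c}"
      using a c by (intro has_integral_mult_right has_integral_powr_from_0) auto
    then have *: "((\<lambda>t. a * t powr (a - 1)) has_integral c powr a) {0..c}"
      using a by simp
    have "(\<integral>\<^sup>+t. ennreal (a * t powr (a - 1)) * indicator {0..c} t \<partial>lborel) = ennreal (c powr a)"
      by (rule nn_integral_has_integral_lebesgue'[OF _ *]) (use a in auto)
    moreover have "(\<integral>\<^sup>+t. ennreal (a * t powr (a - 1)) * indicator {t. 0 < t \<and> ennreal t < ennreal c} t \<partial>lborel)
      = (\<integral>\<^sup>+t. ennreal (a * t powr (a - 1)) * indicator {0..c} t \<partial>lborel)"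
    proof (rule nn_integral_cong_AE)
      have "AE t in lborel. t \<noteq> 0 \<and> t \<noteq> c"
        using AE_lborel_singleton[of "0::real"] AE_lborel_singleton[of c] by eventually_elim auto
      then show "AE t in lborel. ennreal (a * t powr (a - 1)) * indicator {t. 0 < t \<and> ennreal t < ennreal c} t
         = ennreal (a * t powr (a - 1)) * indicator {0..c} t"
        by eventually_elim (auto simp: indicator_def ennreal_less_iff)
    qed
    ultimately show ?thesis by simp
  qed
  show ?thesis
  proof (cases z)
    case (real c)
    then show ?thesis using fin[of c] a by (simp add: epow_ennreal_nonneg)
  next
    case top
    have "epow z a \<le> (\<integral>\<^sup>+t. ennreal (a * t powr (a - 1)) * indicator {t. 0 < t \<and> ennreal t < z} t \<partial>lborel)" (is "_ \<le> ?I")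
    proof -
      have "epow (of_nat n) a \<le> ?I" for n :: nat
      proof -
        have "epow (of_nat n) a = ennreal (real n powr a)"
          using a epow_ennreal_nonneg[of "real n" a] by (simp add: ennreal_of_nat_eq_real_of_nat)
        also have "\<dots> = (\<integral>\<^sup>+t. ennreal (a * t powr (a - 1)) * indicator {t. 0 < t \<and> ennreal t < ennreal (real n)} t \<partial>lborel)"
          by (rule fin[symmetric]) simp
        also have "\<dots> \<le> ?I"
          using top by (intro nn_integral_mono mult_left_mono) (auto simp: indicator_def)
        finally show ?thesis .
      qed
      then have "(SUP n::nat. epow (of_nat n) a) \<le> ?I"
        by (rule SUP_least)
      moreover have "(SUP n::nat. epow (of_nat n) a) = epow (SUP n::nat. of_nat n) a"
        by (rule epow_SUP[symmetric]) (use a in auto)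
      moreover have "(SUP n::nat. of_nat n) = z"
        using top by (simp add: ennreal_SUP_of_nat_eq_top)
      ultimately show ?thesis by simp
    qed
    moreover have "epow z a = \<infinity>"
      using top a by simp
    ultimately show ?thesis
      by (simp add: top_unique)
  qed
qed

section \<open>Maximal functions of doubling measures\<close>

abbreviation ball_int :: "'a::metric_space measure \<Rightarrow> ('a \<Rightarrow> ennreal) \<Rightarrow> 'a \<Rightarrow> real \<Rightarrow> ennreal" where
  "ball_int M f c r \<equiv> \<integral>\<^sup>+y\<in>ball c r. f y \<partial>M"

text \<open>Uncentred and over open balls: the superlevel sets are unions of balls, hence open,
  which yields measurability for an arbitrary \<open>f\<close>.\<close>

definition max_fun :: "'a::euclidean_space measure \<Rightarrow> ('a \<Rightarrow> ennreal) \<Rightarrow> 'a \<Rightarrow> ennreal" where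
  "max_fun M f x = (SUP (c, r)\<in>{(c, r). 0 < r \<and> x \<in> ball c r}.
     ball_int M f c r / emeasure M (ball c r))"

lemma less_max_fun_iff:
  "t < max_fun M f x \<longleftrightarrow>
     (\<exists>c r. 0 < r \<and> x \<in> ball c r \<and> t < ball_int M f c r / emeasure M (ball c r))"
  by (auto simp: max_fun_def less_SUP_iff)

lemma open_less_max_fun: "open {x. t < max_fun M f x}"
proof -
  have "{x. t < max_fun M f x} = (\<Union>(c, r)\<in>{(c, r). 0 < r \<and>
      t < ball_int M f c r / emeasure M (ball c r)}. ball c r)"
    unfolding less_max_fun_iff by fast
  then show ?thesis by auto
qed

lemma ennreal_divide_mult_cancel:
  fixes x m :: ennreal
  assumes "m \<noteq> 0" "m \<noteq> \<infinity>"
  shows "x / m * m = x"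
proof -
  have "x / m * m = x * m / m"
    by (simp only: mult.commute[of "x / m"] ennreal_times_divide mult.commute[of m])
  then show ?thesis
    using assms ennreal_mult_divide_eq[of m x] by simp
qed

text \<open>The dilation factor 5 is the one of the Vitali covering lemma.\<close>

locale doubling =
  fixes M :: "'a::euclidean_space measure" and D :: real
  assumes sets_M: "sets M = sets lebesgue"
    and ball_pos: "0 < r \<Longrightarrow> 0 < emeasure M (ball c r)"
    and ball_finite: "emeasure M (ball c r) < \<infinity>"
    and ball_5: "0 < r \<Longrightarrow> emeasure M (ball c (5 * r)) \<le> ennreal D * emeasure M (ball c r)"
begin

lemma open_in_sets: "open S \<Longrightarrow> S \<in> sets M"
  by (simp add: sets_M)

lemma ball_in_sets [measurable]: "ball c r \<in> sets M"
  by (simp add: open_in_sets)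

lemma space_M [simp]: "space M = UNIV"
  using sets_eq_imp_space_eq[OF sets_M] by simp

lemma UNIV_in_sets: "UNIV \<in> sets M"
  using open_in_sets[OF open_UNIV] .

lemma sigma_finite_M: "sigma_finite_measure M"
proof
  show "\<exists>A. countable A \<and> A \<subseteq> sets M \<and> \<Union> A = space M \<and> (\<forall>a\<in>A. emeasure M a \<noteq> \<infinity>)"
  proof (intro exI conjI ballI)
    show "countable (range (\<lambda>n::nat. ball (0::'a) (real n)))" by simp
    show "range (\<lambda>n::nat. ball (0::'a) (real n)) \<subseteq> sets M" by auto
    show "\<Union>(range (\<lambda>n::nat. ball (0::'a) (real n))) = space M"
      using reals_Archimedean2 by auto
  qed (use ball_finite in \<open>auto simp: less_top\<close>)
qed

sublocale sigma_finite_measure M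
  by (rule sigma_finite_M)

lemma measurable_max_fun [measurable]: "max_fun M f \<in> borel_measurable M"
  by (rule borel_measurableI_greater) (simp add: open_in_sets open_less_max_fun)

lemma nn_integral_ball_le_max_fun:
  assumes "0 < r" "x \<in> ball c r"
  shows "ball_int M f c r \<le> max_fun M f x * emeasure M (ball c r)"
proof -
  have "ball_int M f c r / emeasure M (ball c r) \<le> max_fun M f x"
    unfolding max_fun_def using assms by (intro SUP_upper2[where i = "(c, r)"]) auto
  then have "ball_int M f c r / emeasure M (ball c r) * emeasure M (ball c r)
     \<le> max_fun M f x * emeasure M (ball c r)"
    by (intro mult_right_mono) auto
  then show ?thesis
    using ball_pos[OF assms(1), of c] ball_finite[of c r]
    by (subst (asm) ennreal_divide_mult_cancel) auto
qed

lemma max_fun_le: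
  assumes "\<And>c r. 0 < r \<Longrightarrow> x \<in> ball c r \<Longrightarrow>
    ball_int M f c r \<le> t * emeasure M (ball c r)"
  shows "max_fun M f x \<le> t"
  unfolding max_fun_def
proof (intro SUP_least, clarify)
  fix c r assume "(0::real) < r" "x \<in> ball c r"
  then have "ball_int M f c r / emeasure M (ball c r)
     \<le> t * emeasure M (ball c r) / emeasure M (ball c r)"
    using assms by (intro divide_right_mono_ennreal) auto
  also have "\<dots> = t"
    using ball_pos[OF \<open>0 < r\<close>, of c] ball_finite[of c r] by (intro ennreal_mult_divide_eq) auto
  finally show "ball_int M f c r / emeasure M (ball c r) \<le> t" .
qed

lemma max_fun_add_le:
  assumes [measurable]: "g \<in> borel_measurable M"
    and "\<And>y. f y \<le> g y + t"
  shows "max_fun M f x \<le> max_fun M g x + t"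
proof (rule max_fun_le)
  fix c r assume r: "(0::real) < r" "x \<in> ball c r"
  have "ball_int M f c r \<le> (\<integral>\<^sup>+y. g y * indicator (ball c r) y + t * indicator (ball c r) y \<partial>M)"
    using assms(2) by (intro nn_integral_mono) (auto simp: indicator_def)
  also have "\<dots> = ball_int M g c r + t * emeasure M (ball c r)"
    by (simp add: nn_integral_add nn_integral_cmult_indicator)
  also have "\<dots> \<le> (max_fun M g x + t) * emeasure M (ball c r)"
    using nn_integral_ball_le_max_fun[OF r, of g] by (simp add: distrib_right)
  finally show "ball_int M f c r \<le> (max_fun M g x + t) * emeasure M (ball c r)" .
qed

text \<open>The Vitali lemma, which asks for bounded radii, selects disjoint balls whose fivefold
  dilates cover the union. Doubling leads from the dilates back to the selected balls, and
  disjointness means that \<open>f\<close> is integrated at most once.\<close>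

lemma weak_type_bounded:
  fixes R :: real and t :: ennreal
  assumes [measurable]: "f \<in> borel_measurable M"
  defines "K \<equiv> {(c, r). 0 < r \<and> r \<le> R \<and>
      t < ball_int M f c r / emeasure M (ball c r)}"
  shows "t * emeasure M (\<Union>(c, r)\<in>K. ball c r) \<le> ennreal D * (\<integral>\<^sup>+x. f x \<partial>M)"
proof -
  let ?b5 = "\<lambda>i. ball (fst i) (5 * snd i)"
  let ?b = "\<lambda>i. ball (fst i) (snd i)"
  have bd: "0 < snd i \<and> snd i \<le> R" if "i \<in> K" for i
    using that by (auto simp: K_def)
  have sub: "(\<Union>(c, r)\<in>K. ball c r) \<subseteq> (\<Union>i\<in>K. ?b i)"
    by auto
  obtain C where C: "countable C" "C \<subseteq> K"
     "pairwise (\<lambda>i j. disjnt (?b i) (ball (fst j) (snd j))) C"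
     and cover: "(\<Union>(c, r)\<in>K. ball c r) \<subseteq> (\<Union>i\<in>C. ?b5 i)"
    using Vitali_covering_lemma_balls[OF sub bd] by blast
  have df: "disjoint_family_on (\<lambda>i. ?b i) C"
    using C(3) by (auto simp: disjoint_family_on_def pairwise_def disjnt_def)
  have *: "t * emeasure M (?b5 i)
      \<le> ennreal D * (\<integral>\<^sup>+y. f y * indicator (?b i) y \<partial>M)" if "i \<in> C" for i
  proof -
    obtain c r where i: "i = (c, r)" by force
    have r: "0 < r" "t < ball_int M f c r / emeasure M (ball c r)"
      using that C(2) i by (auto simp: K_def)
    have "t * emeasure M (ball c (5 * r)) \<le> t * (ennreal D * emeasure M (ball c r))"
      using ball_5[OF r(1)] by (intro mult_left_mono) auto
    also have "\<dots> = ennreal D * (t * emeasure M (ball c r))"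
      by (simp add: ac_simps)
    also have "\<dots> \<le> ennreal D * (ball_int M f c r / emeasure M (ball c r) * emeasure M (ball c r))"
      using r(2) by (intro mult_left_mono mult_right_mono) auto
    also have "\<dots> = ennreal D * ball_int M f c r"
      using ball_pos[OF r(1), of c] ball_finite[of c r] by (subst ennreal_divide_mult_cancel) auto
    finally show ?thesis by (simp add: i)
  qed
  have "t * emeasure M (\<Union>(c, r)\<in>K. ball c r) \<le> t * emeasure M (\<Union>i\<in>C. ?b5 i)"
    using cover by (intro mult_left_mono emeasure_mono) (auto intro!: open_in_sets)
  also have "emeasure M (\<Union>i\<in>C. ?b5 i)
    \<le> (\<integral>\<^sup>+i. emeasure M (?b5 i) \<partial>count_space C)"
  proof -
    have "emeasure M (\<Union>i\<in>C. ?b5 i)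
      = (\<integral>\<^sup>+x. indicator (\<Union>i\<in>C. ?b5 i) x \<partial>M)"
      by (intro nn_integral_indicator[symmetric] open_in_sets) auto
    also have "\<dots> \<le> (\<integral>\<^sup>+x. \<integral>\<^sup>+i. indicator (?b5 i) x \<partial>count_space C \<partial>M)"
    proof (intro nn_integral_mono)
      fix x
      show "indicator (\<Union>i\<in>C. ?b5 i) x
        \<le> (\<integral>\<^sup>+i. indicator (?b5 i) x \<partial>count_space C :: ennreal)"
      proof (cases "x \<in> (\<Union>i\<in>C. ?b5 i)")
        case True
        then obtain j where j: "j \<in> C" "x \<in> ball (fst j) (5 * snd j)" by auto
        have "1 \<le> (\<integral>\<^sup>+i. indicator {j} i \<partial>count_space C :: ennreal)"
          using j by (subst nn_integral_indicator) (auto simp: one_ennreal_def)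
        also have "\<dots> \<le> (\<integral>\<^sup>+i. indicator (?b5 i) x \<partial>count_space C)"
          using j by (intro nn_integral_mono) (auto simp: indicator_def)
        finally show ?thesis using True by simp
      qed simp
    qed
    also have "\<dots> = (\<integral>\<^sup>+i. \<integral>\<^sup>+x. indicator (?b5 i) x \<partial>M \<partial>count_space C)"
      using C(1) by (intro nn_integral_count_space_nn_integral) auto
    also have "\<dots> = (\<integral>\<^sup>+i. emeasure M (?b5 i) \<partial>count_space C)"
      by (intro nn_integral_cong) auto
    finally show ?thesis .
  qed
  then have "t * emeasure M (\<Union>i\<in>C. ?b5 i)
    \<le> t * (\<integral>\<^sup>+i. emeasure M (?b5 i) \<partial>count_space C)"
    by (intro mult_left_mono) auto
  also have "t * (\<integral>\<^sup>+i. emeasure M (?b5 i) \<partial>count_space C)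
     = (\<integral>\<^sup>+i. t * emeasure M (?b5 i) \<partial>count_space C)"
    by (simp add: nn_integral_cmult)
  also have "\<dots> \<le> (\<integral>\<^sup>+i. ennreal D * (\<integral>\<^sup>+y. f y * indicator (?b i) y \<partial>M) \<partial>count_space C)"
    using * by (intro nn_integral_mono) auto
  \<comment> \<open>Each integral over a ball is read as the mass of the ball under
    \<open>density M f\<close>, so that the sum over the disjoint balls becomes a single mass by
    countable additivity.\<close>
  also have "\<dots> = (\<integral>\<^sup>+i. ennreal D * emeasure (density M f) (?b i) \<partial>count_space C)"
    by (intro nn_integral_cong) (simp add: emeasure_density)
  also have "\<dots> = ennreal D * (\<integral>\<^sup>+i. emeasure (density M f) (?b i) \<partial>count_space C)"
    by (simp add: nn_integral_cmult)
  also have "(\<integral>\<^sup>+i. emeasure (density M f) (?b i) \<partial>count_space C)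
     = emeasure (density M f) (\<Union>i\<in>C. ?b i)"
    using C(1) df by (intro emeasure_UN_countable[symmetric]) auto
  also have "\<dots> \<le> emeasure (density M f) UNIV"
    by (intro emeasure_mono) (auto simp: UNIV_in_sets)
  also have "\<dots> = (\<integral>\<^sup>+x. f x \<partial>M)"
    using emeasure_density[OF assms(1) UNIV_in_sets] by simp
  finally show ?thesis
    by (simp add: mult_left_mono)
qed

text \<open>The bound for radii up to R does not involve R, and the sets increase with R, so
  continuity from below removes the restriction.\<close>

lemma weak_type:
  assumes "f \<in> borel_measurable M"
  shows "t * emeasure M {x. t < max_fun M f x} \<le> ennreal D * (\<integral>\<^sup>+x. f x \<partial>M)"
proof -
  define S where "S R = (\<Union>(c, r)\<in>{(c, r). 0 < r \<and> r \<le> real R \<and>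
      t < ball_int M f c r / emeasure M (ball c r)}. ball c r)" for R :: nat
  have "{x. t < max_fun M f x} = (\<Union>R. S R)"
    unfolding less_max_fun_iff S_def using real_arch_simple by (fastforce simp: set_eq_iff)
  moreover have "emeasure M (\<Union>R. S R) = (SUP R. emeasure M (S R))"
  proof (rule SUP_emeasure_incseq[symmetric])
    show "range S \<subseteq> sets M"
      by (auto simp: S_def intro!: open_in_sets)
    show "incseq S"
    proof (rule incseq_SucI)
      show "S R \<subseteq> S (Suc R)" for R
        unfolding S_def by (intro UN_mono) auto
    qed
  qed
  ultimately have "t * emeasure M {x. t < max_fun M f x} = (SUP R. t * emeasure M (S R))"
    by (simp add: SUP_mult_left_ennreal)
  also have "\<dots> \<le> ennreal D * (\<integral>\<^sup>+x. f x \<partial>M)"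
    unfolding S_def by (intro SUP_least weak_type_bounded assms)
  finally show ?thesis .
qed

text \<open>The extra factor \<open>g\<close> lets one formula serve three times: with 1 and with
  \<open>f\<close> in the maximal theorem, and with an indicator in Kolmogorov's inequality.\<close>

lemma nn_integral_layer_cake:
  assumes [measurable]: "F \<in> borel_measurable M" "g \<in> borel_measurable M" and a: "a > 0"
  shows "(\<integral>\<^sup>+x. g x * epow (F x) a \<partial>M)
    = (\<integral>\<^sup>+t. ennreal (a * t powr (a - 1)) * indicator {0<..} t
         * (\<integral>\<^sup>+x. g x * indicator {x. ennreal t < F x} x \<partial>M) \<partial>lborel)"
proof -
  let ?k = "\<lambda>x t. if 0 < t \<and> ennreal t < F x then ennreal (a * t powr (a - 1)) else 0"
  let ?J = "\<lambda>t::real. \<integral>\<^sup>+x. g x * indicator {x. ennreal t < F x} x \<partial>M"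
  let ?I = "\<lambda>x. \<integral>\<^sup>+t. ennreal (a * t powr (a - 1)) * indicator {t. 0 < t \<and> ennreal t < F x} t \<partial>lborel"
  interpret pair_sigma_finite lborel M
    by standard
  have "(\<integral>\<^sup>+x. g x * epow (F x) a \<partial>M)
    = (\<integral>\<^sup>+x. g x * ?I x \<partial>M)"
    by (simp add: nn_integral_powr_layer[OF a])
  also have "\<dots> = (\<integral>\<^sup>+x. (\<integral>\<^sup>+t. g x * ?k x t \<partial>lborel) \<partial>M)"
  proof (intro nn_integral_cong)
    fix x
    have "?I x
       = (\<integral>\<^sup>+t. ?k x t \<partial>lborel)"
      by (intro nn_integral_cong) auto
    then show "g x * ?I x
       = (\<integral>\<^sup>+t. g x * ?k x t \<partial>lborel)"
      by (simp add: nn_integral_cmult)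
  qed
  also have "\<dots> = (\<integral>\<^sup>+t. (\<integral>\<^sup>+x. g x * ?k x t \<partial>M) \<partial>lborel)"
    by (rule Fubini') measurable
  also have "\<dots> = (\<integral>\<^sup>+t. ennreal (a * t powr (a - 1)) * indicator {0<..} t
         * ?J t \<partial>lborel)"
  proof (intro nn_integral_cong)
    fix t :: real
    have "(\<integral>\<^sup>+x. g x * ?k x t \<partial>M)
      = (\<integral>\<^sup>+x. (ennreal (a * t powr (a - 1)) * indicator {0<..} t) * (g x * indicator {x. ennreal t < F x} x) \<partial>M)"
      by (intro nn_integral_cong) (auto simp: indicator_def mult.commute)
    also have "\<dots> = ennreal (a * t powr (a - 1)) * indicator {0<..} t
         * ?J t"
      by (rule nn_integral_cmult) measurable
    finally show "(\<integral>\<^sup>+x. g x * ?k x t \<partial>M)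
      = ennreal (a * t powr (a - 1)) * indicator {0<..} t
         * ?J t" .
  qed
  finally show ?thesis .
qed

text \<open>To bound \<open>M(f)\<close> above level \<open>t\<close>, only the part of \<open>f\<close> above \<open>t / 2\<close> matters.\<close>

theorem strong_type:
  assumes [measurable]: "f \<in> borel_measurable M" and r: "r > 1"
  shows "(\<integral>\<^sup>+x. epow (max_fun M f x) r \<partial>M)
    \<le> ennreal (2 * r / (r - 1) * 2 powr (r - 1)) * ennreal D * (\<integral>\<^sup>+x. epow (f x) r \<partial>M)"
proof -
  let ?k = "\<lambda>t. ennreal ((r - 1) * t powr (r - 1 - 1))"
  let ?c = "ennreal (2 * r / (r - 1))"
  let ?E = "\<lambda>t::real. {x. ennreal t < max_fun M f x}"
  let ?J = "\<lambda>t::real. \<integral>\<^sup>+x. f x * indicator {x. ennreal t < 2 * f x} x \<partial>M"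
  have level: "ennreal (r * t powr (r - 1)) * emeasure M (?E t)
      \<le> ?c * ennreal D
        * (?k t * ?J t)"
    if t: "t > 0" for t
  proof -
    define g where "g x = f x * indicator {x. ennreal t < 2 * f x} x" for x
    have [measurable]: "g \<in> borel_measurable M"
      unfolding g_def by measurable
    have "f x \<le> g x + ennreal (t / 2)" for x
    proof (cases "ennreal t < 2 * f x")
      case False
      then have "2 * f x \<le> 2 * ennreal (t / 2)"
        using t by (simp add: ennreal_mult[of 2, simplified, symmetric])
      then have "f x \<le> ennreal (t / 2)"
        by (subst (asm) ennreal_mult_le_mult_iff) auto
      then show ?thesis by (simp add: add_increasing)
    qed (simp add: g_def)
    then have "max_fun M f x \<le> max_fun M g x + ennreal (t / 2)" for x
      by (rule max_fun_add_le[rotated]) measurable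
    moreover have "ennreal (t / 2) < y" if "ennreal t < y + ennreal (t / 2)" for y
    proof (rule ccontr)
      assume "\<not> ennreal (t / 2) < y"
      then have "y + ennreal (t / 2) \<le> ennreal (t / 2) + ennreal (t / 2)"
        by (intro add_mono) auto
      also have "\<dots> = ennreal t"
        using t by (simp add: ennreal_plus[symmetric] del: ennreal_plus)
      finally show False using that by simp
    qed
    ultimately have sub: "(?E t) \<subseteq> {x. ennreal (t / 2) < max_fun M g x}"
      by (auto intro: less_le_trans)
    \<comment> \<open>The layer density for the exponent \<open>r\<close> is split into
      \<open>t / 2\<close>, which the weak type inequality at height \<open>t / 2\<close> consumes,
      and the layer density for \<open>r - 1\<close>. Integrated against \<open>f\<close>, the
      latter reproduces \<open>f * (2 f)^(r - 1)\<close>.\<close>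
    have "r * t powr (r - 1) = (2 * r / (r - 1)) * ((r - 1) * t powr (r - 1 - 1)) * (t / 2)"
      using t r powr_add[of t "r - 1 - 1" 1] by simp
    then have "ennreal (r * t powr (r - 1))
       = ?c * ?k t * ennreal (t / 2)"
      using t r by (subst ennreal_mult[symmetric], simp, simp)+ simp
    then have "ennreal (r * t powr (r - 1)) * emeasure M (?E t)
      = ?c * ?k t
         * (ennreal (t / 2) * emeasure M (?E t))"
      by (simp only: mult.assoc)
    also have "\<dots> \<le> ?c * ?k t
         * (ennreal (t / 2) * emeasure M {x. ennreal (t / 2) < max_fun M g x})"
      using sub by (intro mult_left_mono emeasure_mono) (auto intro: open_in_sets open_less_max_fun)
    also have "\<dots> \<le> ?c * ?k t
         * (ennreal D * (\<integral>\<^sup>+x. g x \<partial>M))"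
      by (intro mult_left_mono weak_type) auto
    finally show ?thesis
      by (simp add: g_def ac_simps)
  qed
  have "(\<integral>\<^sup>+x. epow (max_fun M f x) r \<partial>M)
    = (\<integral>\<^sup>+t. ennreal (r * t powr (r - 1)) * indicator {0<..} t
         * (\<integral>\<^sup>+x. 1 * indicator (?E t) x \<partial>M) \<partial>lborel)"
    using nn_integral_layer_cake[of "max_fun M f" "\<lambda>_. 1" r] r by simp
  also have "\<dots> \<le> (\<integral>\<^sup>+t. ?c * ennreal D
        * (?k t * indicator {0<..} t
         * ?J t) \<partial>lborel)"
    using level by (intro nn_integral_mono) (auto simp: indicator_def[of "{0<..}"] open_in_sets open_less_max_fun)
  also have "\<dots> = ?c * ennreal D
        * (\<integral>\<^sup>+t. ?k t * indicator {0<..} t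
         * ?J t \<partial>lborel)"
    by (rule nn_integral_cmult) measurable
  also have "\<dots> = ?c * ennreal D * (\<integral>\<^sup>+x. f x * epow (2 * f x) (r - 1) \<partial>M)"
    using nn_integral_layer_cake[of "\<lambda>x. 2 * f x" f "r - 1"] r by simp
  also have "(\<lambda>x. f x * epow (2 * f x) (r - 1)) = (\<lambda>x. ennreal (2 powr (r - 1)) * epow (f x) r)"
  proof
    fix x
    have "epow (f x) r = epow (f x) 1 * epow (f x) (r - 1)"
      using r by (subst epow_add[symmetric]) auto
    then show "f x * epow (2 * f x) (r - 1) = ennreal (2 powr (r - 1)) * epow (f x) r"
      using r epow_ennreal[of 2 "r - 1"] by (simp add: epow_mult ac_simps)
  qed
  also have "(\<integral>\<^sup>+x. ennreal (2 powr (r - 1)) * epow (f x) r \<partial>M)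
     = ennreal (2 powr (r - 1)) * (\<integral>\<^sup>+x. epow (f x) r \<partial>M)"
    by (rule nn_integral_cmult) measurable
  finally have "(\<integral>\<^sup>+x. epow (max_fun M f x) r \<partial>M)
    \<le> ?c * ennreal (2 powr (r - 1)) * ennreal D * (\<integral>\<^sup>+x. epow (f x) r \<partial>M)"
    by (simp only: ac_simps)
  then show ?thesis
    by (subst ennreal_mult) (use r in auto)
qed

text \<open>The part of \<open>E\<close> above height t has measure at most
  \<open>emeasure M E\<close>, and at most \<open>D / t\<close> times the integral of
  \<open>f\<close>. The first bound is integrated against \<open>d t^(d - 1)\<close> over small t,
  the second over large t, where \<open>d < 1\<close> gives convergence at infinity.\<close>

theorem Kolmogorov_max_fun:
  assumes [measurable]: "f \<in> borel_measurable M" "E \<in> sets M" and d: "0 < d" "d < 1"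
    and D: "0 \<le> D"
  shows "(\<integral>\<^sup>+x\<in>E. epow (max_fun M f x) d \<partial>M)
    \<le> ennreal (1 + D * d / (1 - d)) * epow (emeasure M E) (1 - d) * epow (\<integral>\<^sup>+x. f x \<partial>M) d"
    (is "?L \<le> ?R")
proof -
  let ?k = "\<lambda>t. ennreal (d * t powr (d - 1))"
  let ?l = "\<lambda>t. ennreal (D * d * t powr (d - 2))"
  let ?E = "\<lambda>t::real. {x. ennreal t < max_fun M f x}"
  define m where "m = emeasure M E"
  define I where "I = (\<integral>\<^sup>+x. f x \<partial>M)"
  have C: "0 < 1 + D * d / (1 - d)"
    using d D by (simp add: add_pos_nonneg)
  consider "m = 0" | "I = 0" | "m \<noteq> 0" "I \<noteq> 0" "m = \<infinity> \<or> I = \<infinity>"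
    | m' I' where "0 < m'" "m = ennreal m'" "0 < I'" "I = ennreal I'"
    by (metis ennreal_cases_pos)
  then show ?thesis
  proof cases
    case 1
    then have "AE x in M. x \<notin> E"
      by (intro AE_not_in) (auto simp: m_def)
    then have "?L = (\<integral>\<^sup>+x. 0 \<partial>M)"
      by (intro nn_integral_cong_AE) (auto simp: indicator_def)
    then show ?thesis by simp
  next
    case 2
    have "max_fun M f x \<le> 0" for x
    proof (rule max_fun_le)
      fix c r
      have "ball_int M f c r \<le> I"
        unfolding I_def by (intro nn_integral_mono) (auto simp: indicator_def)
      then show "ball_int M f c r \<le> 0 * emeasure M (ball c r)"
        using 2 by simp
    qed
    then show ?thesis using d by simp
  next
    case 3
    then have "epow m (1 - d) * epow I d = \<infinity>"
      using d epow_eq_top_iff[of "1 - d" m] epow_eq_top_iff[of d I]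
      by (auto simp: ennreal_mult_eq_top_iff epow_eq_0_iff)
    then have "?R = \<infinity>"
      using C by (simp add: mult.assoc m_def I_def ennreal_mult_eq_top_iff)
    then show ?thesis by simp
  next
    case 4
    \<comment> \<open>The height at which the two bounds balance, the factor \<open>D\<close> left
      aside.\<close>
    define l where "l = I' / m'"
    have l: "l > 0" using 4 by (simp add: l_def)
    have int1: "((\<lambda>t. d * t powr (d - 1)) has_integral d * (l powr (d - 1 + 1) / (d - 1 + 1))) {0..l}"
      using d l by (intro has_integral_mult_right has_integral_powr_from_0) auto
    have int2: "((\<lambda>t. D * d * t powr (d - 2)) has_integral D * d * (- (l powr (d - 2 + 1)) / (d - 2 + 1))) {l..}"
      using d l by (intro has_integral_mult_right has_integral_powr_to_inf) auto
    have "?L = (\<integral>\<^sup>+x. indicator E x * epow (max_fun M f x) d \<partial>M)"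
      by (simp add: mult.commute)
    also have "\<dots> = (\<integral>\<^sup>+t. ?k t * indicator {0<..} t
         * (\<integral>\<^sup>+x. indicator E x * indicator (?E t) x \<partial>M) \<partial>lborel)"
      using d by (intro nn_integral_layer_cake) auto
    also have "\<dots> \<le> (\<integral>\<^sup>+t. m * (?k t * indicator {0..l} t)
         + I * (?l t * indicator {l..} t) \<partial>lborel)"
    proof (intro nn_integral_mono)
      fix t :: real
      define e where "e = (\<integral>\<^sup>+x. indicator E x * indicator (?E t) x \<partial>M)"
      have e1: "e \<le> m"
        unfolding e_def m_def nn_integral_indicator[OF assms(2), symmetric]
        by (intro nn_integral_mono) (auto simp: indicator_def)
      have "e \<le> (\<integral>\<^sup>+x. indicator (?E t) x \<partial>M)"
        unfolding e_def by (intro nn_integral_mono) (auto simp: indicator_def)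
      also have "\<dots> = emeasure M (?E t)"
        by (simp add: open_in_sets open_less_max_fun)
      finally have "ennreal t * e \<le> ennreal t * emeasure M (?E t)"
        by (intro mult_left_mono) auto
      also have "\<dots> \<le> ennreal D * I"
        unfolding I_def by (rule weak_type) measurable
      finally have e2: "ennreal t * e \<le> ennreal D * I" .
      consider "t \<le> 0" | "0 < t" "t < l" | "0 < t" "l \<le> t" by linarith
      then show "?k t * indicator {0<..} t * e
         \<le> m * (?k t * indicator {0..l} t)
         + I * (?l t * indicator {l..} t)"
      proof cases
        case 2
        then show ?thesis
          using e1 by (simp add: mult.commute mult_right_mono)
      next
        case 3
        have "d * t powr (d - 1) = d * t powr (d - 2) * t"
          using 3 powr_add[of t "d - 2" 1] by simp
        then have "?k t * e = ennreal (d * t powr (d - 2)) * (ennreal t * e)"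
          using 3 d by (simp add: ennreal_mult mult.assoc)
        also have "\<dots> \<le> ennreal (d * t powr (d - 2)) * (ennreal D * I)"
          by (intro mult_left_mono e2) auto
        also have "\<dots> = I * ?l t"
          using d D by (simp add: ennreal_mult ac_simps)
        finally show ?thesis
          using 3 by (simp add: add_increasing)
      qed auto
    qed
    also have "\<dots> = m * (\<integral>\<^sup>+t. ?k t * indicator {0..l} t \<partial>lborel)
         + I * (\<integral>\<^sup>+t. ?l t * indicator {l..} t \<partial>lborel)"
      by (simp add: nn_integral_add nn_integral_cmult)
    also have "(\<integral>\<^sup>+t. ?k t * indicator {0..l} t \<partial>lborel) = ennreal (l powr d)"
      using nn_integral_has_integral_lebesgue'[OF _ int1] d by simp
    also have "(\<integral>\<^sup>+t. ?l t * indicator {l..} t \<partial>lborel)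
        = ennreal (D * d / (1 - d) * l powr (d - 1))"
    proof -
      have "D * d * (- (l powr (d - 2 + 1)) / (d - 2 + 1)) = D * d / (1 - d) * l powr (d - 1)"
        using d by (simp add: divide_simps) (simp add: algebra_simps)
      then show ?thesis
        using nn_integral_has_integral_lebesgue'[OF _ int2] d D by simp
    qed
    also have "m * ennreal (l powr d) + I * ennreal (D * d / (1 - d) * l powr (d - 1))
       = ennreal (m' * l powr d + I' * (D * d / (1 - d) * l powr (d - 1)))"
    proof -
      have "0 \<le> D * d / (1 - d) * l powr (d - 1)"
        using d D by simp
      then show ?thesis
        using 4 by (simp only: ennreal_mult[symmetric] ennreal_plus[symmetric] powr_ge_zero
            less_imp_le mult_nonneg_nonneg)
    qed
    also have "m' * l powr d + I' * (D * d / (1 - d) * l powr (d - 1))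
       = (1 + D * d / (1 - d)) * m' powr (1 - d) * I' powr d"
    proof -
      have "m' * l powr d = m' powr (1 - d) * I' powr d"
        using 4 by (simp add: l_def powr_divide powr_diff)
      moreover have "I' * l powr (d - 1) = m' powr (1 - d) * I' powr d"
        using 4 by (simp add: l_def powr_divide powr_diff)
      ultimately show ?thesis by algebra
    qed
    also have "ennreal \<dots> = ?R"
      using 4 C by (simp add: m_def[symmetric] I_def[symmetric] epow_ennreal ennreal_mult)
    finally show ?thesis .
  qed
qed

lemma D_ge_1: "1 \<le> D"
proof -
  have "emeasure M (ball 0 1) \<le> emeasure M (ball 0 (5 * 1))"
    by (intro emeasure_mono) auto
  also have "\<dots> \<le> ennreal D * emeasure M (ball 0 1)"
    by (intro ball_5) auto
  finally have "emeasure M (ball 0 1) * 1 \<le> emeasure M (ball 0 1) * ennreal D"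
    by (simp add: mult.commute)
  then have "1 \<le> ennreal D"
    using ball_pos[of 1 0] ball_finite[of 0 1] by (subst (asm) ennreal_mult_le_mult_iff) auto
  then show ?thesis by simp
qed

end

definition strong_const :: "real \<Rightarrow> real \<Rightarrow> real" where
  "strong_const r D = 2 * r / (r - 1) * 2 powr (r - 1) * D"

lemma strong_const_pos: "r > 1 \<Longrightarrow> D > 0 \<Longrightarrow> strong_const r D > 0"
  by (simp add: strong_const_def)

context doubling
begin

lemma strong_type':
  assumes "f \<in> borel_measurable M" "r > 1"
  shows "(\<integral>\<^sup>+x. epow (max_fun M f x) r \<partial>M) \<le> ennreal (strong_const r D) * (\<integral>\<^sup>+x. epow (f x) r \<partial>M)"
  using strong_type[OF assms] D_ge_1 assms(2) unfolding strong_const_def by (subst ennreal_mult) auto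

end

section \<open>Sparse families\<close>

text \<open>Split off one factor: \<open>x * epow x (t - 1)\<close> can only grow when the second
  factor is evaluated at \<open>x + y\<close>. Later \<open>t = q / p\<close>, and the hypothesis
  \<open>p \<le> q\<close> makes it at least 1.\<close>

lemma epow_add_le:
  assumes "t \<ge> 1"
  shows "epow x t + epow y t \<le> epow (x + y) t"
proof -
  have *: "epow z t = z * epow z (t - 1)" for z
    using epow_add[of 1 "t - 1" z] assms by simp
  have "epow x t + epow y t \<le> x * epow (x + y) (t - 1) + y * epow (x + y) (t - 1)"
    unfolding * using assms by (intro add_mono mult_left_mono epow_mono) auto
  also have "\<dots> = epow (x + y) t"
    unfolding *[of "x + y"] by (simp add: distrib_right)
  finally show ?thesis .
qed

lemma sum_epow_le:
  assumes "finite I" "t \<ge> 1"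
  shows "(\<Sum>i\<in>I. epow (X i) t) \<le> epow (\<Sum>i\<in>I. X i) t"
  using assms(1)
proof (induction I)
  case (insert i I)
  then have "(\<Sum>i\<in>insert i I. epow (X i) t) \<le> epow (X i) t + epow (\<Sum>i\<in>I. X i) t"
    by (simp add: add_left_mono)
  also have "\<dots> \<le> epow (X i + (\<Sum>i\<in>I. X i)) t"
    by (rule epow_add_le[OF assms(2)])
  finally show ?case using insert by simp
qed simp

lemma sum_indicator_disjoint:
  fixes f :: "'i \<Rightarrow> ennreal"
  assumes "finite I" "disjoint_family_on F I" "j \<in> I" "x \<in> F j"
  shows "(\<Sum>i\<in>I. f i * indicator (F i) x) = f j"
proof -
  have "(\<Sum>i\<in>I. f i * indicator (F i) x) = (\<Sum>i\<in>I. if i = j then f j else 0)"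
    using assms by (intro sum.cong) (auto simp: disjoint_family_on_def indicator_def)
  then show ?thesis using assms by simp
qed

lemma epow_sum_indicator_disjoint:
  assumes "finite I" "disjoint_family_on F I" "q > 0"
  shows "epow (\<Sum>i\<in>I. c i * indicator (F i) x) q = (\<Sum>i\<in>I. epow (c i) q * indicator (F i) x)"
proof (cases "\<exists>j\<in>I. x \<in> F j")
  case True
  then obtain j where "j \<in> I" "x \<in> F j" by auto
  then show ?thesis
    using sum_indicator_disjoint[OF assms(1,2), of j x] by simp
next
  case False
  then have "(\<Sum>i\<in>I. c i * indicator (F i) x) = 0" "(\<Sum>i\<in>I. epow (c i) q * indicator (F i) x) = 0"
    by (auto intro!: sum.neutral)
  then show ?thesis using assms by simp
qed

context doubling
begin

definition ball_avg :: "('a \<Rightarrow> ennreal) \<Rightarrow> 'a \<Rightarrow> real \<Rightarrow> ennreal" where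
  "ball_avg f z R = (\<integral>\<^sup>+y\<in>ball z R. f y \<partial>M) / emeasure M (ball z R)"

lemma ball_avg_le_max_fun: "0 < R \<Longrightarrow> x \<in> ball z R \<Longrightarrow> ball_avg f z R \<le> max_fun M f x"
  unfolding ball_avg_def max_fun_def by (intro SUP_upper2[where i = "(z, R)"]) auto

lemma ball_avg_mult:
  "0 < R \<Longrightarrow> ball_avg f z R * emeasure M (ball z R) = (\<integral>\<^sup>+y\<in>ball z R. f y \<partial>M)"
  unfolding ball_avg_def using ball_pos[of R z] ball_finite[of z R]
  by (intro ennreal_divide_mult_cancel) auto

text \<open>The average is a lower bound for the maximal function at every point of the ball, in
  particular throughout \<open>F\<close>, which carries a fixed share of the mass.\<close>

lemma epow_ball_avg_le:
  assumes "F \<in> sets M" "F \<subseteq> ball z R" "0 < R" "0 \<le> r"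
    and C0: "emeasure M (ball z R) \<le> ennreal C0 * emeasure M F"
  shows "epow (ball_avg f z R) r * emeasure M (ball z R)
     \<le> ennreal C0 * (\<integral>\<^sup>+x\<in>F. epow (max_fun M f x) r \<partial>M)"
proof -
  have "epow (ball_avg f z R) r * emeasure M (ball z R)
     \<le> epow (ball_avg f z R) r * (ennreal C0 * emeasure M F)"
    by (intro mult_left_mono C0) auto
  also have "\<dots> = ennreal C0 * (\<integral>\<^sup>+x\<in>F. epow (ball_avg f z R) r \<partial>M)"
    using nn_integral_cmult_indicator[OF assms(1)] by (simp add: mult.left_commute)
  also have "\<dots> \<le> ennreal C0 * (\<integral>\<^sup>+x\<in>F. epow (max_fun M f x) r \<partial>M)"
    using assms(2-4)
    by (intro mult_left_mono nn_integral_mono)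
       (auto simp: indicator_def intro!: epow_mono ball_avg_le_max_fun)
  finally show ?thesis .
qed

lemma nn_integral_ball_le_sparse:
  assumes "F \<in> sets M" "F \<subseteq> ball z R" "0 < R"
    and C0: "emeasure M (ball z R) \<le> ennreal C0 * emeasure M F"
  shows "(\<integral>\<^sup>+y\<in>ball z R. f y \<partial>M) \<le> ennreal C0 * (\<integral>\<^sup>+x\<in>F. max_fun M f x \<partial>M)"
  using epow_ball_avg_le[OF assms(1-3) _ C0, of 1 f] assms(3) by (simp add: ball_avg_mult)

end

text \<open>\<open>P i\<close> supports the i-th summand, \<open>F i\<close> is its private part,
  and the ball around \<open>P i\<close> is what the maximal function sees. The index set is finite
  so that norms are finite and may be cancelled; constants do not depend on its size.\<close>

locale sparse_family = doubling M D for M :: "'a::euclidean_space measure" and D +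
  fixes I :: "'i set" and P F :: "'i \<Rightarrow> 'a set" and z :: "'i \<Rightarrow> 'a" and R :: "'i \<Rightarrow> real" and C0 :: real
  assumes finite_I: "finite I"
    and C0_pos: "C0 > 0"
    and P_sets: "i \<in> I \<Longrightarrow> P i \<in> sets M"
    and F_sets: "i \<in> I \<Longrightarrow> F i \<in> sets M"
    and F_le_P: "i \<in> I \<Longrightarrow> F i \<subseteq> P i"
    and P_le_ball: "i \<in> I \<Longrightarrow> P i \<subseteq> ball (z i) (R i)"
    and R_pos: "i \<in> I \<Longrightarrow> 0 < R i"
    and F_disjoint: "disjoint_family_on F I"
    and F_large: "i \<in> I \<Longrightarrow> emeasure M (ball (z i) (R i)) \<le> ennreal C0 * emeasure M (F i)"
begin

lemma F_le_ball: "i \<in> I \<Longrightarrow> F i \<subseteq> ball (z i) (R i)"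
  using F_le_P P_le_ball by blast

lemma sum_nn_integral_F_le:
  assumes [measurable]: "f \<in> borel_measurable M"
  shows "(\<Sum>i\<in>I. \<integral>\<^sup>+x\<in>F i. f x \<partial>M) \<le> (\<integral>\<^sup>+x. f x \<partial>M)"
proof -
  note [measurable] = F_sets
  have "(\<Sum>i\<in>I. \<integral>\<^sup>+x\<in>F i. f x \<partial>M) = (\<integral>\<^sup>+x. f x * (\<Sum>i\<in>I. 1 * indicator (F i) x) \<partial>M)"
    by (simp add: nn_integral_sum[symmetric] sum_distrib_left)
  also have "\<dots> \<le> (\<integral>\<^sup>+x. f x * 1 \<partial>M)"
  proof (intro nn_integral_mono mult_left_mono)
    fix x
    show "(\<Sum>i\<in>I. 1 * indicator (F i) x) \<le> (1::ennreal)"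
    proof (cases "\<exists>j\<in>I. x \<in> F j")
      case True
      then obtain j where "j \<in> I" "x \<in> F j" by auto
      then show ?thesis
        using sum_indicator_disjoint[OF finite_I F_disjoint, of j x "\<lambda>_. 1"] by simp
    next
      case False
      then have "(\<Sum>i\<in>I. 1 * indicator (F i) x) = (0::ennreal)"
        by (auto intro!: sum.neutral)
      then show ?thesis by simp
    qed
  qed auto
  finally show ?thesis by simp
qed

text \<open>The sum S is tested against its own power: \<open>S^q = S * S^(q - 1)\<close>. Each
  integral over \<open>P i\<close> moves to \<open>F i\<close> at the cost of a maximal function,
  and Hoelder's inequality with the maximal theorem in \<open>L^q'\<close> gives
  \<open>X \<le> C * Y^(1/q) * X^(1/q')\<close>, from which the power of X is divided out.\<close>

theorem sparse_Lq_bound: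
  fixes c :: "'i \<Rightarrow> ennreal"
  assumes c: "\<And>i. i \<in> I \<Longrightarrow> c i < \<infinity>" and q: "q > 1"
  defines "q' \<equiv> q / (q - 1)"
  shows "(\<integral>\<^sup>+x. epow (\<Sum>i\<in>I. c i * indicator (P i) x) q \<partial>M)
     \<le> ennreal ((C0 * strong_const q' D powr (1 / q')) powr q) * (\<Sum>i\<in>I. epow (c i) q * emeasure M (F i))"
proof -
  note [measurable] = P_sets F_sets
  have q': "q' > 1" "1 / q + 1 / q' = 1"
    using q by (auto simp: q'_def field_simps)
  define K where "K = strong_const q' D"
  have K: "K > 0"
    unfolding K_def using q' D_ge_1 by (intro strong_const_pos) auto
  define S where "S x = (\<Sum>i\<in>I. c i * indicator (P i) x)" for x
  define T where "T x = (\<Sum>i\<in>I. c i * indicator (F i) x)" for x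
  have [measurable]: "S \<in> borel_measurable M" "T \<in> borel_measurable M"
    unfolding S_def T_def by measurable
  let ?N = "max_fun M (\<lambda>x. epow (S x) (q - 1))"
  define X where "X = (\<integral>\<^sup>+x. epow (S x) q \<partial>M)"
  define Y where "Y = (\<Sum>i\<in>I. epow (c i) q * emeasure M (F i))"
  \<comment> \<open>Disjointness of the \<open>F i\<close> turns the q-th power of the sum into the
    sum of q-th powers.\<close>
  have Y_eq: "Y = (\<integral>\<^sup>+x. epow (T x) q \<partial>M)"
    unfolding Y_def T_def using q
    by (subst epow_sum_indicator_disjoint[OF finite_I F_disjoint])
       (simp_all add: nn_integral_sum nn_integral_cmult_indicator F_sets)
  \<comment> \<open>The cancellation at the end is legitimate only for finite \<open>X\<close>; here
    finiteness of the family and of its coefficients enters.\<close>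
  have fin: "X < \<infinity>"
  proof -
    define B where "B = (\<Sum>i\<in>I. c i)"
    define U where "U = (\<Union>i\<in>I. P i)"
    have "B < \<infinity>"
      using c finite_I by (auto simp: B_def)
    moreover have "emeasure M U < \<infinity>"
    proof -
      have "emeasure M U \<le> (\<Sum>i\<in>I. emeasure M (P i))"
        unfolding U_def using finite_I P_sets by (intro emeasure_subadditive_finite) auto
      also have "\<dots> \<le> (\<Sum>i\<in>I. emeasure M (ball (z i) (R i)))"
        by (intro sum_mono emeasure_mono P_le_ball) auto
      also have "\<dots> < \<infinity>"
        using finite_I ball_finite by auto
      finally show ?thesis .
    qed
    moreover have "X \<le> (\<integral>\<^sup>+x. epow B q * indicator U x \<partial>M)"
      unfolding X_def
    proof (intro nn_integral_mono)
      fix x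
      have "S x \<le> B"
        unfolding S_def B_def by (intro sum_mono) (auto simp: indicator_def)
      moreover have "S x = 0" if "x \<notin> U"
        using that unfolding S_def U_def by (auto intro!: sum.neutral)
      ultimately show "epow (S x) q \<le> epow B q * indicator U x"
        using q by (cases "x \<in> U") (auto intro: epow_mono)
    qed
    moreover have "U \<in> sets M"
      unfolding U_def using finite_I P_sets by auto
    ultimately have "X \<le> epow B q * emeasure M U" "epow B q < \<infinity>"
      using q epow_less_top[of q B] by (auto simp: nn_integral_cmult_indicator)
    with \<open>emeasure M U < \<infinity>\<close> show ?thesis
      by (auto simp: ennreal_mult_less_top intro: le_less_trans)
  qed
  have "X = (\<integral>\<^sup>+x. (\<Sum>i\<in>I. c i * (epow (S x) (q - 1) * indicator (P i) x)) \<partial>M)"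
    unfolding X_def
  proof (intro nn_integral_cong)
    fix x
    have "epow (S x) q = S x * epow (S x) (q - 1)"
      using epow_add[of 1 "q - 1" "S x"] q by simp
    also have "\<dots> = (\<Sum>i\<in>I. c i * (epow (S x) (q - 1) * indicator (P i) x))"
      unfolding S_def[of x] sum_distrib_right by (simp only: ac_simps)
    finally show "epow (S x) q = \<dots>" .
  qed
  also have "\<dots> = (\<Sum>i\<in>I. c i * (\<integral>\<^sup>+x\<in>P i. epow (S x) (q - 1) \<partial>M))"
    by (subst nn_integral_sum) (auto intro!: sum.cong nn_integral_cmult)
  also have "\<dots> \<le> (\<Sum>i\<in>I. c i * (ennreal C0 * (\<integral>\<^sup>+x\<in>F i. ?N x \<partial>M)))"
  proof (intro sum_mono mult_left_mono)
    fix i assume i: "i \<in> I"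
    have "(\<integral>\<^sup>+x\<in>P i. epow (S x) (q - 1) \<partial>M) \<le> (\<integral>\<^sup>+x\<in>ball (z i) (R i). epow (S x) (q - 1) \<partial>M)"
      using P_le_ball[OF i] by (intro nn_integral_mono) (auto simp: indicator_def)
    also have "\<dots> \<le> ennreal C0 * (\<integral>\<^sup>+x\<in>F i. ?N x \<partial>M)"
      by (intro nn_integral_ball_le_sparse F_sets F_le_ball R_pos F_large i)
    finally show "(\<integral>\<^sup>+x\<in>P i. epow (S x) (q - 1) \<partial>M) \<le> \<dots>" .
  qed auto
  also have "\<dots> = (\<Sum>i\<in>I. (\<integral>\<^sup>+x. ennreal C0 * ((c i * indicator (F i) x) * ?N x) \<partial>M))"
  proof (intro sum.cong refl)
    fix i assume "i \<in> I"
    then have [measurable]: "F i \<in> sets M" by (rule F_sets)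
    have "c i * (ennreal C0 * (\<integral>\<^sup>+x\<in>F i. ?N x \<partial>M))
      = (\<integral>\<^sup>+x. c i * (ennreal C0 * (?N x * indicator (F i) x)) \<partial>M)"
      by (simp add: nn_integral_cmult)
    then show "c i * (ennreal C0 * (\<integral>\<^sup>+x\<in>F i. ?N x \<partial>M))
      = (\<integral>\<^sup>+x. ennreal C0 * ((c i * indicator (F i) x) * ?N x) \<partial>M)"
      by (simp add: ac_simps)
  qed
  also have "\<dots> = (\<integral>\<^sup>+x. ennreal C0 * (T x * ?N x) \<partial>M)"
    by (subst nn_integral_sum[symmetric]) (auto simp: T_def sum_distrib_left sum_distrib_right)
  also have "\<dots> = ennreal C0 * (\<integral>\<^sup>+x. T x * ?N x \<partial>M)"
    by (rule nn_integral_cmult) measurable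
  also have "\<dots> \<le> ennreal C0 * (epow (\<integral>\<^sup>+x. epow (T x) q \<partial>M) (1 / q)
      * epow (\<integral>\<^sup>+x. epow (?N x) q' \<partial>M) (1 / q'))"
    using q q' by (intro mult_left_mono Holder_nn_integral) auto
  also have "\<dots> \<le> ennreal C0 * (epow Y (1 / q) * epow (ennreal K * X) (1 / q'))"
  proof -
    have "(\<integral>\<^sup>+x. epow (?N x) q' \<partial>M)
      \<le> ennreal K * (\<integral>\<^sup>+x. epow (epow (S x) (q - 1)) q' \<partial>M)"
      unfolding K_def using q' by (intro strong_type') auto
    also have "\<dots> = ennreal K * X"
      using q by (simp add: epow_epow X_def q'_def)
    finally show ?thesis
      unfolding Y_eq using q' by (intro mult_left_mono epow_mono) auto
  qed
  finally have main: "X \<le> ennreal C0 * (epow Y (1 / q) * epow (ennreal K * X) (1 / q'))" .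
  have "X \<le> ennreal ((C0 * K powr (1 / q')) powr q) * Y"
  proof (cases "X = 0")
    case False
    then have X: "0 < X" by (simp add: zero_less_iff_neq_zero)
    define Z where "Z = epow X (1 / q')"
    have Z: "0 < Z" "Z < \<infinity>"
      unfolding Z_def using X fin by (auto intro: epow_pos epow_finite[simplified])
    have "Z * epow X (1 / q) = X"
      unfolding Z_def using q' q epow_add[of "1 / q'" "1 / q" X] by (simp add: add.commute)
    moreover have "ennreal C0 * (epow Y (1 / q) * epow (ennreal K * X) (1 / q'))
       = Z * (ennreal (C0 * K powr (1 / q')) * epow Y (1 / q))"
      using q' K C0_pos
      by (simp add: epow_mult epow_ennreal Z_def ennreal_mult ac_simps)
    ultimately have "Z * epow X (1 / q) \<le> Z * (ennreal (C0 * K powr (1 / q')) * epow Y (1 / q))"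
      using main by simp
    then have "epow X (1 / q) \<le> ennreal (C0 * K powr (1 / q')) * epow Y (1 / q)"
      using Z by (subst (asm) ennreal_mult_le_mult_iff) auto
    then have "epow (epow X (1 / q)) q \<le> epow (ennreal (C0 * K powr (1 / q')) * epow Y (1 / q)) q"
      using q by (intro epow_mono) auto
    then show ?thesis
      using q C0_pos K by (simp add: epow_epow epow_mult epow_ennreal)
  qed simp
  then show ?thesis
    by (simp add: X_def S_def Y_def K_def)
qed

text \<open>With b the mass of a ball and a the average of \<open>h\<close>, the q-th power of the
  coefficient times b is \<open>(a^r * b)^(q/p)\<close>, since
  \<open>(1/p - 1/q) * q + 1 = q/p\<close>. As \<open>q/p\<close> is at least 1, the sum of these is
  at most the power of the sum of \<open>a^r * b\<close>, and that sum is controlled by the maximal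
  theorem with exponent \<open>r\<close>.\<close>

theorem sparse_fractional_bound:
  assumes [measurable]: "h \<in> borel_measurable M" and p: "1 < p" "p \<le> q" and r: "r > 1"
  defines "q' \<equiv> q / (q - 1)"
  shows "(\<integral>\<^sup>+x. epow (\<Sum>i\<in>I. epow (emeasure M (ball (z i) (R i))) (1 / p - 1 / q)
            * epow (ball_avg h (z i) (R i)) (r / p) * indicator (P i) x) q \<partial>M)
     \<le> ennreal ((C0 * strong_const q' D powr (1 / q')) powr q * (C0 * strong_const r D) powr (q / p))
       * epow (\<integral>\<^sup>+x. epow (h x) r \<partial>M) (q / p)"
proof -
  define H where "H = (\<integral>\<^sup>+x. epow (h x) r \<partial>M)"
  define b where "b i = emeasure M (ball (z i) (R i))" for i
  define a where "a i = ball_avg h (z i) (R i)" for i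
  define K where "K = strong_const r D"
  define L where "L = (C0 * strong_const q' D powr (1 / q')) powr q"
  have q: "q > 1" "q' > 1" using p by (auto simp: q'_def)
  have K: "K > 0"
    unfolding K_def using r D_ge_1 by (intro strong_const_pos) auto
  have "strong_const q' D > 0"
    using q D_ge_1 by (intro strong_const_pos) auto
  then have L: "L > 0"
    using C0_pos by (auto simp: L_def)
  have sum_le: "(\<Sum>i\<in>I. epow (a i) r * b i) \<le> ennreal (C0 * K) * H"
  proof -
    have "(\<Sum>i\<in>I. epow (a i) r * b i) \<le> (\<Sum>i\<in>I. ennreal C0 * (\<integral>\<^sup>+x\<in>F i. epow (max_fun M h x) r \<partial>M))"
      unfolding a_def b_def using r
      by (intro sum_mono epow_ball_avg_le F_sets F_le_ball R_pos F_large) auto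
    also have "\<dots> = ennreal C0 * (\<Sum>i\<in>I. (\<integral>\<^sup>+x\<in>F i. epow (max_fun M h x) r \<partial>M))"
      by (simp add: sum_distrib_left)
    also have "\<dots> \<le> ennreal C0 * (\<integral>\<^sup>+x. epow (max_fun M h x) r \<partial>M)"
      by (intro mult_left_mono sum_nn_integral_F_le) auto
    also have "\<dots> \<le> ennreal C0 * (ennreal K * H)"
      unfolding K_def H_def using r by (intro mult_left_mono strong_type') auto
    finally show ?thesis
      using C0_pos K by (simp add: ennreal_mult mult.assoc)
  qed
  show ?thesis
  proof (cases "H = \<infinity>")
    case True
    have "ennreal (L * (C0 * K) powr (q / p)) * epow H (q / p) = \<infinity>"
      using True p q L C0_pos K by (simp add: ennreal_mult_top)
    then show ?thesis by (simp add: H_def L_def K_def)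
  next
    case False
    \<comment> \<open>The sum over the finite family is bounded by a finite quantity and every ball
      has positive mass, so no average can be infinite.\<close>
    have a_fin: "a i < \<infinity>" if "i \<in> I" for i
    proof -
      have "epow (a i) r * b i \<le> (\<Sum>i\<in>I. epow (a i) r * b i)"
        using that finite_I by (intro member_le_sum) auto
      also have "\<dots> < \<infinity>"
      proof -
        have "ennreal (C0 * K) * H < \<infinity>"
          using False by (simp add: ennreal_mult_less_top less_top)
        then show ?thesis using sum_le by (rule le_less_trans[rotated])
      qed
      finally have "epow (a i) r * b i < \<infinity>" .
      moreover have "b i > 0"
        unfolding b_def using R_pos[OF that] by (rule ball_pos)
      ultimately have "epow (a i) r \<noteq> \<infinity>"
        by (auto simp: ennreal_top_mult split: if_splits)
      then show ?thesis
        using r epow_eq_top_iff[of r "a i"] by (auto simp: less_top)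
    qed
    define c where "c i = epow (b i) (1 / p - 1 / q) * epow (a i) (r / p)" for i
    have \<kappa>: "1 / p - 1 / q \<ge> 0"
      using p by (simp add: field_simps)
    have "c i < \<infinity>" if "i \<in> I" for i
    proof -
      have "epow (b i) (1 / p - 1 / q) < \<infinity>"
        unfolding b_def using ball_pos[OF R_pos[OF that]] ball_finite by (intro epow_finite) auto
      moreover have "epow (a i) (r / p) < \<infinity>"
        using a_fin[OF that] r p by (intro epow_less_top) auto
      ultimately show ?thesis
        by (auto simp: c_def ennreal_mult_less_top)
    qed
    then have "(\<integral>\<^sup>+x. epow (\<Sum>i\<in>I. c i * indicator (P i) x) q \<partial>M)
       \<le> ennreal L * (\<Sum>i\<in>I. epow (c i) q * emeasure M (F i))"
      unfolding L_def q'_def by (rule sparse_Lq_bound) (use q in auto)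
    also have "\<dots> \<le> ennreal L * (\<Sum>i\<in>I. epow (epow (a i) r * b i) (q / p))"
    proof (intro mult_left_mono sum_mono)
      fix i assume i: "i \<in> I"
      have "epow (c i) q * emeasure M (F i) \<le> epow (c i) q * b i"
        unfolding b_def by (intro mult_left_mono emeasure_mono F_le_ball i) auto
      also have "\<dots> = epow (a i) (r * (q / p)) * (epow (b i) ((1 / p - 1 / q) * q) * epow (b i) 1)"
        using q by (simp add: c_def epow_mult epow_epow ac_simps)
      also have "epow (b i) ((1 / p - 1 / q) * q) * epow (b i) 1 = epow (b i) ((1 / p - 1 / q) * q + 1)"
        using \<kappa> q by (intro epow_add[symmetric]) auto
      also have "(1 / p - 1 / q) * q + 1 = q / p"
        using q by (simp add: field_simps)
      also have "epow (a i) (r * (q / p)) * epow (b i) (q / p) = epow (epow (a i) r * b i) (q / p)"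
        using q p by (simp add: epow_mult epow_epow)
      finally show "epow (c i) q * emeasure M (F i) \<le> epow (epow (a i) r * b i) (q / p)" .
    qed auto
    also have "\<dots> \<le> ennreal L * epow (\<Sum>i\<in>I. epow (a i) r * b i) (q / p)"
      using p by (intro mult_left_mono sum_epow_le finite_I) auto
    also have "\<dots> \<le> ennreal L * epow (ennreal (C0 * K) * H) (q / p)"
      using p q by (intro mult_left_mono epow_mono sum_le) auto
    also have "\<dots> = ennreal (L * (C0 * K) powr (q / p)) * epow H (q / p)"
      using p q L C0_pos K by (simp add: epow_mult epow_ennreal ennreal_mult powr_mult mult.assoc)
    finally show ?thesis
      by (simp add: H_def L_def K_def c_def a_def b_def)
  qed
qed

end

section \<open>Dyadic cubes\<close>

text \<open>The fibres of this map are the half-open dyadic cubes of side \<open>2 powr j\<close>;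
  in terms of indices, the parent of a cube is given by integer division by 2.\<close>

definition dyadic_index :: "int \<Rightarrow> real ^ 'n \<Rightarrow> int ^ 'n" where
  "dyadic_index j x = (\<chi> i. \<lfloor>x $ i / 2 powr j\<rfloor>)"

definition dyadic_corner :: "int \<Rightarrow> int ^ 'n \<Rightarrow> real ^ 'n" where
  "dyadic_corner j m = (\<chi> i. m $ i * 2 powr j)"

definition dyadic_cube :: "int \<Rightarrow> int ^ 'n \<Rightarrow> (real ^ 'n) set" where
  "dyadic_cube j m = {x. dyadic_index j x = m}"

text \<open>The factor \<open>3 n + 2\<close> makes the balls of nested dyadic cubes nested.\<close>

definition dyadic_radius :: "'n itself \<Rightarrow> int \<Rightarrow> real" where
  "dyadic_radius _ j = (3 * real CARD('n) + 2) * 2 powr j"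

abbreviation dyadic_ball :: "int \<Rightarrow> int ^ 'n \<Rightarrow> (real ^ 'n) set" where
  "dyadic_ball j m \<equiv> ball (dyadic_corner j m) (dyadic_radius TYPE('n) j)"

lemma dyadic_radius_pos: "dyadic_radius TYPE('n::finite) j > 0"
  by (simp add: dyadic_radius_def add_nonneg_pos)

lemma dist_dyadic_corner_le:
  fixes x :: "real ^ 'n::finite"
  shows "dist (dyadic_corner j (dyadic_index j x)) x \<le> real CARD('n) * 2 powr j"
proof -
  have "\<bar>(dyadic_corner j (dyadic_index j x) - x) $ i\<bar> \<le> 2 powr j" for i
  proof -
    have "\<lfloor>x $ i / 2 powr j\<rfloor> * 2 powr j \<le> x $ i" "x $ i < (\<lfloor>x $ i / 2 powr j\<rfloor> + 1) * 2 powr j"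
      using floor_divide_lower[of "2 powr j" "x $ i"] floor_divide_upper[of "2 powr j" "x $ i"] by simp_all
    then show ?thesis
      by (simp add: dyadic_corner_def dyadic_index_def algebra_simps)
  qed
  then have "norm (dyadic_corner j (dyadic_index j x) - x) \<le> (\<Sum>i::'n\<in>UNIV. 2 powr j)"
    by (intro order_trans[OF norm_le_l1_cart] sum_mono)
  then show ?thesis by (simp add: dist_norm)
qed

lemma dyadic_cube_subset_ball: "dyadic_cube j m \<subseteq> dyadic_ball j (m :: int ^ 'n::finite)"
proof
  fix x assume "x \<in> dyadic_cube j m"
  then have m: "m = dyadic_index j x" by (simp add: dyadic_cube_def)
  have "dist (dyadic_corner j m) x \<le> real CARD('n) * 2 powr j"
    unfolding m by (rule dist_dyadic_corner_le)
  also have "\<dots> < dyadic_radius TYPE('n) j"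
    unfolding dyadic_radius_def by (intro mult_strict_right_mono) (auto intro: le_less_trans[of _ "3 * real CARD('n)"])
  finally show "x \<in> dyadic_ball j m" by simp
qed

text \<open>The enlarged ball reaches distance \<open>2 powr j\<close> in every direction even from
  a point near the boundary of its cube, so a single dyadic grid captures all pairs of points at
  this distance.\<close>

lemma cball_subset_dyadic_ball: "cball x (2 powr j) \<subseteq> dyadic_ball j (dyadic_index j (x :: real ^ 'n::finite))"
proof
  fix y assume "y \<in> cball x (2 powr j)"
  then have "dist (dyadic_corner j (dyadic_index j x)) y \<le> real CARD('n) * 2 powr j + 2 powr j"
    using dist_dyadic_corner_le[of j x] dist_triangle[of "dyadic_corner j (dyadic_index j x)" y x]
    by (simp add: dist_commute)
  also have "\<dots> = (real CARD('n) + 1) * 2 powr j" by (simp add: algebra_simps)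
  also have "\<dots> < dyadic_radius TYPE('n) j"
    unfolding dyadic_radius_def by (intro mult_strict_right_mono) auto
  finally show "y \<in> dyadic_ball j (dyadic_index j x)" by simp
qed

lemma dyadic_ball_mono_Suc:
  "dyadic_ball j (dyadic_index j x) \<subseteq> dyadic_ball (j + 1) (dyadic_index (j + 1) (x :: real ^ 'n::finite))"
proof
  fix y assume y: "y \<in> dyadic_ball j (dyadic_index j x)"
  define c where "c = dyadic_corner j (dyadic_index j x)"
  define c' where "c' = dyadic_corner (j + 1) (dyadic_index (j + 1) x)"
  have p: "2 powr real_of_int (j + 1) = 2 * 2 powr j"
    by (simp add: powr_add)
  \<comment> \<open>Through \<open>x\<close>, the corners of a cube and of its parent are at most
    \<open>3 n * 2 powr j\<close> apart, while the two radii differ by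
    \<open>(3 n + 2) * 2 powr j\<close>.\<close>
  have "dist c' x \<le> real CARD('n) * (2 * 2 powr j)" "dist c x \<le> real CARD('n) * 2 powr j"
    using dist_dyadic_corner_le[of "j + 1" x] dist_dyadic_corner_le[of j x] unfolding c'_def c_def p by auto
  moreover have "dist c' y \<le> dist c' x + dist c x + dist c y"
    using dist_triangle[of c' y c] dist_triangle[of c' c x] by (simp add: dist_commute)
  moreover have "dist c y < (3 * real CARD('n) + 2) * 2 powr j"
    using y by (simp add: c_def dyadic_radius_def)
  ultimately have "dist c' y < (3 * real CARD('n) + 2) * 2 powr j + 3 * real CARD('n) * 2 powr j"
    by (simp add: algebra_simps)
  also have "\<dots> \<le> (3 * real CARD('n) + 2) * (2 * 2 powr j)"
    by (simp add: algebra_simps)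
  finally show "y \<in> dyadic_ball (j + 1) (dyadic_index (j + 1) x)"
    using p by (simp add: c'_def dyadic_radius_def)
qed

lemma dyadic_ball_mono:
  assumes "j \<le> i"
  shows "dyadic_ball j (dyadic_index j x) \<subseteq> dyadic_ball i (dyadic_index i (x :: real ^ 'n::finite))"
  using assms
proof (induction i rule: int_ge_induct)
  case (step i)
  then show ?case using dyadic_ball_mono_Suc[of i x] by blast
qed simp

lemma dyadic_index_Suc: "dyadic_index (j + 1) x = (\<chi> i. dyadic_index j x $ i div 2)"
proof -
  have "x $ i / 2 powr real_of_int (j + 1) = (x $ i / 2 powr j) / real_of_int 2" for i
    by (simp add: powr_add)
  then show ?thesis
    unfolding dyadic_index_def by (simp only: floor_divide_real_eq_div) simp
qed

lemma dyadic_index_eq_mono: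
  assumes "j \<le> i" "dyadic_index j x = dyadic_index j y"
  shows "dyadic_index i x = dyadic_index i y"
  using assms(1)
  by (induction i rule: int_ge_induct) (auto simp: assms(2) dyadic_index_Suc)

lemma sets_dyadic_cube: "dyadic_cube j (m :: int ^ 'n::finite) \<in> sets borel"
proof -
  have "dyadic_cube j m = {x. \<forall>i. \<lfloor>x $ i / 2 powr j\<rfloor> = m $ i}"
    by (simp add: dyadic_cube_def dyadic_index_def vec_eq_iff)
  also have "\<dots> = {x. \<forall>i. m $ i \<le> x $ i / 2 powr j \<and> x $ i / 2 powr j < m $ i + 1}"
    by (simp add: floor_eq_iff)
  also have "\<dots> \<in> sets borel"
    by measurable
  finally show ?thesis .
qed

lemma sets_dyadic_cube_lebesgue: "dyadic_cube j (m :: int ^ 'n::finite) \<in> sets lebesgue"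
  using sets_dyadic_cube[of j m] by (intro sets_completionI_sets) simp

lemma measurable_dyadic_index: "dyadic_index j \<in> measurable lebesgue (count_space (UNIV :: (int ^ 'n::finite) set))"
proof -
  have "dyadic_index j -` {m} \<inter> space lebesgue \<in> sets lebesgue" for m :: "int ^ 'n"
    using sets_dyadic_cube_lebesgue[of j m] by (simp add: vimage_def dyadic_cube_def)
  then show ?thesis
    by (simp add: measurable_count_space_eq2_countable)
qed

lemma emeasure_dyadic_cube_ge:
  fixes m :: "int ^ 'n::finite"
  shows "ennreal (2 powr (j * real CARD('n))) \<le> emeasure lebesgue (dyadic_cube j m)"
proof -
  define c where "c = dyadic_corner j m"
  define d where "d = c + (\<chi> i. 2 powr j)"
  have "box c d \<subseteq> dyadic_cube j m"
  proof
    fix x assume x: "x \<in> box c d"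
    have "\<lfloor>x $ i / 2 powr j\<rfloor> = m $ i" for i
    proof -
      have "m $ i * 2 powr j < x $ i" "x $ i < m $ i * 2 powr j + 2 powr j"
        using x by (auto simp: mem_box_cart c_def d_def dyadic_corner_def)
      then show ?thesis
        by (intro floor_unique) (simp_all add: field_simps)
    qed
    then show "x \<in> dyadic_cube j m"
      by (simp add: dyadic_cube_def dyadic_index_def vec_eq_iff)
  qed
  then have "emeasure lebesgue (box c d) \<le> emeasure lebesgue (dyadic_cube j m)"
    by (intro emeasure_mono sets_dyadic_cube_lebesgue)
  moreover have "emeasure lebesgue (box c d) = ennreal (2 powr (j * real CARD('n)))"
  proof -
    have "emeasure lborel (box c d) = ennreal (\<Prod>b\<in>Basis. (d - c) \<bullet> b)"
      by (rule emeasure_lborel_box) (auto simp: d_def inner_add_left Basis_vec_def inner_axis)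
    also have "(\<Prod>b\<in>Basis. (d - c) \<bullet> b) = (\<Prod>b\<in>(Basis :: (real ^ 'n) set). 2 powr j)"
      by (intro prod.cong) (auto simp: d_def Basis_vec_def inner_axis)
    also have "\<dots> = 2 powr (j * real CARD('n))"
      by (simp add: powr_powr[symmetric] powr_realpow)
    finally show ?thesis by simp
  qed
  ultimately show ?thesis by simp
qed

interpretation lebesgue: doubling "lebesgue :: 'a::euclidean_space measure" "5 ^ DIM('a)"
proof
  fix c :: 'a and r :: real
  show "emeasure lebesgue (ball c r) < \<infinity>"
    by (cases "0 \<le> r") (simp_all add: emeasure_ball ball_empty less_top)
  assume r: "0 < r"
  then show "0 < emeasure lebesgue (ball c r)"
    by (simp add: emeasure_ball)
  show "emeasure lebesgue (ball c (5 * r)) \<le> ennreal (5 ^ DIM('a)) * emeasure lebesgue (ball c r)"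
    using r by (simp add: emeasure_ball ennreal_mult[symmetric] power_mult_distrib ac_simps del: ennreal_power)
qed simp

text \<open>The quotient of the volume of a dyadic ball by that of its cube, the same at all
  scales.\<close>

definition dyadic_vol :: "'n::finite itself \<Rightarrow> real" where
  "dyadic_vol _ = unit_ball_vol (real CARD('n)) * (3 * real CARD('n) + 2) ^ CARD('n)"

lemma dyadic_vol_pos: "dyadic_vol TYPE('n::finite) > 0"
  by (auto simp: dyadic_vol_def intro!: mult_pos_pos zero_less_power add_nonneg_pos)

lemma emeasure_dyadic_ball:
  fixes m :: "int ^ 'n::finite"
  shows "emeasure lebesgue (dyadic_ball j m) = ennreal (dyadic_vol TYPE('n) * 2 powr (j * real CARD('n)))"
proof -
  have "dyadic_radius TYPE('n) j ^ CARD('n)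
     = (3 * real CARD('n) + 2) ^ CARD('n) * 2 powr (j * real CARD('n))"
    by (simp add: dyadic_radius_def power_mult_distrib powr_powr[symmetric] powr_realpow)
  then show ?thesis
    using dyadic_radius_pos[where 'n='n, of j]
    by (simp add: emeasure_ball dyadic_vol_def mult.assoc)
qed

section \<open>Principal cubes\<close>

text \<open>For \<open>a > 1\<close> and \<open>t > 0\<close>, the largest integer power of
  \<open>a\<close> strictly below \<open>t\<close>.\<close>

definition level :: "real \<Rightarrow> real \<Rightarrow> real" where
  "level a t = a powr (real_of_int \<lceil>log a t\<rceil> - 1)"

lemma level_pos: "a > 1 \<Longrightarrow> level a t > 0"
  by (simp add: level_def)

lemma level_less:
  assumes "a > 1" "t > 0"
  shows "level a t < t"
proof -
  have "a powr (real_of_int \<lceil>log a t\<rceil> - 1) < a powr (log a t)"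
    using assms by (intro powr_less_mono) linarith+
  then show ?thesis using assms by (simp add: level_def)
qed

lemma le_level:
  assumes "a > 1" "t > 0"
  shows "t \<le> a * level a t"
proof -
  have "a powr (log a t) \<le> a powr (1 + (real_of_int \<lceil>log a t\<rceil> - 1))"
    using assms by (intro powr_mono) linarith+
  also have "\<dots> = a * level a t"
    using assms by (subst powr_add) (simp add: level_def)
  finally show ?thesis using assms by simp
qed

text \<open>\<open>level a t\<close> is itself a power of \<open>a\<close> below \<open>t'\<close>,
  hence competes for being the largest one.\<close>

lemma level_less_imp_le:
  assumes "a > 1" "t' > 0" "level a t < t'"
  shows "level a t \<le> level a t'"
proof -
  have "\<lceil>log a t\<rceil> - 1 < log a t'"
    using assms by (subst less_log_iff) (auto simp: level_def)
  then have "\<lceil>log a t\<rceil> \<le> \<lceil>log a t'\<rceil>" by linarith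
  then show ?thesis
    unfolding level_def using assms by (intro powr_mono) auto
qed

lemma level_less_level_imp_le:
  assumes "a > 1" "level a t < level a t'"
  shows "a * level a t \<le> level a t'"
proof -
  have "\<lceil>log a t\<rceil> < \<lceil>log a t'\<rceil>"
    using assms by (simp add: level_def)
  then have "1 + (real_of_int \<lceil>log a t\<rceil> - 1) \<le> real_of_int \<lceil>log a t'\<rceil> - 1" by linarith
  then have "a powr (1 + (real_of_int \<lceil>log a t\<rceil> - 1)) \<le> a powr (real_of_int \<lceil>log a t'\<rceil> - 1)"
    using assms by (intro powr_mono) auto
  then show ?thesis
    using assms by (subst (asm) powr_add) (simp add: level_def)
qed

text \<open>The integral extends over the ball but is divided by the volume of the cube, which keeps
  the powers of 2 free of dimensional constants. \<open>enn2real\<close> loses nothing where the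
  integrals over balls are finite.\<close>

definition dyadic_avg :: "(real ^ 'n \<Rightarrow> ennreal) \<Rightarrow> int \<Rightarrow> int ^ 'n \<Rightarrow> real" where
  "dyadic_avg f j m = enn2real (\<integral>\<^sup>+y\<in>dyadic_ball j m. f y \<partial>lebesgue) * 2 powr (- (j * real CARD('n)))"

text \<open>The ratio of consecutive levels; the last summand makes the cubes sparse by the weak type
  inequality, the others bound the growth of the averages from a cube to its parent.\<close>

definition level_ratio :: "'n::finite itself \<Rightarrow> real" where
  "level_ratio _ = 2 ^ CARD('n) + 1 + 4 * dyadic_vol TYPE('n) * 5 ^ CARD('n) * 2 ^ CARD('n)"

text \<open>Decay at large scales is what makes stopping cubes exist: the scales at which the
  averages around a point exceed a given level are bounded above.\<close>

locale decaying_averages =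
  fixes f :: "real ^ 'n::finite \<Rightarrow> ennreal" and a :: real
  assumes a_def: "a = level_ratio TYPE('n)"
    and f_measurable [measurable]: "f \<in> borel_measurable lebesgue"
    and f_finite: "ball_int lebesgue f c r < \<infinity>"
    and avg_decay: "0 < t \<Longrightarrow> \<exists>J. \<forall>l>J. dyadic_avg f l (dyadic_index l x) \<le> t"
begin

lemma a_gt: "a > 2 ^ CARD('n)" "a > 1"
proof -
  have "0 < 4 * dyadic_vol TYPE('n) * 5 ^ CARD('n) * 2 ^ CARD('n)"
    using dyadic_vol_pos[where 'n = 'n] by simp
  then show "a > 2 ^ CARD('n)" unfolding a_def level_ratio_def by linarith
  then show "a > 1"
    by (rule le_less_trans[rotated]) simp
qed

abbreviation A :: "int \<Rightarrow> int ^ 'n \<Rightarrow> real" where "A \<equiv> dyadic_avg f"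

lemma A_nonneg: "A j m \<ge> 0"
  by (simp add: dyadic_avg_def)

lemma nn_integral_dyadic_ball:
  "(\<integral>\<^sup>+y\<in>dyadic_ball j m. f y \<partial>lebesgue) = ennreal (A j m * 2 powr (j * real CARD('n)))"
  using f_finite by (simp add: dyadic_avg_def powr_add[symmetric] mult.assoc)

text \<open>The balls are nested and the volumes of the cubes differ by \<open>2^n\<close>, so from
  a cube to its parent the average drops at most by this factor.\<close>

lemma A_Suc: "A j (dyadic_index j x) \<le> 2 ^ CARD('n) * A (j + 1) (dyadic_index (j + 1) x)"
proof -
  have "(\<integral>\<^sup>+y\<in>dyadic_ball j (dyadic_index j x). f y \<partial>lebesgue)
    \<le> (\<integral>\<^sup>+y\<in>dyadic_ball (j + 1) (dyadic_index (j + 1) x). f y \<partial>lebesgue)"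
    using dyadic_ball_mono_Suc[of j x] by (intro nn_integral_mono) (auto simp: indicator_def)
  then have "A j (dyadic_index j x) * 2 powr (j * real CARD('n))
     \<le> A (j + 1) (dyadic_index (j + 1) x) * 2 powr ((j + 1) * real CARD('n))"
    unfolding nn_integral_dyadic_ball using A_nonneg by (subst (asm) ennreal_le_iff) auto
  also have "2 powr ((j + 1) * real CARD('n)) = 2 powr (j * real CARD('n)) * 2 ^ CARD('n)"
    by (simp add: distrib_right powr_add powr_realpow)
  finally have "A j (dyadic_index j x) * 2 powr (j * real CARD('n))
     \<le> (2 ^ CARD('n) * A (j + 1) (dyadic_index (j + 1) x)) * 2 powr (j * real CARD('n))"
    by (simp add: ac_simps)
  then show ?thesis by (rule mult_right_le_imp_le) simp
qed

text \<open>The stopping cubes of the Calderon-Zygmund selection for all levels at once: the average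
  of such a cube exceeds its level, those of all its ancestors do not. Ancestors are addressed
  through a point of the cube.\<close>

definition principal :: "int \<Rightarrow> int ^ 'n \<Rightarrow> bool" where
  "principal j m \<longleftrightarrow> 0 < A j m \<and>
     (\<forall>l>j. \<forall>x. dyadic_index j x = m \<longrightarrow> A l (dyadic_index l x) \<le> level a (A j m))"

text \<open>These are the points of the cube at which no average, at any scale, passes the next
  level. They serve as the disjoint large parts of the sparse family.\<close>

definition core :: "int \<Rightarrow> int ^ 'n \<Rightarrow> (real ^ 'n) set" where
  "core j m = {y. dyadic_index j y = m \<and> (\<forall>i. A i (dyadic_index i y) \<le> a * level a (A j m))}"

text \<open>Take the largest scale \<open>i\<close> at which the average around \<open>x\<close>
  exceeds the level \<open>k\<close> of the starting cube. The level of the cube found is at least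
  \<open>k\<close>, whereas all averages above it are at most \<open>k\<close>.\<close>

lemma ex_principal:
  assumes "0 < A j (dyadic_index j x)"
  obtains i where "j \<le> i" "principal i (dyadic_index i x)"
    "A j (dyadic_index j x) \<le> a * A i (dyadic_index i x)"
proof -
  let ?A = "\<lambda>j. A j (dyadic_index j x)"
  define k where "k = level a (?A j)"
  have k: "k > 0" "k < ?A j" "?A j \<le> a * k"
    using a_gt assms by (auto simp: k_def level_pos level_less le_level)
  define L where "L = {l. j \<le> l \<and> k < ?A l}"
  obtain J where J: "\<And>l. l > J \<Longrightarrow> ?A l \<le> k"
    using avg_decay[OF k(1)] by blast
  have "L \<subseteq> {j..J}"
    using J by (force simp: L_def not_less[symmetric])
  then have fin: "finite L" by (rule finite_subset) simp
  have "j \<in> L" using k by (simp add: L_def)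
  define i where "i = Max L"
  have i: "i \<in> L" "\<And>l. l \<in> L \<Longrightarrow> l \<le> i"
    using \<open>j \<in> L\<close> Max_in[OF fin] Max_ge[OF fin] unfolding i_def by blast+
  then have Ai: "j \<le> i" "k < ?A i" by (auto simp: L_def)
  have ki: "k \<le> level a (?A i)"
    using Ai k a_gt unfolding k_def by (intro level_less_imp_le) auto
  have "principal i (dyadic_index i x)"
    unfolding principal_def
  proof (intro conjI allI impI)
    show "0 < ?A i" using Ai k by simp
    fix l y assume l: "i < l" and y: "dyadic_index i y = dyadic_index i x"
    have "dyadic_index l y = dyadic_index l x"
      using l y by (intro dyadic_index_eq_mono[of i l]) auto
    moreover have "l \<notin> L" using i(2) l by force
    ultimately show "A l (dyadic_index l y) \<le> level a (?A i)"
      using ki Ai l by (auto simp: L_def)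
  qed
  moreover have "?A j \<le> a * ?A i"
    using k Ai a_gt by (smt (verit) mult_left_mono)
  ultimately show thesis using that Ai by blast
qed

lemma core_subset: "core j m \<subseteq> dyadic_cube j m"
  by (auto simp: core_def dyadic_cube_def)

lemma sets_core: "core j m \<in> sets lebesgue"
proof -
  note [measurable] = measurable_dyadic_index
  have "{y \<in> space lebesgue. dyadic_index j y = m \<and> (\<forall>i. A i (dyadic_index i y) \<le> a * level a (A j m))}
     \<in> sets lebesgue"
    by measurable
  then show ?thesis by (simp add: core_def)
qed

text \<open>Principality of the smaller cube puts the average of the larger one at most at the level
  of the smaller, so the level of the larger is a strictly lower power of \<open>a\<close>. Then the
  average of the smaller cube passes the next level of the larger one, and \<open>y\<close> cannot
  be in the core of the larger.\<close>

lemma core_disjoint_aux: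
  assumes "principal i (dyadic_index i y)" "principal j (dyadic_index j y)"
    and "y \<in> core i (dyadic_index i y)" "y \<in> core j (dyadic_index j y)"
  shows "\<not> i < j"
proof
  assume ij: "i < j"
  let ?a = "A i (dyadic_index i y)" and ?b = "A j (dyadic_index j y)"
  have pos: "0 < ?a" "0 < ?b" using assms by (auto simp: principal_def)
  have b: "?b \<le> level a ?a"
    using assms(1) ij by (auto simp: principal_def)
  then have "level a ?b < level a ?a"
    using level_less[OF a_gt(2) pos(2)] by linarith
  then have "a * level a ?b \<le> level a ?a"
    using a_gt by (intro level_less_level_imp_le) auto
  moreover have "?a \<le> a * level a ?b"
    using assms(4) by (auto simp: core_def)
  ultimately show False
    using level_less[OF a_gt(2) pos(1)] by linarith
qed

lemma core_disjoint:
  "disjoint_family_on (\<lambda>(j, m). core j m) {(j, m). principal j m}"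
proof -
  have "(i, m) = (j, m')" if "principal i m" "principal j m'" "y \<in> core i m" "y \<in> core j m'" for i j m m' y
  proof -
    have "m = dyadic_index i y" "m' = dyadic_index j y"
      using that by (auto simp: core_def)
    then show ?thesis
      using core_disjoint_aux[of i y j] core_disjoint_aux[of j y i] that by force
  qed
  then show ?thesis
    by (auto simp: disjoint_family_on_def)
qed

text \<open>A point lost from the cube has a large average at some smaller scale, hence a large
  maximal function of \<open>f\<close> restricted to the ball of the cube. By the weak type
  inequality and the size of \<open>a\<close> such points fill at most half of the cube.\<close>

lemma emeasure_core_ge:
  assumes pr: "principal j m"
  shows "emeasure lebesgue (dyadic_ball j m) \<le> ennreal (2 * dyadic_vol TYPE('n)) * emeasure lebesgue (core j m)"
proof -
  define V where "V = dyadic_vol TYPE('n)"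
  define k where "k = level a (A j m)"
  define s where "s = 2 powr (j * real CARD('n))"
  have V: "V > 0" by (simp add: V_def dyadic_vol_pos)
  have k: "k > 0" using a_gt by (simp add: k_def level_pos)
  have s: "s > 0" by (simp add: s_def)
  have "emeasure lebesgue (dyadic_cube j m) > 0"
    by (rule less_le_trans[OF _ emeasure_dyadic_cube_ge]) simp
  then obtain x0 where "x0 \<in> dyadic_cube j m"
    by (metis emeasure_empty equals0I less_irrefl)
  then have x0: "dyadic_index j x0 = m" by (simp add: dyadic_cube_def)
  have up: "A l (dyadic_index l y) \<le> k" if "j < l" "dyadic_index j y = m" for l y
    using pr that by (auto simp: principal_def k_def)
  have Ajm: "A j m \<le> 2 ^ CARD('n) * k"
  proof -
    have "A j m \<le> 2 ^ CARD('n) * A (j + 1) (dyadic_index (j + 1) x0)"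
      using A_Suc[of j x0] by (simp add: x0)
    also have "\<dots> \<le> 2 ^ CARD('n) * k"
      using up[of "j + 1" x0] x0 by (intro mult_left_mono) auto
    finally show ?thesis .
  qed
  also have "\<dots> < a * k" using a_gt k by simp
  finally have Ajm': "A j m < a * k" .
  define g where "g y = f y * indicator (dyadic_ball j m) y" for y
  have [measurable]: "g \<in> borel_measurable lebesgue"
    unfolding g_def by measurable
  \<comment> \<open>The factor \<open>V\<close> converts division by the volume of a cube into
    division by the volume of its ball; half of the resulting height suffices.\<close>
  define Bad where "Bad = {y. ennreal (a * k / (2 * V)) < max_fun lebesgue g y}"
  have bad_sub: "dyadic_cube j m - core j m \<subseteq> Bad"
  proof
    fix y assume "y \<in> dyadic_cube j m - core j m"
    then have y: "dyadic_index j y = m" and "\<exists>i. \<not> A i (dyadic_index i y) \<le> a * k"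
      by (auto simp: core_def dyadic_cube_def k_def)
    then obtain i where i: "a * k < A i (dyadic_index i y)" by (auto simp: not_le)
    \<comment> \<open>Ancestors stay below \<open>k\<close> by principality, and the cube itself
      stays below \<open>a * k\<close> by the growth bound towards its parent. Only smaller scales
      remain, and their balls lie in the ball of the cube, where \<open>g\<close> agrees with
      \<open>f\<close>.\<close>
    have "i < j"
    proof (rule ccontr)
      assume "\<not> i < j"
      then consider "i = j" | "j < i" by linarith
      then show False
      proof cases
        case 1
        then show ?thesis using i y Ajm' by simp
      next
        case 2
        have "k \<le> a * k" using k a_gt by simp
        then show ?thesis using up[OF 2 y] i by simp
      qed
    qed
    define b where "b = dyadic_ball i (dyadic_index i y)"
    have "b \<subseteq> dyadic_ball j m"
      unfolding b_def using dyadic_ball_mono[of i j y] \<open>i < j\<close> y by simp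
    then have "ennreal (A i (dyadic_index i y) * 2 powr (i * real CARD('n))) = (\<integral>\<^sup>+x\<in>b. g x \<partial>lebesgue)"
      unfolding b_def nn_integral_dyadic_ball[symmetric] g_def
      by (intro nn_integral_cong) (auto simp: indicator_def)
    also have "\<dots> \<le> max_fun lebesgue g y * emeasure lebesgue b"
      unfolding b_def using dyadic_cube_subset_ball[of i "dyadic_index i y"]
      by (intro lebesgue.nn_integral_ball_le_max_fun dyadic_radius_pos) (auto simp: dyadic_cube_def)
    finally have le: "ennreal (A i (dyadic_index i y) * 2 powr (i * real CARD('n)))
        \<le> max_fun lebesgue g y * ennreal (V * 2 powr (i * real CARD('n)))"
      by (simp add: b_def emeasure_dyadic_ball V_def)
    show "y \<in> Bad"
    proof (rule ccontr)
      assume "y \<notin> Bad"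
      then have "max_fun lebesgue g y \<le> ennreal (a * k / (2 * V))"
        by (simp add: Bad_def not_less)
      with le have "ennreal (A i (dyadic_index i y) * 2 powr (i * real CARD('n)))
         \<le> ennreal (a * k / (2 * V)) * ennreal (V * 2 powr (i * real CARD('n)))"
        by (meson mult_right_mono order_trans zero_le)
      also have "\<dots> = ennreal (a * k / 2 * 2 powr (i * real CARD('n)))"
        using V k a_gt by (simp add: ennreal_mult[symmetric])
      finally have "A i (dyadic_index i y) \<le> a * k / 2"
        using A_nonneg k a_gt by (subst (asm) ennreal_le_iff) auto
      then show False using i k a_gt by (smt (verit) field_sum_of_halves mult_pos_pos)
    qed
  qed
  have "ennreal (a * k / (2 * V)) * emeasure lebesgue Bad
     \<le> ennreal (5 ^ CARD('n)) * (\<integral>\<^sup>+x. g x \<partial>lebesgue)"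
    unfolding Bad_def using lebesgue.weak_type[of g "ennreal (a * k / (2 * V))"] by simp
  also have "(\<integral>\<^sup>+x. g x \<partial>lebesgue) = ennreal (A j m * s)"
    unfolding g_def nn_integral_dyadic_ball s_def ..
  also have "ennreal (5 ^ CARD('n)) * \<dots> \<le> ennreal (5 ^ CARD('n) * (2 ^ CARD('n) * k * s))"
    using Ajm s A_nonneg by (subst ennreal_mult[symmetric]) (auto intro!: ennreal_leI mult_left_mono mult_right_mono)
  also have "\<dots> \<le> ennreal (a * k / (2 * V) * (s / 2))"
  proof (rule ennreal_leI)
    \<comment> \<open>The last summand of \<open>level_ratio\<close> is used here:
      \<open>5^n\<close> is the weak type constant, \<open>2^n\<close> the growth bound for
      \<open>A j m\<close>, and \<open>4 * V\<close> combines the \<open>2 * V\<close> in the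
      threshold with the demand for half of the volume.\<close>
    have "4 * V * (5 ^ CARD('n) * 2 ^ CARD('n)) \<le> a"
      by (simp add: a_def level_ratio_def V_def algebra_simps)
    then have "5 ^ CARD('n) * 2 ^ CARD('n) \<le> a / (4 * V)"
      using V by (simp add: field_simps)
    then have "5 ^ CARD('n) * 2 ^ CARD('n) * (k * s) \<le> a / (4 * V) * (k * s)"
      using k s by (intro mult_right_mono) auto
    then show "5 ^ CARD('n) * (2 ^ CARD('n) * k * s) \<le> a * k / (2 * V) * (s / 2)"
      by (simp add: ac_simps)
  qed
  also have "ennreal (a * k / (2 * V) * (s / 2)) = ennreal (a * k / (2 * V)) * ennreal (s / 2)"
    using V k s a_gt by (intro ennreal_mult) auto
  finally have bad: "emeasure lebesgue Bad \<le> ennreal (s / 2)"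
    using V k a_gt by (subst (asm) ennreal_mult_le_mult_iff) auto
  have "ennreal s \<le> emeasure lebesgue (dyadic_cube j m)"
    unfolding s_def by (rule emeasure_dyadic_cube_ge)
  also have "\<dots> \<le> emeasure lebesgue (core j m \<union> Bad)"
    using bad_sub sets_core open_less_max_fun[of "ennreal (a * k / (2 * V))" lebesgue g]
    by (intro emeasure_mono) (auto simp: Bad_def)
  also have "\<dots> \<le> emeasure lebesgue (core j m) + emeasure lebesgue Bad"
    using sets_core open_less_max_fun[of "ennreal (a * k / (2 * V))" lebesgue g]
    by (intro emeasure_subadditive) (auto simp: Bad_def)
  also have "\<dots> \<le> emeasure lebesgue (core j m) + ennreal (s / 2)"
    by (intro add_left_mono bad)
  finally have "ennreal (s / 2) + ennreal (s / 2) \<le> ennreal (s / 2) + emeasure lebesgue (core j m)"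
    using s by (simp add: ennreal_plus[symmetric] add.commute del: ennreal_plus)
  then have half: "ennreal (s / 2) \<le> emeasure lebesgue (core j m)"
    by (subst (asm) ennreal_add_left_cancel_le) auto
  have "emeasure lebesgue (dyadic_ball j m) = ennreal (2 * V) * ennreal (s / 2)"
    using V s by (simp add: emeasure_dyadic_ball V_def s_def ennreal_mult[symmetric])
  also have "\<dots> \<le> ennreal (2 * V) * emeasure lebesgue (core j m)"
    by (intro mult_left_mono half) auto
  finally show ?thesis by (simp add: V_def)
qed

end

section \<open>Sparse domination of the fractional integral\<close>

abbreviation riesz_potential :: "real \<Rightarrow> (real ^ 'n \<Rightarrow> ennreal) \<Rightarrow> real ^ 'n \<Rightarrow> ennreal" where
  "riesz_potential \<alpha> f x \<equiv> \<integral>\<^sup>+y. f y * ennreal (1 / norm (x - y) powr (real CARD('n) - \<alpha>)) \<partial>lebesgue"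

abbreviation scale :: "real \<Rightarrow> int \<Rightarrow> real" where
  "scale \<alpha> j \<equiv> 2 powr (real_of_int j * \<alpha>)"

lemma nn_integral_geometric_int:
  assumes "\<alpha> > 0"
  shows "(\<integral>\<^sup>+j. ennreal (scale \<alpha> j) * indicator {..i} j \<partial>count_space UNIV)
     = ennreal (scale \<alpha> i / (1 - 2 powr (- \<alpha>)))"
proof -
  have q: "0 \<le> 2 powr (- \<alpha>)" "2 powr (- \<alpha>) < 1"
    using assms powr_less_mono[of "- \<alpha>" 0 2] by auto
  have summand: "2 powr (real_of_int (i - int k) * \<alpha>) = scale \<alpha> i * (2 powr (- \<alpha>)) ^ k" for k
  proof -
    have "2 powr (real_of_int (i - int k) * \<alpha>) = 2 powr (real_of_int i * \<alpha> + (- \<alpha>) * real k)"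
      by (simp add: algebra_simps)
    also have "\<dots> = scale \<alpha> i * (2 powr (- \<alpha>)) ^ k"
      by (simp only: powr_add powr_powr[symmetric]) (simp add: powr_realpow)
    finally show ?thesis .
  qed
  have bij: "bij_betw (\<lambda>k. i - int k) UNIV {..i}"
    by (rule bij_betwI[where g = "\<lambda>j. nat (i - j)"]) auto
  have "(\<integral>\<^sup>+j. ennreal (scale \<alpha> j) * indicator {..i} j \<partial>count_space UNIV)
     = (\<integral>\<^sup>+j. ennreal (scale \<alpha> j) \<partial>count_space {..i})"
    by (simp add: nn_integral_count_space_indicator)
  also have "\<dots> = (\<integral>\<^sup>+k. ennreal (2 powr (real_of_int (i - int k) * \<alpha>)) \<partial>count_space UNIV)"
    by (rule nn_integral_bij_count_space[OF bij, symmetric])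
  also have "\<dots> = (\<Sum>k. ennreal (scale \<alpha> i * (2 powr (- \<alpha>)) ^ k))"
    by (simp only: summand nn_integral_count_space_nat)
  also have "\<dots> = ennreal (\<Sum>k. scale \<alpha> i * (2 powr (- \<alpha>)) ^ k)"
    using q by (intro suminf_ennreal2 summable_mult summable_geometric) auto
  also have "(\<Sum>k. scale \<alpha> i * (2 powr (- \<alpha>)) ^ k)
     = scale \<alpha> i / (1 - 2 powr (- \<alpha>))"
    using q by (subst suminf_mult) (auto intro: summable_geometric simp: suminf_geometric)
  finally show ?thesis .
qed

text \<open>A single term of the sum suffices, the one with
  \<open>2^(j - 1) < |x - y| \<le> 2^j\<close>.\<close>

lemma frac_kernel_le:
  fixes x y :: "real ^ 'n::finite"
  assumes "\<alpha> < real CARD('n)"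
  shows "ennreal (1 / norm (x - y) powr (real CARD('n) - \<alpha>))
    \<le> (\<integral>\<^sup>+j. ennreal (2 powr ((real_of_int j - 1) * (\<alpha> - real CARD('n))))
          * indicator (dyadic_ball j (dyadic_index j x)) y \<partial>count_space UNIV)"
\<comment> \<open>On the diagonal the left side has the default value
  \<open>1 / 0 = 0\<close>.\<close>
proof (cases "x = y")
  case False
  define d where "d = norm (x - y)"
  have d: "d > 0" using False by (simp add: d_def)
  define j where "j = \<lceil>log 2 d\<rceil>"
  have "real_of_int j - 1 < log 2 d" "log 2 d \<le> j"
    unfolding j_def by linarith+
  then have j: "2 powr (real_of_int j - 1) < d" "d \<le> 2 powr j"
    using d by (simp_all add: less_log_iff log_le_iff)
  have "1 / d powr (real CARD('n) - \<alpha>) = d powr (\<alpha> - real CARD('n))"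
    using d by (simp add: powr_minus[symmetric] divide_inverse)
  also have "\<dots> \<le> (2 powr (real_of_int j - 1)) powr (\<alpha> - real CARD('n))"
    using assms j by (intro powr_mono2') auto
  also have "\<dots> = 2 powr ((real_of_int j - 1) * (\<alpha> - real CARD('n)))"
    by (simp add: powr_powr)
  finally have "ennreal (1 / d powr (real CARD('n) - \<alpha>))
     \<le> ennreal (2 powr ((real_of_int j - 1) * (\<alpha> - real CARD('n))))
          * indicator (dyadic_ball j (dyadic_index j x)) y"
  proof -
    have "y \<in> dyadic_ball j (dyadic_index j x)"
      using cball_subset_dyadic_ball[of x j] j by (auto simp: d_def dist_norm)
    then show "1 / d powr (real CARD('n) - \<alpha>) \<le> 2 powr ((real_of_int j - 1) * (\<alpha> - real CARD('n))) \<Longrightarrow> ?thesis"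
      by (simp add: ennreal_leI)
  qed
  also have "\<dots> \<le> (\<integral>\<^sup>+j. ennreal (2 powr ((real_of_int j - 1) * (\<alpha> - real CARD('n))))
          * indicator (dyadic_ball j (dyadic_index j x)) y \<partial>count_space UNIV)"
    by (rule nn_integral_ge_point) simp
  finally show ?thesis by (simp add: d_def)
qed simp

context decaying_averages
begin

text \<open>The kernel at scale j, of order \<open>2^(j (\<alpha> - n))\<close>, times the volume
  \<open>2^(j n)\<close> of the cube leaves the weight \<open>2^(j \<alpha>)\<close> on the
  average.\<close>

lemma frac_integral_le_sum_averages:
  assumes "\<alpha> < real CARD('n)"
  shows "riesz_potential \<alpha> f x
    \<le> ennreal (2 powr (real CARD('n) - \<alpha>))
      * (\<integral>\<^sup>+j. ennreal (scale \<alpha> j * A j (dyadic_index j x)) \<partial>count_space UNIV)"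
proof -
  let ?fB = "\<lambda>j y. f y * indicator (dyadic_ball j (dyadic_index j x)) y"
  let ?n = "real CARD('n)"
  define e where "e j = ennreal (2 powr ((real_of_int j - 1) * (\<alpha> - ?n)))" for j
  have "riesz_potential \<alpha> f x
    \<le> (\<integral>\<^sup>+y. f y * (\<integral>\<^sup>+j. e j * indicator (dyadic_ball j (dyadic_index j x)) y \<partial>count_space UNIV) \<partial>lebesgue)"
    unfolding e_def by (intro nn_integral_mono mult_left_mono frac_kernel_le assms) auto
  also have "\<dots> = (\<integral>\<^sup>+y. \<integral>\<^sup>+j. e j * ?fB j y \<partial>count_space UNIV \<partial>lebesgue)"
    by (simp add: nn_integral_cmult[symmetric] mult.left_commute)
  also have "\<dots> = (\<integral>\<^sup>+j. \<integral>\<^sup>+y. e j * ?fB j y \<partial>lebesgue \<partial>count_space UNIV)"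
    by (rule nn_integral_count_space_nn_integral) auto
  also have "\<dots> = (\<integral>\<^sup>+j. ennreal (2 powr (?n - \<alpha>)) * ennreal (scale \<alpha> j * A j (dyadic_index j x)) \<partial>count_space UNIV)"
  proof (intro nn_integral_cong)
    fix j :: int
    have "(\<integral>\<^sup>+y. e j * ?fB j y \<partial>lebesgue)
      = e j * ennreal (A j (dyadic_index j x) * 2 powr (j * ?n))"
      unfolding nn_integral_dyadic_ball[symmetric] by (rule nn_integral_cmult) measurable
    also have "\<dots> = ennreal (2 powr ((real_of_int j - 1) * (\<alpha> - ?n)) * (A j (dyadic_index j x) * 2 powr (j * ?n)))"
      unfolding e_def using A_nonneg by (intro ennreal_mult[symmetric]) auto
    also have "2 powr ((real_of_int j - 1) * (\<alpha> - ?n)) * (A j (dyadic_index j x) * 2 powr (j * ?n))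
      = 2 powr (?n - \<alpha>) * (scale \<alpha> j * A j (dyadic_index j x))"
    proof -
      have "2 powr ((real_of_int j - 1) * (\<alpha> - ?n)) * 2 powr (j * ?n) = 2 powr (?n - \<alpha>) * scale \<alpha> j"
        unfolding powr_add[symmetric] by (simp add: algebra_simps)
      then show ?thesis by (simp add: ac_simps)
    qed
    also have "ennreal \<dots> = ennreal (2 powr (?n - \<alpha>)) * ennreal (scale \<alpha> j * A j (dyadic_index j x))"
      using A_nonneg by (intro ennreal_mult) auto
    finally show "(\<integral>\<^sup>+y. e j * ?fB j y \<partial>lebesgue) = \<dots>" .
  qed
  also have "\<dots> = ennreal (2 powr (?n - \<alpha>)) * (\<integral>\<^sup>+j. ennreal (scale \<alpha> j * A j (dyadic_index j x)) \<partial>count_space UNIV)"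
    by (rule nn_integral_cmult) simp
  finally show ?thesis .
qed

text \<open>Every scale j with a nonzero average is charged to a principal ancestor at some scale
  \<open>i \<ge> j\<close> whose average is comparable. The scales charged to one \<open>i\<close>
  form a geometric series with sum of order \<open>2^(i \<alpha>)\<close>, because \<alpha> is
  positive.\<close>

lemma sum_averages_le_principal:
  assumes \<alpha>: "\<alpha> > 0"
  shows "(\<integral>\<^sup>+j. ennreal (scale \<alpha> j * A j (dyadic_index j x)) \<partial>count_space UNIV)
    \<le> ennreal (a / (1 - 2 powr (- \<alpha>)))
      * (\<integral>\<^sup>+i. (if principal i (dyadic_index i x) then ennreal (scale \<alpha> i * A i (dyadic_index i x)) else 0) \<partial>count_space UNIV)"
    (is "_ \<le> _ * (\<integral>\<^sup>+i. ?t i \<partial>count_space UNIV)")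
proof -
  let ?s = "\<lambda>i j. ennreal (scale \<alpha> j) * indicator {..i} j"
  let ?A = "\<lambda>j. A j (dyadic_index j x)"
  define u where "u i = (if principal i (dyadic_index i x) then ennreal (a * ?A i) else 0)" for i
  have q: "2 powr (- \<alpha>) < 1"
    using \<alpha> powr_less_mono[of "- \<alpha>" 0 2] by auto
  have "(\<integral>\<^sup>+j. ennreal (scale \<alpha> j * ?A j) \<partial>count_space UNIV)
    \<le> (\<integral>\<^sup>+j. \<integral>\<^sup>+i. u i * ?s i j \<partial>count_space UNIV \<partial>count_space UNIV)"
  proof (intro nn_integral_mono)
    fix j :: int
    show "ennreal (scale \<alpha> j * ?A j)
      \<le> (\<integral>\<^sup>+i. u i * ?s i j \<partial>count_space UNIV)"
    proof (cases "?A j = 0")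
      case False
      then have "0 < ?A j" using A_nonneg[of j "dyadic_index j x"] by simp
      then obtain i where i: "j \<le> i" "principal i (dyadic_index i x)"
         "?A j \<le> a * ?A i"
        by (rule ex_principal)
      have "ennreal (scale \<alpha> j * ?A j)
        \<le> ennreal (scale \<alpha> j * (a * ?A i))"
        using i by (intro ennreal_leI mult_left_mono) auto
      also have "\<dots> = u i * ?s i j"
        using i A_nonneg[of i "dyadic_index i x"] a_gt by (simp add: u_def ennreal_mult mult.commute)
      also have "\<dots> \<le> (\<integral>\<^sup>+i. u i * ?s i j \<partial>count_space UNIV)"
        by (rule nn_integral_ge_point) simp
      finally show ?thesis .
    qed simp
  qed
  also have "\<dots> = (\<integral>\<^sup>+i. \<integral>\<^sup>+j. u i * ?s i j \<partial>count_space UNIV \<partial>count_space UNIV)"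
    by (rule nn_integral_count_space_nn_integral) auto
  also have "\<dots> = (\<integral>\<^sup>+i. u i * (\<integral>\<^sup>+j. ennreal (scale \<alpha> j) * indicator {..i} j \<partial>count_space UNIV) \<partial>count_space UNIV)"
    by (intro nn_integral_cong nn_integral_cmult) simp
  also have "\<dots> = (\<integral>\<^sup>+i. ennreal (a / (1 - 2 powr (- \<alpha>))) * ?t i \<partial>count_space UNIV)"
    unfolding nn_integral_geometric_int[OF \<alpha>] u_def using A_nonneg a_gt q
    by (intro nn_integral_cong) (auto simp: ennreal_mult[symmetric])
  also have "\<dots> = ennreal (a / (1 - 2 powr (- \<alpha>))) * (\<integral>\<^sup>+i. ?t i \<partial>count_space UNIV)"
    by (rule nn_integral_cmult) simp
  finally show ?thesis .
qed

text \<open>Summing over all cubes, with the indicator selecting those that contain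
  \<open>x\<close>, makes the family and its coefficients independent of \<open>x\<close>, as needed
  for integration in \<open>x\<close>.\<close>

theorem frac_integral_le_sparse:
  assumes \<alpha>: "0 < \<alpha>" "\<alpha> < real CARD('n)"
  shows "riesz_potential \<alpha> f x
    \<le> ennreal (2 powr (real CARD('n) - \<alpha>) * (a / (1 - 2 powr (- \<alpha>))))
      * (\<integral>\<^sup>+(i, m). (if principal i m then ennreal (scale \<alpha> i * A i m) else 0)
           * indicator (dyadic_cube i m) x \<partial>count_space UNIV)"
proof -
  define t where "t = (\<lambda>i m. if principal i m then ennreal (scale \<alpha> i * A i m) else 0)"
  have q: "2 powr (- \<alpha>) < 1"
    using \<alpha> powr_less_mono[of "- \<alpha>" 0 2] by auto
  have "(\<integral>\<^sup>+i. t i (dyadic_index i x) \<partial>count_space UNIV)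
    \<le> (\<integral>\<^sup>+i. \<integral>\<^sup>+m. (case (i, m) of (i, m) \<Rightarrow> t i m * indicator (dyadic_cube i m) x) \<partial>count_space UNIV \<partial>count_space UNIV)"
  proof (intro nn_integral_mono)
    fix i :: int
    have "t i (dyadic_index i x) = t i (dyadic_index i x) * indicator (dyadic_cube i (dyadic_index i x)) x"
      by (simp add: dyadic_cube_def)
    also have "\<dots> \<le> (\<integral>\<^sup>+m. t i m * indicator (dyadic_cube i m) x \<partial>count_space UNIV)"
      by (rule nn_integral_ge_point) simp
    finally show "t i (dyadic_index i x) \<le> (\<integral>\<^sup>+m. (case (i, m) of (i, m) \<Rightarrow> t i m * indicator (dyadic_cube i m) x) \<partial>count_space UNIV)"
      by simp
  qed
  also have "\<dots> = (\<integral>\<^sup>+(i, m). t i m * indicator (dyadic_cube i m) x \<partial>count_space UNIV)"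
    by (rule nn_integral_fst_count_space)
  finally have le: "(\<integral>\<^sup>+i. t i (dyadic_index i x) \<partial>count_space UNIV) \<le> \<dots>" .
  have "riesz_potential \<alpha> f x
    \<le> ennreal (2 powr (real CARD('n) - \<alpha>))
      * (ennreal (a / (1 - 2 powr (- \<alpha>))) * (\<integral>\<^sup>+i. t i (dyadic_index i x) \<partial>count_space UNIV))"
    using sum_averages_le_principal[OF \<alpha>(1), of x] unfolding t_def[symmetric]
    by (intro order_trans[OF frac_integral_le_sum_averages[OF \<alpha>(2)]] mult_left_mono) (auto simp: t_def)
  also have "\<dots> \<le> ennreal (2 powr (real CARD('n) - \<alpha>))
      * (ennreal (a / (1 - 2 powr (- \<alpha>))) * (\<integral>\<^sup>+(i, m). t i m * indicator (dyadic_cube i m) x \<partial>count_space UNIV))"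
    by (intro mult_left_mono le) auto
  also have "\<dots> = ennreal (2 powr (real CARD('n) - \<alpha>) * (a / (1 - 2 powr (- \<alpha>))))
     * (\<integral>\<^sup>+(i, m). t i m * indicator (dyadic_cube i m) x \<partial>count_space UNIV)"
    using q a_gt by (subst ennreal_mult) (auto simp: mult.assoc)
  finally show ?thesis
    by (simp only: t_def)
qed

end

section \<open>Weights satisfying the $A_1$ condition on balls\<close>

text \<open>The A_1 condition in product form, a.e. and on balls, which avoids dividing by an
  essential infimum. The weight 0 is excluded because its measure gives no ball positive
  mass.\<close>

locale A1_weight =
  fixes w :: "real ^ 'n::finite \<Rightarrow> ennreal" and K :: real
  assumes w_measurable [measurable]: "w \<in> borel_measurable lebesgue"
    and w_finite: "w x < \<infinity>"
    and w_locally_integrable: "ball_int lebesgue w c r < \<infinity>"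
    and K_pos: "K > 0"
    and A1: "0 < r \<Longrightarrow> AE y in lebesgue. y \<in> ball c r \<longrightarrow>
      ball_int lebesgue w c r \<le> ennreal K * emeasure lebesgue (ball c r) * w y"
    and nontrivial: "\<not> (AE x in lebesgue. w x = 0)"
begin

definition \<mu> :: "(real ^ 'n) measure" where
  "\<mu> = density lebesgue w"

lemma sets_\<mu> [simp]: "sets \<mu> = sets lebesgue"
  by (simp add: \<mu>_def)

lemma borel_measurable_\<mu>_iff [simp]: "f \<in> borel_measurable \<mu> \<longleftrightarrow> f \<in> borel_measurable lebesgue"
  by (simp add: \<mu>_def)

lemma nn_integral_\<mu>:
  "f \<in> borel_measurable lebesgue \<Longrightarrow> (\<integral>\<^sup>+x. f x \<partial>\<mu>) = (\<integral>\<^sup>+x. w x * f x \<partial>lebesgue)"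
  unfolding \<mu>_def by (rule nn_integral_density) measurable

lemma emeasure_\<mu>: "S \<in> sets lebesgue \<Longrightarrow> emeasure \<mu> S = (\<integral>\<^sup>+x\<in>S. w x \<partial>lebesgue)"
  unfolding \<mu>_def by (rule emeasure_density) measurable

lemma ball_in_sets_lebesgue: "ball (c :: real ^ 'n) r \<in> sets lebesgue"
  by simp

lemma emeasure_\<mu>_ball_finite: "emeasure \<mu> (ball c r) < \<infinity>"
  using w_locally_integrable by (simp add: emeasure_\<mu>)

lemma A1_\<mu>:
  assumes "0 < r"
  shows "AE y in lebesgue. y \<in> ball c r \<longrightarrow>
      emeasure \<mu> (ball c r) \<le> ennreal K * emeasure lebesgue (ball c r) * w y"
  using A1[OF assms, of c] by (simp add: emeasure_\<mu>)

text \<open>The A_1 condition on a ball of positive mass forces \<open>w > 0\<close> a.e. in that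
  ball. Some ball about 0 has positive mass, hence so do all larger ones, and these exhaust the
  space.\<close>

lemma AE_w_pos: "AE y in lebesgue. 0 < w y"
proof -
  have "\<exists>N::nat. emeasure \<mu> (ball 0 (real N)) > 0"
  proof (rule ccontr)
    assume "\<not> ?thesis"
    then have "(\<integral>\<^sup>+x. w x * indicator (ball 0 (real N)) x \<partial>lebesgue) = 0" for N :: nat
      using emeasure_\<mu>[of "ball 0 (real N)"] by (simp add: zero_less_iff_neq_zero)
    then have "AE x in lebesgue. w x * indicator (ball 0 (real N)) x = 0" for N :: nat
      by (subst (asm) nn_integral_0_iff_AE) auto
    then have "AE x in lebesgue. \<forall>N::nat. w x * indicator (ball 0 (real N)) x = 0"
      by (subst AE_all_countable) blast
    then have "AE x in lebesgue. w x = 0"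
    proof eventually_elim
      case (elim x)
      obtain N :: nat where "norm x < real N" using reals_Archimedean2 by blast
      then show ?case using elim[rule_format, of N] by simp
    qed
    then show False using nontrivial by simp
  qed
  then obtain N :: nat where N: "emeasure \<mu> (ball 0 (real N)) > 0" by blast
  have "AE y in lebesgue. y \<in> ball 0 (real N + real k + 1) \<longrightarrow> 0 < w y" for k :: nat
  proof -
    define R where "R = real N + real k + 1"
    have "emeasure \<mu> (ball 0 (real N)) \<le> emeasure \<mu> (ball 0 R)"
      by (intro emeasure_mono) (auto simp: R_def)
    then have "0 < emeasure \<mu> (ball 0 R)" using N by (rule less_le_trans[rotated])
    moreover have "R > 0" by (simp add: R_def)
    ultimately show ?thesis
      using A1_\<mu>[OF \<open>R > 0\<close>, of 0] unfolding R_def[symmetric]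
      by (auto elim!: eventually_mono simp: zero_less_iff_neq_zero)
  qed
  then have "AE y in lebesgue. \<forall>k::nat. y \<in> ball 0 (real N + real k + 1) \<longrightarrow> 0 < w y"
    by (simp only: AE_all_countable) simp
  then show ?thesis
  proof eventually_elim
    case (elim y)
    obtain k :: nat where "norm y < real k" using reals_Archimedean2 by blast
    then show ?case using elim[rule_format, of k] by simp
  qed
qed

lemma emeasure_\<mu>_ball_pos:
  assumes "0 < r"
  shows "0 < emeasure \<mu> (ball c r)"
proof -
  have "emeasure \<mu> (ball c r) \<noteq> 0"
  proof
    assume "emeasure \<mu> (ball c r) = 0"
    then have "AE x in lebesgue. w x * indicator (ball c r) x = 0"
      by (simp add: emeasure_\<mu> nn_integral_0_iff_AE)
    with AE_w_pos have "AE x in lebesgue. x \<notin> ball c r"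
      by eventually_elim (auto simp: indicator_def)
    then have "emeasure lebesgue (ball c r) = 0"
      by (subst (asm) AE_iff_measurable[OF ball_in_sets_lebesgue]) auto
    then show False
      using lebesgue.ball_pos[OF assms, of c] by (simp add: zero_less_iff_neq_zero)
  qed
  then show ?thesis by (simp add: zero_less_iff_neq_zero)
qed

text \<open>Integrating the A_1 inequality over \<open>E\<close> gives
  \<open>|E| \<mu>(B) \<le> K |B| \<mu>(E)\<close>. It is used twice: with \<open>E\<close> a
  smaller ball it shows that \<mu> is doubling, and with \<open>E\<close> a core it transfers
  sparseness to \<mu>.\<close>

lemma emeasure_\<mu>_ball_le:
  assumes E: "E \<in> sets lebesgue" "E \<subseteq> ball c r" and r: "0 < r" and C: "C \<ge> 0"
    and le: "emeasure lebesgue (ball c r) \<le> ennreal C * emeasure lebesgue E"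
  shows "emeasure \<mu> (ball c r) \<le> ennreal (K * C) * emeasure \<mu> E"
proof -
  define B where "B = ball c r"
  have "emeasure lebesgue E \<le> emeasure lebesgue (ball c r)"
    using E by (intro emeasure_mono) auto
  then have Efin: "emeasure lebesgue E < \<infinity>"
    using lebesgue.ball_finite[of c r] by (rule le_less_trans)
  have Epos: "emeasure lebesgue E \<noteq> 0"
  proof
    assume "emeasure lebesgue E = 0"
    then show False using le lebesgue.ball_pos[OF r, of c] by simp
  qed
  have "emeasure lebesgue E * emeasure \<mu> B = (\<integral>\<^sup>+y\<in>E. emeasure \<mu> B \<partial>lebesgue)"
    using nn_integral_cmult_indicator[OF E(1), of "emeasure \<mu> B"] by (simp only: mult.commute)
  also have "\<dots> \<le> (\<integral>\<^sup>+y. (ennreal K * emeasure lebesgue B) * (w y * indicator E y) \<partial>lebesgue)"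
    using A1_\<mu>[OF r, of c] E(2)
    by (intro nn_integral_mono_AE) (auto elim!: eventually_mono simp: indicator_def B_def mult.assoc)
  also have "\<dots> = (ennreal K * emeasure lebesgue B) * emeasure \<mu> E"
    using E by (simp add: emeasure_\<mu> nn_integral_cmult)
  also have "\<dots> \<le> (ennreal K * (ennreal C * emeasure lebesgue E)) * emeasure \<mu> E"
    using le by (intro mult_right_mono mult_left_mono) (auto simp: B_def)
  also have "\<dots> = emeasure lebesgue E * (ennreal (K * C) * emeasure \<mu> E)"
    using K_pos C by (simp add: ennreal_mult ac_simps)
  finally show ?thesis
    using Epos Efin by (subst (asm) ennreal_mult_le_mult_iff) (auto simp: B_def)
qed

sublocale \<mu>: doubling \<mu> "K * 5 ^ CARD('n)"
proof
  show "sets \<mu> = sets lebesgue" by simp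
  show "emeasure \<mu> (ball c r) < \<infinity>" for c r
    by (rule emeasure_\<mu>_ball_finite)
  fix c :: "real ^ 'n" and r :: real assume r: "0 < r"
  show "0 < emeasure \<mu> (ball c r)"
    using r by (rule emeasure_\<mu>_ball_pos)
  show "emeasure \<mu> (ball c (5 * r)) \<le> ennreal (K * 5 ^ CARD('n)) * emeasure \<mu> (ball c r)"
    using r lebesgue.ball_5[OF r, of c] by (intro emeasure_\<mu>_ball_le) auto
qed

text \<open>Here \<open>N\<close> is a maximal function of \<open>g\<close>, \<open>G\<close> is the norm of \<open>g\<close> in \<open>L\<^sup>1\<close>, \<open>\<theta>\<close> stands for
  \<open>\<Theta>(\<alpha>)/n\<close>, and \<open>h\<close> is the \<open>s\<close>-th power of the function \<open>f N\<^sup>-\<^sup>\<theta> w\<^sup>-\<^sup>k\<close> whose \<open>L\<^sup>p(w)\<close>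
  norm is the right-hand side of the weighted inequality.\<close>

lemma local_estimate:
  fixes f N :: "real ^ 'n \<Rightarrow> ennreal"
  assumes s: "s > 1" "1 / s + 1 / s' = 1" and k: "k < 1 / s"
    and G: "G > 0" and Ck: "Ck > 0"
    and [measurable]: "f \<in> borel_measurable lebesgue" "N \<in> borel_measurable lebesgue"
    and N: "AE x in lebesgue. 0 < N x \<and> N x < \<infinity>"
    and Kolm: "(\<integral>\<^sup>+x\<in>ball c r. epow (N x) (\<theta> * s') \<partial>lebesgue)
      \<le> ennreal Ck * epow (emeasure lebesgue (ball c r)) (1 - \<theta> * s') * ennreal (G powr (\<theta> * s'))"
    and r: "r > 0"
  defines "h \<equiv> (\<lambda>x. epow (f x) s * epow (N x) (- \<theta> * s) * epow (w x) (- k * s))"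
  shows "ball_int lebesgue f c r
    \<le> ennreal (K powr (1 / s - k) * Ck powr (1 / s') * G powr \<theta>)
      * epow (emeasure lebesgue (ball c r)) (1 - k - \<theta>) * epow (emeasure \<mu> (ball c r)) k
      * epow (\<mu>.ball_avg h c r) (1 / s)"
proof -
  let ?C1 = "K powr (1 / s - k) * Ck powr (1 / s') * G powr \<theta>"
  have s'1: "s' > 1"
    using s by (smt (verit) divide_less_eq_1 divide_nonneg_pos divide_le_0_iff less_divide_eq_1)
  define B where "B = ball c r"
  have [measurable]: "B \<in> sets lebesgue" by (simp add: B_def)
  have [measurable]: "h \<in> borel_measurable lebesgue" unfolding h_def by measurable
  obtain b where b: "b > 0" "emeasure lebesgue B = ennreal b"
    using lebesgue.ball_pos[OF r, of c] lebesgue.ball_finite[of c r] unfolding B_def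
    by (metis ennreal_cases_pos less_irrefl)
  obtain m where m: "m > 0" "emeasure \<mu> B = ennreal m"
    using emeasure_\<mu>_ball_pos[OF r, of c] emeasure_\<mu>_ball_finite[of c r] unfolding B_def
    by (metis ennreal_cases_pos less_irrefl)
  define t where "t = (1 / s - k) * s'"
  have t: "t > 0" using k s'1 by (simp add: t_def)
  let ?Z = "(K * b) powr t * m powr (- t) * (Ck * b powr (1 - \<theta> * s') * G powr (\<theta> * s'))"
  define X where "X = \<mu>.ball_avg h c r"
  \<comment> \<open>The factorisation \<open>f = F * H\<close> on B is made so that
    \<open>F^s = h * w\<close>, whose integral is a \<mu>-integral of \<open>h\<close>, and
    \<open>H^s' = N^(\<theta> s') * w^(-t)\<close>. Since \<open>t > 0\<close>, the A_1 condition
    bounds \<open>w^(-t)\<close> by a constant on the ball, and what is left of H falls under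
    \<open>Kolm\<close>.\<close>
  define F where "F x = f x * epow (N x) (- \<theta>) * epow (w x) (1 / s - k) * indicator B x" for x
  define H where "H x = epow (N x) \<theta> * epow (w x) (k - 1 / s) * indicator B x" for x
  have [measurable]: "F \<in> borel_measurable lebesgue" "H \<in> borel_measurable lebesgue"
    unfolding F_def H_def by measurable
  have "(\<integral>\<^sup>+x\<in>B. f x \<partial>lebesgue) = (\<integral>\<^sup>+x. F x * H x \<partial>lebesgue)"
  proof (rule nn_integral_cong_AE)
    show "AE x in lebesgue. f x * indicator B x = F x * H x"
      using N AE_w_pos
    proof eventually_elim
      case (elim x)
      have "epow (N x) (- \<theta>) * epow (N x) \<theta> = 1"
        using elim by (intro epow_neg_mult_self) auto
      moreover have "epow (w x) (1 / s - k) * epow (w x) (k - 1 / s) = 1"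
        using epow_neg_mult_self[of "w x" "k - 1 / s"] elim w_finite[of x] by simp
      ultimately have "f x * indicator B x = f x * indicator B x * indicator B x
        * (epow (N x) (- \<theta>) * epow (N x) \<theta>) * (epow (w x) (1 / s - k) * epow (w x) (k - 1 / s))"
        by (simp add: indicator_def)
      then show ?case
        unfolding F_def H_def by (simp only: ac_simps)
    qed
  qed
  also have "\<dots> \<le> epow (\<integral>\<^sup>+x. epow (F x) s \<partial>lebesgue) (1 / s) * epow (\<integral>\<^sup>+x. epow (H x) s' \<partial>lebesgue) (1 / s')"
    by (rule Holder_nn_integral) (use s in auto)
  also have "(\<integral>\<^sup>+x. epow (F x) s \<partial>lebesgue) = X * ennreal m"
  proof -
    have "(\<integral>\<^sup>+x. epow (F x) s \<partial>lebesgue) = (\<integral>\<^sup>+x. w x * (h x * indicator B x) \<partial>lebesgue)"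
    proof (rule nn_integral_cong_AE)
      show "AE x in lebesgue. epow (F x) s = w x * (h x * indicator B x)"
        using AE_w_pos
      proof eventually_elim
        case (elim x)
        have "(1 / s - k) * s = 1 + (- k * s)"
          using s(1) by (simp add: algebra_simps)
        then have "epow (w x) ((1 / s - k) * s) = epow (w x) (1 + (- k * s))"
          by simp
        also have "\<dots> = w x * epow (w x) (- k * s)"
          using elim w_finite[of x] by (subst epow_add_finite) auto
        finally have "epow (w x) ((1 / s - k) * s) = \<dots>" .
        moreover have "epow (indicator B x) s = indicator B x"
          using s by (simp add: indicator_def epow_def)
        ultimately show ?case
          unfolding F_def h_def using s by (simp add: epow_mult epow_epow ac_simps)
      qed
    qed
    also have "\<dots> = (\<integral>\<^sup>+x\<in>B. h x \<partial>\<mu>)"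
      by (rule nn_integral_\<mu>[symmetric]) measurable
    also have "\<dots> = X * ennreal m"
      unfolding X_def m(2)[symmetric] B_def by (rule \<mu>.ball_avg_mult[OF r, symmetric])
    finally show ?thesis .
  qed
  also have "epow (X * ennreal m) (1 / s) * epow (\<integral>\<^sup>+x. epow (H x) s' \<partial>lebesgue) (1 / s')
    \<le> epow (X * ennreal m) (1 / s) * epow (ennreal ?Z) (1 / s')"
  proof (intro mult_left_mono epow_mono)
    have "(\<integral>\<^sup>+x. epow (H x) s' \<partial>lebesgue)
       \<le> (\<integral>\<^sup>+x. ennreal ((K * b) powr t * m powr (- t)) * (epow (N x) (\<theta> * s') * indicator B x) \<partial>lebesgue)"
    proof (rule nn_integral_mono_AE)
      show "AE x in lebesgue. epow (H x) s'
          \<le> ennreal ((K * b) powr t * m powr (- t)) * (epow (N x) (\<theta> * s') * indicator B x)"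
        using AE_w_pos A1_\<mu>[OF r, of c]
      proof eventually_elim
        case (elim x)
        show ?case
        proof (cases "x \<in> B")
          case True
          obtain y where y: "y > 0" "w x = ennreal y"
            using elim(1) w_finite[of x] by (metis ennreal_cases_pos less_irrefl)
          have "ennreal m \<le> ennreal (K * b * y)"
            using elim(2) True b m y K_pos by (simp add: B_def[symmetric] ennreal_mult)
          then have my: "m \<le> K * b * y"
            using K_pos b y by (subst (asm) ennreal_le_iff) auto
          \<comment> \<open>The A_1 inequality reads \<open>m \<le> K * b * y\<close> here; raised
            to the power \<open>-t\<close> it becomes the upper bound
            \<open>(K * b / m)^t\<close>.\<close>
          have "y powr (- t) = (K * b) powr t * (K * b * y) powr (- t)"
          proof -
            have "(K * b) powr t * (K * b * y) powr (- t) = ((K * b) powr t * (K * b) powr (- t)) * y powr (- t)"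
              using K_pos b y by (subst powr_mult) auto
            also have "(K * b) powr t * (K * b) powr (- t) = 1"
              using K_pos b unfolding powr_add[symmetric] by simp
            finally show ?thesis by simp
          qed
          also have "\<dots> \<le> (K * b) powr t * m powr (- t)"
            using my m t by (intro mult_left_mono powr_mono2') auto
          finally have "epow (w x) (- t) \<le> ennreal ((K * b) powr t * m powr (- t))"
            using y by (simp add: epow_ennreal ennreal_leI)
          moreover have "epow (H x) s' = epow (N x) (\<theta> * s') * epow (w x) (- t)"
          proof -
            have "(k - 1 / s) * s' = - t" by (simp add: t_def algebra_simps)
            then show ?thesis
              using True s'1 by (simp add: H_def epow_mult epow_epow)
          qed
          ultimately show ?thesis
            using True mult_left_mono[of "epow (w x) (- t)" "ennreal ((K * b) powr t * m powr (- t))" "epow (N x) (\<theta> * s')"]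
            by (simp add: mult.commute[of "ennreal _"])
        next
          case False
          then show ?thesis using s'1 by (simp add: H_def)
        qed
      qed
    qed
    also have "\<dots> = ennreal ((K * b) powr t * m powr (- t)) * (\<integral>\<^sup>+x. epow (N x) (\<theta> * s') * indicator B x \<partial>lebesgue)"
      by (rule nn_integral_cmult) measurable
    also have "\<dots> \<le> ennreal ((K * b) powr t * m powr (- t)) * (ennreal Ck * epow (ennreal b) (1 - \<theta> * s') * ennreal (G powr (\<theta> * s')))"
      using Kolm unfolding B_def[symmetric] b(2) by (rule mult_left_mono) simp
    also have "\<dots> = ennreal ?Z"
      using b Ck by (simp add: epow_ennreal ennreal_mult)
    finally show "(\<integral>\<^sup>+x. epow (H x) s' \<partial>lebesgue) \<le> \<dots>" .
  qed (use s'1 in auto)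
  also have "\<dots> = ennreal (m powr (1 / s) * ?Z powr (1 / s')) * epow X (1 / s)"
  proof -
    define Z where "Z = (K * b) powr t * m powr (- t) * (Ck * b powr (1 - \<theta> * s') * G powr (\<theta> * s'))"
    have "Z > 0" using m K_pos b Ck G by (simp add: Z_def)
    then show ?thesis
      unfolding Z_def[symmetric] using m s by (simp add: epow_mult epow_ennreal ennreal_mult ac_simps)
  qed
  also have "m powr (1 / s) * ?Z powr (1 / s')
     = ?C1 * b powr (1 - k - \<theta>) * m powr k"
  proof -
    have e: "t * (1 / s') = 1 / s - k" "\<theta> * s' * (1 / s') = \<theta>" "(1 - \<theta> * s') * (1 / s') = 1 / s' - \<theta>"
      using s'1 by (simp_all add: t_def field_simps)
    have "?Z powr (1 / s')
       = (K * b) powr (t * (1 / s')) * m powr (- (t * (1 / s'))) * (Ck powr (1 / s') * b powr ((1 - \<theta> * s') * (1 / s')) * G powr (\<theta> * s' * (1 / s')))"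
      using K_pos b m Ck G by (simp add: powr_mult powr_powr)
    also have "\<dots> = K powr (1 / s - k) * b powr (1 / s - k) * m powr (- (1 / s - k)) * (Ck powr (1 / s') * b powr (1 / s' - \<theta>) * G powr \<theta>)"
      unfolding e using K_pos b by (simp add: powr_mult)
    finally have "m powr (1 / s) * ?Z powr (1 / s')
      = ?C1 * (b powr (1 / s - k) * b powr (1 / s' - \<theta>)) * (m powr (1 / s) * m powr (- (1 / s - k)))"
      by simp
    also have "b powr (1 / s - k) * b powr (1 / s' - \<theta>) = b powr (1 - k - \<theta>)"
      unfolding powr_add[symmetric] using s by (simp add: algebra_simps)
    also have "m powr (1 / s) * m powr (- (1 / s - k)) = m powr k"
      unfolding powr_add[symmetric] by simp
    finally show ?thesis .
  qed
  also have "ennreal (K powr (1 / s - k) * Ck powr (1 / s') * G powr \<theta> * b powr (1 - k - \<theta>) * m powr k)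
    = ennreal ?C1 * epow (emeasure lebesgue B) (1 - k - \<theta>) * epow (emeasure \<mu> B) k"
    using b m by (simp add: epow_ennreal ennreal_mult)
  finally show ?thesis
    by (simp add: B_def X_def)
qed

end

text \<open>Finite partial sums along an enumeration carry the bounds for finite sparse families
  over to the countable family of all principal cubes.\<close>

lemma nn_integral_count_space_eq_SUP:
  fixes F :: "'i::countable \<Rightarrow> ennreal"
  shows "(\<integral>\<^sup>+i. F i \<partial>count_space UNIV) = (SUP N. \<Sum>i | to_nat i < N. F i)"
    and finite_to_nat_less: "finite {i::'i. to_nat i < N}"
proof -
  show fin: "finite {i::'i. to_nat i < N}" for N
  proof (rule finite_subset)
    show "{i::'i. to_nat i < N} \<subseteq> from_nat ` {..<N}"
      by (auto intro!: image_eqI[of _ _ "to_nat _"])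
  qed simp
  have "(\<integral>\<^sup>+i. F i \<partial>count_space UNIV) = (\<integral>\<^sup>+i. (SUP N. F i * indicator {i. to_nat i < N} i) \<partial>count_space UNIV)"
  proof (intro nn_integral_cong antisym)
    fix i
    show "F i \<le> (SUP N. F i * indicator {i. to_nat i < N} i)"
      by (rule SUP_upper2[of "Suc (to_nat i)"]) auto
    show "(SUP N. F i * indicator {i. to_nat i < N} i) \<le> F i"
      by (intro SUP_least) (auto simp: indicator_def)
  qed
  also have "\<dots> = (SUP N. \<integral>\<^sup>+i. F i * indicator {i. to_nat i < N} i \<partial>count_space UNIV)"
    by (rule nn_integral_monotone_convergence_SUP)
       (auto simp: incseq_def le_fun_def indicator_def)
  also have "\<dots> = (SUP N. \<Sum>i | to_nat i < N. F i)"
  proof (intro SUP_cong refl)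
    fix N
    have "(\<integral>\<^sup>+i. F i * indicator {i. to_nat i < N} i \<partial>count_space UNIV)
      = (\<Sum>i | to_nat i < N. F i * indicator {i. to_nat i < N} i)"
      by (rule nn_integral_count_space') (auto simp: fin)
    then show "(\<integral>\<^sup>+i. F i * indicator {i. to_nat i < N} i \<partial>count_space UNIV) = (\<Sum>i | to_nat i < N. F i)"
      by simp
  qed
  finally show "(\<integral>\<^sup>+i. F i \<partial>count_space UNIV) = (SUP N. \<Sum>i | to_nat i < N. F i)" .
qed

text \<open>The first line is the cost of sparse domination, the next two come from the local
  estimate on dyadic balls, and the last two from the sparse bound with respect to \<mu>, where
  \<open>K * (2 * dyadic_vol)\<close> measures sparseness. The weight enters through
  \<open>K\<close> alone.\<close>

definition weighted_const :: "'n::finite itself \<Rightarrow> real \<Rightarrow> real \<Rightarrow> real \<Rightarrow> real \<Rightarrow> real \<Rightarrow> real \<Rightarrow> real" where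
  "weighted_const TYPE('n) \<alpha> p q s K Ck =
     2 powr (real CARD('n) - \<alpha>) * (level_ratio TYPE('n) / (1 - 2 powr (- \<alpha>)))
     * (K powr (1 / s - (1 / p - 1 / q)) * Ck powr (1 - 1 / s)
        * dyadic_vol TYPE('n) powr (1 - \<alpha> / real CARD('n)))
     * ((K * (2 * dyadic_vol TYPE('n)) * strong_const (q / (q - 1)) (K * 5 ^ CARD('n)) powr (1 / (q / (q - 1)))) powr q
        * (K * (2 * dyadic_vol TYPE('n)) * strong_const (p / s) (K * 5 ^ CARD('n))) powr (q / p)) powr (1 / q)"

context A1_weight
begin

text \<open>By \<open>\<alpha>_eq\<close> the volume enters the local estimate as
  \<open>|B|^(1 - \<alpha>/n)\<close> and cancels against the coefficients of the sparse sum. Only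
  \<mu>-masses and \<mu>-averages of \<open>h\<close> remain, exactly the quantities of
  \<open>sparse_fractional_bound\<close> with \<open>r = p/s\<close>.\<close>

theorem frac_integral_weighted_bound:
  fixes f N :: "real ^ 'n \<Rightarrow> ennreal"
  assumes \<alpha>: "0 < \<alpha>" "\<alpha> < real CARD('n)"
    and p: "1 < p" "p \<le> q" and s: "1 < s" "s < p"
    and \<alpha>_eq: "1 / p - 1 / q + \<theta> = \<alpha> / real CARD('n)"
    and G: "G > 0" and Ck: "Ck > 0"
    and [measurable]: "f \<in> borel_measurable lebesgue" "N \<in> borel_measurable lebesgue"
    and N: "AE x in lebesgue. 0 < N x \<and> N x < \<infinity>"
    and Kolm: "\<And>c r. r > 0 \<Longrightarrow> (\<integral>\<^sup>+x\<in>ball c r. epow (N x) (\<theta> * (s / (s - 1))) \<partial>lebesgue)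
      \<le> ennreal Ck * epow (emeasure lebesgue (ball c r)) (1 - \<theta> * (s / (s - 1)))
          * ennreal (G powr (\<theta> * (s / (s - 1))))"
  defines "R \<equiv> (\<integral>\<^sup>+x. epow (f x) p * (epow (N x) (- \<theta> * p) * epow (w x) (p / q)) \<partial>lebesgue)"
  assumes R_fin: "R < \<infinity>"
  shows "epow (\<integral>\<^sup>+x. epow (riesz_potential \<alpha> f x) q * w x \<partial>lebesgue) (1 / q)
    \<le> ennreal (weighted_const TYPE('n) \<alpha> p q s K Ck * G powr \<theta>) * epow R (1 / p)"
proof -
  let ?n = "real CARD('n)"
  define s' where "s' = s / (s - 1)"
  have s': "1 / s + 1 / s' = 1" "1 / s' = 1 - 1 / s"
    using s by (simp_all add: s'_def field_simps)
  define \<kappa> where "\<kappa> = 1 / p - 1 / q"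
  have \<kappa>0: "\<kappa> \<ge> 0" using p by (simp add: \<kappa>_def field_simps)
  have "1 / p < 1 / s" using s p by (simp add: field_simps)
  then have \<kappa>: "\<kappa> < 1 / s"
    using p by (simp add: \<kappa>_def) (smt (verit) divide_pos_pos)
  define V where "V = dyadic_vol TYPE('n)"
  have V: "V > 0" by (simp add: V_def dyadic_vol_pos)
  define h where "h = (\<lambda>x. epow (f x) s * epow (N x) (- \<theta> * s) * epow (w x) (- \<kappa> * s))"
  have [measurable]: "h \<in> borel_measurable lebesgue" unfolding h_def by measurable
  have R_eq: "(\<integral>\<^sup>+x. epow (h x) (p / s) \<partial>\<mu>) = R"
  proof -
    have "(\<integral>\<^sup>+x. epow (h x) (p / s) \<partial>\<mu>) = (\<integral>\<^sup>+x. w x * epow (h x) (p / s) \<partial>lebesgue)"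
      by (rule nn_integral_\<mu>) measurable
    also have "\<dots> = R"
      unfolding R_def
    proof (rule nn_integral_cong_AE)
      show "AE x in lebesgue. w x * epow (h x) (p / s) = epow (f x) p * (epow (N x) (- \<theta> * p) * epow (w x) (p / q))"
        using AE_w_pos
      proof eventually_elim
        case (elim x)
        have "w x * epow (w x) (- \<kappa> * p) = epow (w x) (1 + - \<kappa> * p)"
          using elim w_finite[of x] by (subst epow_add_finite) auto
        also have "1 + - \<kappa> * p = p / q"
          using p by (simp add: \<kappa>_def algebra_simps)
        finally have "w x * epow (w x) (- \<kappa> * p) = epow (w x) (p / q)" .
        moreover have "epow (h x) (p / s) = epow (f x) p * epow (N x) (- \<theta> * p) * epow (w x) (- \<kappa> * p)"
          using s p by (simp add: h_def epow_mult epow_epow)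
        moreover have "w x * (epow (f x) p * epow (N x) (- \<theta> * p) * epow (w x) (- \<kappa> * p))
          = epow (f x) p * (epow (N x) (- \<theta> * p) * (w x * epow (w x) (- \<kappa> * p)))"
          by (simp only: ac_simps)
        ultimately show ?case by simp
      qed
    qed
    finally show ?thesis .
  qed
  define H where "H = (\<integral>\<^sup>+x. epow (max_fun \<mu> h x) (p / s) \<partial>\<mu>)"
  have "H \<le> ennreal (strong_const (p / s) (K * 5 ^ CARD('n))) * (\<integral>\<^sup>+x. epow (h x) (p / s) \<partial>\<mu>)"
    unfolding H_def using s by (intro \<mu>.strong_type') auto
  then have H_fin: "H < \<infinity>"
    unfolding R_eq using R_fin by (auto intro: le_less_trans simp: ennreal_mult_less_top)
  \<comment> \<open>The whole ball is taken as the large subset, with constant 1. The bound yields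
    both the finiteness of the averages and their decay at large scales.\<close>
  have X_le: "epow (\<mu>.ball_avg h c r) (p / s) * emeasure \<mu> (ball c r) \<le> H" if "r > 0" for c r
  proof -
    have "epow (\<mu>.ball_avg h c r) (p / s) * emeasure \<mu> (ball c r)
      \<le> ennreal 1 * (\<integral>\<^sup>+x\<in>ball c r. epow (max_fun \<mu> h x) (p / s) \<partial>\<mu>)"
      using that s p by (intro \<mu>.epow_ball_avg_le) auto
    also have "\<dots> \<le> H"
      unfolding H_def by (auto intro!: nn_integral_mono simp: indicator_def)
    finally show ?thesis .
  qed
  have X_fin: "\<mu>.ball_avg h c r < \<infinity>" if "r > 0" for c r
  proof -
    have "epow (\<mu>.ball_avg h c r) (p / s) * emeasure \<mu> (ball c r) < \<infinity>"
      using X_le[OF that, of c] H_fin by (rule le_less_trans)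
    then have "epow (\<mu>.ball_avg h c r) (p / s) \<noteq> \<infinity>"
      using emeasure_\<mu>_ball_pos[OF that, of c] by (auto simp: ennreal_top_mult split: if_splits)
    then show ?thesis
      using s p epow_eq_top_iff[of "p / s" "\<mu>.ball_avg h c r"] by (auto simp: less_top)
  qed
  define C1 where "C1 = K powr (1 / s - \<kappa>) * Ck powr (1 - 1 / s) * G powr \<theta>"
  have C1: "C1 > 0" using K_pos Ck G by (simp add: C1_def)
  have \<alpha>_exp: "1 - \<kappa> - \<theta> = 1 - \<alpha> / ?n"
    using \<alpha>_eq by (simp add: \<kappa>_def)
  have loc: "ball_int lebesgue f c r
    \<le> ennreal C1 * epow (emeasure lebesgue (ball c r)) (1 - \<alpha> / ?n)
      * (epow (emeasure \<mu> (ball c r)) \<kappa> * epow (\<mu>.ball_avg h c r) (1 / s))" if "r > 0" for c r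
    using local_estimate[OF s(1) s'(1) \<kappa> G Ck _ _ N Kolm[OF that, folded s'_def] that, of f c]
    unfolding h_def[symmetric] \<alpha>_exp s'(2) by (simp add: C1_def mult.assoc)
  define Y where "Y = (\<lambda>(j, m). epow (emeasure \<mu> (dyadic_ball j m)) \<kappa>
      * epow (\<mu>.ball_avg h (dyadic_corner j m) (dyadic_radius TYPE('n) j)) (1 / s))"
  define C2 where "C2 = C1 * V powr (1 - \<alpha> / ?n)"
  have C2: "C2 > 0" using C1 V by (simp add: C2_def)
  \<comment> \<open>Local integrability of \<open>f\<close> is a consequence of the finite
    right-hand norm: every factor of the local estimate is finite.\<close>
  have f_fin: "ball_int lebesgue f c r < \<infinity>" for c r
  proof (cases "r > 0")
    case True
    have "epow (emeasure lebesgue (ball c r)) (1 - \<alpha> / ?n) < \<infinity>" "epow (emeasure \<mu> (ball c r)) \<kappa> < \<infinity>"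
      using lebesgue.ball_pos[OF True, of c] lebesgue.ball_finite[of c r]
        emeasure_\<mu>_ball_pos[OF True, of c] emeasure_\<mu>_ball_finite[of c r]
      by (simp_all only: epow_finite)
    moreover have "epow (\<mu>.ball_avg h c r) (1 / s) < \<infinity>"
      using X_fin[OF True] s by (intro epow_less_top) auto
    ultimately show ?thesis
      using loc[OF True, of c] by (auto intro: le_less_trans simp: ennreal_mult_less_top)
  qed (simp add: ball_empty)
  have A_le: "ennreal (scale \<alpha> j * dyadic_avg f j m) \<le> ennreal C2 * Y (j, m)" for j and m :: "int ^ 'n"
  proof -
    let ?u = "scale \<alpha> j * 2 powr (- (real_of_int j * ?n))" and ?v = "2 powr (real_of_int j * ?n - real_of_int j * \<alpha>)"
      and ?B = "dyadic_ball j m"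
    define S where "S = (\<integral>\<^sup>+y\<in>?B. f y \<partial>lebesgue)"
    have "S < \<infinity>" unfolding S_def by (rule f_fin)
    then have "ennreal (scale \<alpha> j * dyadic_avg f j m)
      = ennreal (?u) * S"
      unfolding dyadic_avg_def S_def[symmetric]
      by (cases S) (auto simp: ennreal_mult[symmetric] ac_simps)
    also have "\<dots> \<le> ennreal (?u)
        * (ennreal C1 * epow (emeasure lebesgue (?B)) (1 - \<alpha> / ?n) * Y (j, m))"
      unfolding S_def Y_def prod.case by (intro mult_left_mono loc dyadic_radius_pos) auto
    also have "epow (emeasure lebesgue (?B)) (1 - \<alpha> / ?n)
      = ennreal ((V * 2 powr (real_of_int j * ?n)) powr (1 - \<alpha> / ?n))"
      unfolding emeasure_dyadic_ball V_def[symmetric] using V by (intro epow_ennreal) auto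
    also have "(V * 2 powr (real_of_int j * ?n)) powr (1 - \<alpha> / ?n)
      = V powr (1 - \<alpha> / ?n) * ?v"
      using V by (simp add: powr_mult powr_powr algebra_simps)
    also have "ennreal (?u)
        * (ennreal C1 * ennreal (V powr (1 - \<alpha> / ?n) * ?v) * Y (j, m))
      = ennreal (?u * (C1 * (V powr (1 - \<alpha> / ?n) * ?v))) * Y (j, m)"
      using C1 by (simp add: ennreal_mult mult.assoc)
    also have "?u * (C1 * (V powr (1 - \<alpha> / ?n) * ?v))
       = C2 * (?u * ?v)"
      by (simp add: C2_def)
    also have "?u * ?v = 1"
      unfolding powr_add[symmetric] by simp
    finally show ?thesis by simp
  qed
  \<comment> \<open>Writing \<kappa> as \<open>1/p - 1/q\<close> splits \<open>Y\<close> into a part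
    bounded by \<open>H^(1/p)\<close> and the power \<open>-1/q\<close> of a mass that grows with
    the ball. So \<open>Y\<close> stays bounded along the ancestors of a cube, and
    \<open>A_le\<close> leaves a decay of order \<open>2^(-l \<alpha>)\<close>.\<close>
  have decay: "\<exists>J. \<forall>l>J. dyadic_avg f l (dyadic_index l x) \<le> t" if t: "0 < t" for t x
  proof -
    define Y0 where "Y0 = epow H (1 / p) * epow (emeasure \<mu> (dyadic_ball 0 (dyadic_index 0 x))) (- 1 / q)"
    have pos0: "0 < emeasure \<mu> (dyadic_ball j m)" "emeasure \<mu> (dyadic_ball j m) < \<infinity>" for j and m :: "int ^ 'n"
      by (rule emeasure_\<mu>_ball_pos[OF dyadic_radius_pos] emeasure_\<mu>_ball_finite)+
    have "Y0 < \<infinity>"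
      unfolding Y0_def using epow_less_top[of "1 / p" H] H_fin p epow_finite[OF pos0, of 0 "dyadic_index 0 x" "- 1 / q"]
      by (simp add: ennreal_mult_less_top)
    then obtain y0 where y0: "y0 \<ge> 0" "Y0 = ennreal y0"
      by (cases Y0) auto
    have Y_le: "Y (l, dyadic_index l x) \<le> Y0" if "l \<ge> 0" for l
    proof -
      let ?m = "emeasure \<mu> (dyadic_ball l (dyadic_index l x))"
      let ?X = "\<mu>.ball_avg h (dyadic_corner l (dyadic_index l x)) (dyadic_radius TYPE('n) l)"
      have "\<kappa> = 1 / p + (- 1 / q)" by (simp add: \<kappa>_def)
      then have "epow ?m \<kappa> = epow ?m (1 / p) * epow ?m (- 1 / q)"
        using epow_add_finite[OF pos0, of _ _ "1 / p" "- 1 / q"] by simp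
      then have "Y (l, dyadic_index l x) = epow (epow ?X (p / s) * ?m) (1 / p) * epow ?m (- 1 / q)"
        using p s by (simp add: Y_def epow_mult epow_epow ac_simps)
      also have "\<dots> \<le> epow H (1 / p) * epow (emeasure \<mu> (dyadic_ball 0 (dyadic_index 0 x))) (- 1 / q)"
        using dyadic_ball_mono[OF that, of x] p s
        by (intro mult_mono epow_mono epow_antimono X_le dyadic_radius_pos emeasure_mono) auto
      finally show ?thesis by (simp add: Y0_def)
    qed
    \<comment> \<open>The added 1 keeps the argument of the logarithm positive when
      \<open>y0 = 0\<close>; the maximum with 0 keeps \<open>l\<close> in the range of
      \<open>Y_le\<close>.\<close>
    define J where "J = max 0 \<lceil>log 2 (C2 * y0 / t + 1) / \<alpha>\<rceil>"
    show ?thesis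
    proof (intro exI allI impI)
      fix l assume l: "J < l"
      have pos: "C2 * y0 / t + 1 > 0" using C2 y0 t by (simp add: add_nonneg_pos)
      have "log 2 (C2 * y0 / t + 1) / \<alpha> \<le> l"
        using l unfolding J_def by linarith
      then have "log 2 (C2 * y0 / t + 1) \<le> l * \<alpha>"
        using \<alpha> by (simp add: field_simps)
      then have "C2 * y0 / t + 1 \<le> 2 powr (l * \<alpha>)"
        using pos by (simp add: log_le_iff)
      then have "C2 * y0 / t \<le> 2 powr (l * \<alpha>)" by simp
      then have a: "C2 * y0 \<le> 2 powr (l * \<alpha>) * t"
        using t by (simp add: field_simps)
      have "ennreal (scale \<alpha> l * dyadic_avg f l (dyadic_index l x)) \<le> ennreal C2 * Y (l, dyadic_index l x)"
        by (rule A_le)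
      also have "\<dots> \<le> ennreal C2 * Y0"
        using Y_le[of l] l by (intro mult_left_mono) (auto simp: J_def)
      also have "\<dots> = ennreal (C2 * y0)"
        using y0 C2 by (simp add: ennreal_mult)
      finally have "scale \<alpha> l * dyadic_avg f l (dyadic_index l x) \<le> C2 * y0"
        using C2 y0 by (subst (asm) ennreal_le_iff) auto
      also note a
      finally show "dyadic_avg f l (dyadic_index l x) \<le> t"
        by (rule mult_left_le_imp_le) simp
    qed
  qed
  interpret decaying_averages f "level_ratio TYPE('n)"
    by standard (use f_fin decay in auto)
  define L where "L = (K * (2 * V) * strong_const (q / (q - 1)) (K * 5 ^ CARD('n)) powr (1 / (q / (q - 1)))) powr q
        * (K * (2 * V) * strong_const (p / s) (K * 5 ^ CARD('n))) powr (q / p)"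
  define F where "F = (\<lambda>idx. if case_prod principal idx then Y idx else 0)"
  define S where "S x = (\<integral>\<^sup>+idx. F idx * indicator (case_prod dyadic_cube idx) x \<partial>count_space UNIV)" for x
  define S' where "S' k x = (\<Sum>idx | to_nat idx < k. F idx * indicator (case_prod dyadic_cube idx) x)" for k x
  have S_SUP: "S x = (SUP k. S' k x)" for x
    unfolding S_def S'_def by (rule nn_integral_count_space_eq_SUP)
  have [measurable]: "case_prod dyadic_cube idx \<in> sets lebesgue" for idx :: "int \<times> (int ^ 'n)"
    by (cases idx) (simp add: sets_dyadic_cube_lebesgue)
  have [measurable]: "S' k \<in> borel_measurable lebesgue" for k
    unfolding S'_def by measurable
  have [measurable]: "S \<in> borel_measurable lebesgue"
    unfolding S_SUP[abs_def] by measurable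
  have S'_bound: "(\<integral>\<^sup>+x. epow (S' k x) q \<partial>\<mu>) \<le> ennreal L * epow R (q / p)" for k
  proof -
    define I where "I = {idx :: int \<times> (int ^ 'n). to_nat idx < k \<and> case_prod principal idx}"
    have finI: "finite I"
      using finite_to_nat_less by (rule finite_subset[rotated]) (auto simp: I_def)
    interpret sparse_family \<mu> "K * 5 ^ CARD('n)" I "case_prod dyadic_cube" "case_prod core"
      "case_prod dyadic_corner" "\<lambda>(j, m). dyadic_radius TYPE('n) j" "K * (2 * V)"
    proof (unfold_locales, goal_cases)
      case (8)
      have "I \<subseteq> {(j, m). principal j m}" by (auto simp: I_def)
      then show ?case
        by (rule disjoint_family_on_mono[OF _ core_disjoint])
    next
      case (9 idx)
      obtain j m where idx: "idx = (j, m)" by force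
      then have "principal j m" using 9 by (simp add: I_def)
      \<comment> \<open>The core is large for Lebesgue measure; the A_1 condition makes it large for
        \<mu> at the cost of the factor \<open>K\<close>.\<close>
      have "emeasure \<mu> (dyadic_ball j m) \<le> ennreal (K * (2 * V)) * emeasure \<mu> (core j m)"
        using V emeasure_core_ge[OF \<open>principal j m\<close>] core_subset[of j m] dyadic_cube_subset_ball[of j m]
        by (intro emeasure_\<mu>_ball_le sets_core dyadic_radius_pos) (auto simp: V_def)
      then show ?case by (simp add: idx)
    qed (use finI K_pos V sets_core sets_dyadic_cube_lebesgue core_subset dyadic_radius_pos[where 'n = 'n]
           subsetD[OF dyadic_cube_subset_ball] in \<open>auto split: prod.splits\<close>)
    let ?c = "case_prod dyadic_corner" and ?r = "\<lambda>(j, m). dyadic_radius TYPE('n) j"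
    \<comment> \<open>With \<open>r = p / s\<close> the exponent \<open>r / p\<close> is the
      \<open>1 / s\<close> occurring in \<open>Y\<close>, and the cubes that are not principal
      contribute 0.\<close>
    have "S' k x = (\<Sum>i\<in>I. epow (emeasure \<mu> (ball (?c i) (?r i))) (1 / p - 1 / q)
            * epow (\<mu>.ball_avg h (?c i) (?r i)) ((p / s) / p)
            * indicator (case_prod dyadic_cube i) x)" for x
      unfolding S'_def
    proof (rule sum.mono_neutral_cong_right)
      show "finite {idx :: int \<times> (int ^ 'n). to_nat idx < k}" by (rule finite_to_nat_less)
    qed (use p in \<open>auto simp: I_def F_def Y_def \<kappa>_def\<close>)
    then show ?thesis
      using sparse_fractional_bound[of h p q "p / s"] s p unfolding R_eq L_def by simp
  qed
  have S_bound: "(\<integral>\<^sup>+x. epow (S x) q \<partial>\<mu>) \<le> ennreal L * epow R (q / p)"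
  proof -
    have "epow (S x) q = (SUP k. epow (S' k x) q)" for x
      unfolding S_SUP using p by (intro epow_SUP) auto
    then have "(\<integral>\<^sup>+x. epow (S x) q \<partial>\<mu>) = (\<integral>\<^sup>+x. (SUP k. epow (S' k x) q) \<partial>\<mu>)" by simp
    also have "\<dots> = (SUP k. \<integral>\<^sup>+x. epow (S' k x) q \<partial>\<mu>)"
    proof (rule nn_integral_monotone_convergence_SUP)
      show "incseq (\<lambda>k x. epow (S' k x) q)"
      proof (intro incseq_SucI le_funI epow_mono)
        show "S' k x \<le> S' (Suc k) x" for k x
          unfolding S'_def by (intro sum_mono2 finite_to_nat_less) auto
      qed (use p in auto)
    qed auto
    also have "\<dots> \<le> ennreal L * epow R (q / p)"
      by (intro SUP_least S'_bound)
    finally show ?thesis .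
  qed
  define Cp where "Cp = 2 powr (?n - \<alpha>) * (level_ratio TYPE('n) / (1 - 2 powr (- \<alpha>)))"
  have "2 powr (- \<alpha>) < 1"
    using \<alpha> powr_less_mono[of "- \<alpha>" 0 2] by auto
  then have Cp: "Cp > 0" using a_gt by (simp add: Cp_def)
  have pw: "riesz_potential \<alpha> f x \<le> ennreal (Cp * C2) * S x" for x
  proof -
    have "riesz_potential \<alpha> f x
      \<le> ennreal Cp * (\<integral>\<^sup>+(i, m). (if principal i m then ennreal (scale \<alpha> i * A i m) else 0)
           * indicator (dyadic_cube i m) x \<partial>count_space UNIV)"
      unfolding Cp_def by (rule frac_integral_le_sparse[OF \<alpha>])
    also have "\<dots> \<le> ennreal Cp * (\<integral>\<^sup>+idx. ennreal C2 * (F idx * indicator (case_prod dyadic_cube idx) x) \<partial>count_space UNIV)"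
      using A_le by (intro mult_left_mono nn_integral_mono) (auto simp: F_def indicator_def)
    also have "\<dots> = ennreal (Cp * C2) * S x"
      using Cp C2 unfolding S_def by (simp add: nn_integral_cmult ennreal_mult mult.assoc)
    finally show ?thesis .
  qed
  have "(\<integral>\<^sup>+x. epow (riesz_potential \<alpha> f x) q * w x \<partial>lebesgue)
    \<le> (\<integral>\<^sup>+x. w x * epow (ennreal (Cp * C2) * S x) q \<partial>lebesgue)"
    unfolding mult.commute[of _ "w _"] using p by (intro nn_integral_mono mult_left_mono epow_mono pw) auto
  also have "\<dots> = (\<integral>\<^sup>+x. epow (ennreal (Cp * C2)) q * epow (S x) q \<partial>\<mu>)"
    using p by (subst nn_integral_\<mu>) (auto simp: epow_mult)
  also have "\<dots> = epow (ennreal (Cp * C2)) q * (\<integral>\<^sup>+x. epow (S x) q \<partial>\<mu>)"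
    by (rule nn_integral_cmult) (unfold borel_measurable_\<mu>_iff, measurable)
  also have "\<dots> \<le> epow (ennreal (Cp * C2)) q * (ennreal L * epow R (q / p))"
    by (intro mult_left_mono S_bound) auto
  finally have "epow (\<integral>\<^sup>+x. epow (riesz_potential \<alpha> f x) q * w x \<partial>lebesgue) (1 / q)
    \<le> epow (epow (ennreal (Cp * C2)) q * (ennreal L * epow R (q / p))) (1 / q)"
    using p by (intro epow_mono) auto
  also have "\<dots> = ennreal (Cp * C2) * epow (ennreal L) (1 / q) * epow R (1 / p)"
    using p by (simp add: epow_mult epow_epow mult.assoc)
  also have "epow (ennreal L) (1 / q) = ennreal (L powr (1 / q))"
    using p by (intro epow_ennreal_nonneg) (auto simp: L_def)
  also have "ennreal (Cp * C2) * ennreal (L powr (1 / q)) = ennreal (weighted_const TYPE('n) \<alpha> p q s K Ck * G powr \<theta>)"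
  proof -
    have "Cp * C2 * L powr (1 / q) = weighted_const TYPE('n) \<alpha> p q s K Ck * G powr \<theta>"
      unfolding weighted_const_def Cp_def C2_def C1_def L_def V_def \<kappa>_def by (simp only: ac_simps)
    then show ?thesis
      using Cp C2 by (simp add: ennreal_mult[symmetric])
  qed
  finally show ?thesis .
qed

end

section \<open>Weights and the maximal function\<close>

text \<open>Local integrability contains measurability of the restrictions to balls, and these are
  eventually constant at every point.\<close>

lemma weight_measurable:
  fixes u :: "real ^ 'n::finite \<Rightarrow> real"
  assumes "weight u"
  shows "u \<in> borel_measurable lebesgue"
proof (rule borel_measurable_LIMSEQ_real)
  fix x :: "real ^ 'n"
  obtain k0 :: nat where k0: "norm x \<le> real k0" using real_arch_simple by blast
  have "indicat_real (cball 0 (real k)) x * u x = u x" if "k \<ge> k0" for k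
    using that k0 by (auto simp: indicator_def)
  then have "\<forall>\<^sub>F k in sequentially. indicat_real (cball 0 (real k)) x * u x = u x"
    by (auto simp: eventually_sequentially)
  then show "(\<lambda>k. indicat_real (cball 0 (real k)) x * u x) \<longlonglongrightarrow> u x"
    by (rule tendsto_eventually)
next
  fix k :: nat
  have "set_integrable lebesgue (cball 0 (real k)) u"
    using assms by (simp add: weight_def)
  then show "(\<lambda>x. indicat_real (cball 0 (real k)) x * u x) \<in> borel_measurable lebesgue"
    unfolding set_integrable_def by (simp add: borel_measurable_integrable)
qed

lemma weight_nn_integral_finite:
  assumes "weight u" "compact S"
  shows "(\<integral>\<^sup>+x\<in>S. ennreal (u x) \<partial>lebesgue) < \<infinity>"
proof -
  have "integrable lebesgue (\<lambda>x. indicat_real S x *\<^sub>R u x)"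
    using assms by (simp add: weight_def set_integrable_def)
  then have "(\<integral>\<^sup>+x. ennreal (norm (indicat_real S x *\<^sub>R u x)) \<partial>lebesgue) < \<infinity>"
    by (simp add: integrable_iff_bounded)
  moreover have "(\<integral>\<^sup>+x\<in>S. ennreal (u x) \<partial>lebesgue) \<le> (\<integral>\<^sup>+x. ennreal (norm (indicat_real S x *\<^sub>R u x)) \<partial>lebesgue)"
    by (intro nn_integral_mono) (auto simp: indicator_def intro!: ennreal_leI)
  ultimately show ?thesis by (rule le_less_trans[rotated])
qed

section \<open>Cubes, and the A_1 condition in pointwise form\<close>

lemma emeasure_cube:
  fixes a b :: "real ^ 'n::finite"
  assumes "l > 0" "\<And>i. b $ i - a $ i = l"
  shows "emeasure lebesgue (cbox a b) = ennreal (l ^ CARD('n))"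
proof -
  have "emeasure lborel (cbox a b) = ennreal (\<Prod>k\<in>Basis. (b - a) \<bullet> k)"
  proof (rule emeasure_lborel_cbox)
    fix k :: "real ^ 'n" assume "k \<in> Basis"
    then obtain i where "k = axis i 1" by (auto simp: Basis_vec_def)
    then show "a \<bullet> k \<le> b \<bullet> k"
      using assms(1) assms(2)[of i] by (simp add: inner_axis)
  qed
  also have "(\<Prod>k\<in>Basis. (b - a) \<bullet> k) = (\<Prod>k\<in>(Basis :: (real ^ 'n) set). l)"
    by (intro prod.cong) (auto simp: Basis_vec_def inner_axis assms(2))
  finally show ?thesis by simp
qed

lemma cubesI: "l > 0 \<Longrightarrow> (\<And>i. b $ i - a $ i = l) \<Longrightarrow> cbox a b \<in> cubes"
  unfolding cubes_def by blast

lemma cubesE: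
  assumes "Q \<in> (cubes :: (real ^ 'n::finite) set set)"
  obtains a b l where "l > 0" "Q = cbox a b" "\<And>i. b $ i - a $ i = l"
    "emeasure lebesgue Q = ennreal (l ^ CARD('n))"
  using assms emeasure_cube unfolding cubes_def by blast

lemma avg_mult_cube:
  assumes "Q \<in> (cubes :: (real ^ 'n::finite) set set)"
  shows "avg Q h * emeasure lebesgue Q = (\<integral>\<^sup>+x\<in>Q. h x \<partial>lebesgue)"
  using assms
proof (rule cubesE)
  fix l :: real assume "l > 0" "emeasure lebesgue Q = ennreal (l ^ CARD('n))"
  then show ?thesis
    unfolding avg_def by (intro ennreal_divide_mult_cancel) auto
qed

text \<open>The supremum runs over possibly uncountably many constants, each with its own null set;
  it is also the supremum of a sequence among them, and countably many null sets may be
  united.\<close>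

lemma AE_ess_inf_on_le: "AE x in lebesgue. x \<in> Q \<longrightarrow> ess_inf_on Q h \<le> h x"
proof -
  define S where "S = {c. AE x in lebesgue. x \<in> Q \<longrightarrow> c \<le> h x}"
  have "0 \<in> S" by (simp add: S_def)
  then obtain c :: "nat \<Rightarrow> ennreal" where c: "range c \<subseteq> S" "Sup S = (SUP k. c k)"
    using ennreal_Sup_countable_SUP[of S] by auto
  then have "AE x in lebesgue. x \<in> Q \<longrightarrow> c k \<le> h x" for k
    by (auto simp: S_def)
  then have "AE x in lebesgue. \<forall>k. x \<in> Q \<longrightarrow> c k \<le> h x"
    by (subst AE_all_countable) blast
  then show ?thesis
    unfolding ess_inf_on_def S_def[symmetric] c(2)
    by eventually_elim (auto intro: SUP_least)
qed

lemma A1_AE: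
  assumes u: "u \<in> A1" and Q: "Q \<in> cubes"
  shows "AE y in lebesgue. y \<in> Q \<longrightarrow> avg Q (\<lambda>x. ennreal (u x)) \<le> A1_const u * ennreal (u y)"
  using AE_ess_inf_on_le[of Q "\<lambda>x. ennreal (u x)"]
proof eventually_elim
  case (elim y)
  define a where "a = avg Q (\<lambda>x. ennreal (u x))"
  define e where "e = ess_inf_on Q (\<lambda>x. ennreal (u x))"
  have A: "a * inverse e \<le> A1_const u"
    unfolding A1_const_def a_def e_def by (rule SUP_upper[OF Q])
  have fin: "A1_const u < \<infinity>" using u by (simp add: A1_def)
  show ?case
  proof
    assume "y \<in> Q"
    then have e: "e \<le> ennreal (u y)" using elim by (simp add: e_def)
    then have "e \<noteq> \<infinity>" by (auto simp: top_unique)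
    have "a \<le> A1_const u * e"
    \<comment> \<open>If the essential infimum is 0, its inverse is \<open>\<infinity>\<close>, and
      a finite A_1 constant leaves only the average 0.\<close>
    proof (cases "e = 0")
      case True
      then have "a = 0"
        using A fin by (cases "a = 0") (auto simp: ennreal_mult_top top_unique)
      then show ?thesis by simp
    next
      case False
      then have "a = a * inverse e * e"
        using \<open>e \<noteq> \<infinity>\<close> ennreal_divide_mult_cancel[of e a] by (simp add: divide_ennreal_def)
      also have "\<dots> \<le> A1_const u * e"
        by (intro mult_right_mono A) auto
      finally show ?thesis .
    qed
    also have "\<dots> \<le> A1_const u * ennreal (u y)"
      by (intro mult_left_mono e) auto
    finally show "avg Q (\<lambda>x. ennreal (u x)) \<le> A1_const u * ennreal (u y)"
      by (simp only: a_def)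
  qed
qed

text \<open>The factor next to \<open>t\<close> is the ratio of the volumes of a cube of side 2r and
  a ball of radius r. The added 1 makes the constant positive for every \<open>t\<close>.\<close>

definition ball_const :: "'n::finite itself \<Rightarrow> ennreal \<Rightarrow> real" where
  "ball_const _ t = enn2real t * 2 ^ CARD('n) / unit_ball_vol (real CARD('n)) + 1"

lemma ball_const_pos: "ball_const TYPE('n::finite) t > 0"
  by (simp add: ball_const_def add_nonneg_pos)

lemma A1_weight_of_A1:
  fixes u :: "real ^ 'n::finite \<Rightarrow> real"
  assumes u: "u \<in> A1" and nontriv: "\<not> (AE x in lebesgue. ennreal (u x) = 0)"
  shows "A1_weight (\<lambda>x. ennreal (u x)) (ball_const TYPE('n) (A1_const u))"
proof
  have w: "weight u" using u by (simp add: A1_def)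
  have [measurable]: "u \<in> borel_measurable lebesgue" by (rule weight_measurable[OF w])
  show "(\<lambda>x. ennreal (u x)) \<in> borel_measurable lebesgue" by measurable
  show "ennreal (u x) < \<infinity>" for x by simp
  show "(\<integral>\<^sup>+x\<in>ball c r. ennreal (u x) \<partial>lebesgue) < \<infinity>" for c r
  proof -
    have "(\<integral>\<^sup>+x\<in>ball c r. ennreal (u x) \<partial>lebesgue) \<le> (\<integral>\<^sup>+x\<in>cball c r. ennreal (u x) \<partial>lebesgue)"
      by (intro nn_integral_mono) (auto simp: indicator_def)
    also have "\<dots> < \<infinity>" by (rule weight_nn_integral_finite[OF w]) simp
    finally show ?thesis .
  qed
  show "ball_const TYPE('n) (A1_const u) > 0" by (rule ball_const_pos)
  show "\<not> (AE x in lebesgue. ennreal (u x) = 0)" by (rule nontriv)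
  fix c :: "real ^ 'n" and r :: real assume r: "0 < r"
  define a b where "a = c - (\<chi> i. r)" and "b = c + (\<chi> i. r)"
  define Q where "Q = cbox a b"
  have side: "b $ i - a $ i = 2 * r" for i by (simp add: a_def b_def)
  have Q: "Q \<in> cubes"
    unfolding Q_def by (rule cubesI[OF _ side]) (use r in simp)
  have vQ: "emeasure lebesgue Q = ennreal ((2 * r) ^ CARD('n))"
    unfolding Q_def using r side by (intro emeasure_cube) auto
  have sub: "ball c r \<subseteq> Q"
  proof
    fix x assume "x \<in> ball c r"
    then have "\<bar>(x - c) $ i\<bar> < r" for i
      using component_le_norm_cart[of "x - c" i] by (simp add: dist_norm norm_minus_commute)
    then show "x \<in> Q"
      by (auto simp: Q_def mem_box_cart a_def b_def abs_less_iff) (smt (verit))+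
  qed
  obtain A where A: "A \<ge> 0" "A1_const u = ennreal A"
    using u by (cases "A1_const u") (auto simp: A1_def)
  define V where "V = unit_ball_vol (real CARD('n))"
  have V: "V > 0" by (simp add: V_def)
  have K: "ball_const TYPE('n) (A1_const u) = A * 2 ^ CARD('n) / V + 1"
    using A by (simp add: ball_const_def V_def)
  have vB: "emeasure lebesgue (ball c r) = ennreal (V * r ^ CARD('n))"
    using r by (simp add: emeasure_ball V_def)
  show "AE y in lebesgue. y \<in> ball c r \<longrightarrow> (\<integral>\<^sup>+x\<in>ball c r. ennreal (u x) \<partial>lebesgue)
     \<le> ennreal (ball_const TYPE('n) (A1_const u)) * emeasure lebesgue (ball c r) * ennreal (u y)"
    using A1_AE[OF u Q]
  proof eventually_elim
    case (elim y)
    show ?case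
    proof
      assume "y \<in> ball c r"
      then have y: "avg Q (\<lambda>x. ennreal (u x)) \<le> ennreal A * ennreal (u y)"
        using elim sub A by auto
      have "(\<integral>\<^sup>+x\<in>ball c r. ennreal (u x) \<partial>lebesgue) \<le> (\<integral>\<^sup>+x\<in>Q. ennreal (u x) \<partial>lebesgue)"
        using sub by (intro nn_integral_mono) (auto simp: indicator_def)
      also have "\<dots> = avg Q (\<lambda>x. ennreal (u x)) * emeasure lebesgue Q"
        by (rule avg_mult_cube[OF Q, symmetric])
      also have "\<dots> \<le> (ennreal A * ennreal (u y)) * ennreal ((2 * r) ^ CARD('n))"
        unfolding vQ by (intro mult_right_mono y) auto
      also have "\<dots> = ennreal (A * (2 * r) ^ CARD('n)) * ennreal (u y)"
        using A r by (subst ennreal_mult) (auto simp: mult_ac)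
      also have "\<dots> \<le> ennreal ((A * 2 ^ CARD('n) / V + 1) * (V * r ^ CARD('n))) * ennreal (u y)"
        using A r V by (intro mult_right_mono ennreal_leI) (auto simp: field_simps power_mult_distrib)
      also have "\<dots> = ennreal (ball_const TYPE('n) (A1_const u)) * emeasure lebesgue (ball c r) * ennreal (u y)"
        unfolding vB K using A r V by (subst ennreal_mult) auto
      finally show "(\<integral>\<^sup>+x\<in>ball c r. ennreal (u x) \<partial>lebesgue)
         \<le> ennreal (ball_const TYPE('n) (A1_const u)) * emeasure lebesgue (ball c r) * ennreal (u y)" .
    qed
  qed
qed

section \<open>The Hardy-Littlewood maximal function over cubes\<close>

lemma nn_integral_norm_eq_L1_norm:
  "integrable lebesgue g \<Longrightarrow> (\<integral>\<^sup>+x. ennreal (norm (g x)) \<partial>lebesgue) = ennreal (L1_norm g)"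
  unfolding L1_norm_def by (intro nn_integral_eq_integral integrable_norm) auto

lemma L1_norm_nonneg: "L1_norm g \<ge> 0"
  by (simp add: L1_norm_def)

text \<open>A closed cube need not be a neighbourhood of its points, so a cube with average above
  \<open>t\<close> is slightly enlarged. The integral does not decrease and the volume is continuous
  in the side, so the average stays above \<open>t\<close>, and the interior of the larger cube lies
  in the level set.\<close>

lemma open_less_maximal_function:
  fixes g :: "real ^ 'n::finite \<Rightarrow> complex"
  assumes g: "integrable lebesgue g"
  shows "open {x. t < maximal_function g x}"
proof (subst open_subopen, safe)
  fix x assume "t < maximal_function g x"
  then obtain Q where Q: "Q \<in> cubes" "x \<in> Q" "t < avg Q (\<lambda>y. ennreal (norm (g y)))"
    unfolding maximal_function_def less_SUP_iff by blast
  from Q(1) obtain a b l where l: "l > 0" and ab: "Q = cbox a b" "\<And>i. b $ i - a $ i = l"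
    and vol: "emeasure lebesgue Q = ennreal (l ^ CARD('n))"
    by (rule cubesE) blast
  define I where "I = (\<integral>\<^sup>+y\<in>Q. ennreal (norm (g y)) \<partial>lebesgue)"
  have "I \<le> (\<integral>\<^sup>+y. ennreal (norm (g y)) \<partial>lebesgue)"
    unfolding I_def by (intro nn_integral_mono) (auto simp: indicator_def)
  then have "I < \<infinity>"
    unfolding nn_integral_norm_eq_L1_norm[OF g] by (rule le_less_trans) simp
  then obtain i where i: "i \<ge> 0" "I = ennreal i" by (cases I) auto
  have t: "t < ennreal (i / l ^ CARD('n))"
    using Q(3) l i unfolding avg_def I_def[symmetric] vol by (simp add: divide_ennreal)
  then obtain t' where t': "t' \<ge> 0" "t = ennreal t'" by (cases t) auto
  have "((\<lambda>e. i / (l + 2 * e) ^ CARD('n)) \<longlongrightarrow> i / (l + 2 * 0) ^ CARD('n)) (at_right 0)"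
    using l by (intro tendsto_intros) auto
  moreover have "t' < i / (l + 2 * 0) ^ CARD('n)"
    using t t' i l by (simp add: ennreal_less_iff)
  ultimately have "\<forall>\<^sub>F e in at_right 0. t' < i / (l + 2 * e) ^ CARD('n)"
    by (rule order_tendstoD)
  moreover have "\<forall>\<^sub>F e in at_right (0::real). e > 0"
    by (rule eventually_at_right_less)
  ultimately have "\<forall>\<^sub>F e in at_right 0. e > 0 \<and> t' < i / (l + 2 * e) ^ CARD('n)"
    by eventually_elim auto
  then obtain e where e: "e > 0" "t' < i / (l + 2 * e) ^ CARD('n)"
    using eventually_happens'[of "at_right (0::real)"] by (metis (mono_tags, lifting) trivial_limit_at_right_real)
  define a' b' where "a' = a - (\<chi> i. e)" and "b' = b + (\<chi> i. e)"
  have side: "b' $ i - a' $ i = l + 2 * e" for i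
    using ab(2)[of i] by (simp add: a'_def b'_def)
  have Q': "cbox a' b' \<in> cubes"
    by (rule cubesI[OF _ side]) (use l e in simp)
  have "Q \<subseteq> cbox a' b'"
    unfolding ab(1) using e(1)
    by (auto simp: mem_box_cart a'_def b'_def algebra_simps) (meson add_increasing less_imp_le)+
  then have "I \<le> (\<integral>\<^sup>+y\<in>cbox a' b'. ennreal (norm (g y)) \<partial>lebesgue)"
    unfolding I_def by (intro nn_integral_mono) (auto simp: indicator_def)
  then have "I / ennreal ((l + 2 * e) ^ CARD('n)) \<le> avg (cbox a' b') (\<lambda>y. ennreal (norm (g y)))"
    unfolding avg_def using side l e by (subst emeasure_cube[of "l + 2 * e"]) (auto intro: divide_right_mono_ennreal)
  moreover have "t < I / ennreal ((l + 2 * e) ^ CARD('n))"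
    using e l i t' by (simp add: divide_ennreal ennreal_less_iff)
  ultimately have less: "t < avg (cbox a' b') (\<lambda>y. ennreal (norm (g y)))" by (rule less_le_trans[rotated])
  show "\<exists>T. open T \<and> x \<in> T \<and> T \<subseteq> {x. t < maximal_function g x}"
  proof (intro exI conjI)
    show "open (box a' b')" by (rule open_box)
    show "x \<in> box a' b'"
      using Q(2) e unfolding ab(1)
      by (auto simp: mem_box_cart a'_def b'_def) (smt (verit))+
    show "box a' b' \<subseteq> {x. t < maximal_function g x}"
    proof
      fix y assume "y \<in> box a' b'"
      then have "y \<in> cbox a' b'" using box_subset_cbox by blast
      then have "avg (cbox a' b') (\<lambda>y. ennreal (norm (g y))) \<le> maximal_function g y"
        unfolding maximal_function_def using Q' by (intro SUP_upper) auto
      then show "y \<in> {x. t < maximal_function g x}"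
        using less by (auto intro: less_le_trans)
    qed
  qed
qed

lemma measurable_maximal_function:
  fixes g :: "real ^ 'n::finite \<Rightarrow> complex"
  assumes "integrable lebesgue g"
  shows "maximal_function g \<in> borel_measurable lebesgue"
  by (rule borel_measurableI_greater) (simp add: open_less_maximal_function[OF assms] lebesgue.open_in_sets)

text \<open>A cube of side l lies in the ball of radius (n + 1) l about its lower corner; this is
  the quotient of their volumes.\<close>

definition cube_ball_ratio :: "'n::finite itself \<Rightarrow> real" where
  "cube_ball_ratio _ = unit_ball_vol (real CARD('n)) * (real CARD('n) + 1) ^ CARD('n)"

lemma cube_ball_ratio_pos: "cube_ball_ratio TYPE('n::finite) > 0"
  by (auto simp: cube_ball_ratio_def intro!: mult_pos_pos zero_less_power)

lemma maximal_function_le_max_fun: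
  fixes g :: "real ^ 'n::finite \<Rightarrow> complex"
  shows "maximal_function g x \<le> ennreal (cube_ball_ratio TYPE('n)) * max_fun lebesgue (\<lambda>y. ennreal (norm (g y))) x"
  unfolding maximal_function_def
proof (rule SUP_least)
  let ?c = "ennreal (cube_ball_ratio TYPE('n))"
  fix Q assume "Q \<in> {Q \<in> cubes. x \<in> Q}"
  then have Q: "Q \<in> cubes" "x \<in> Q" by auto
  from Q(1) obtain a b l where l: "l > 0" and ab: "Q = cbox a b" "\<And>i. b $ i - a $ i = l"
    and vol: "emeasure lebesgue Q = ennreal (l ^ CARD('n))"
    by (rule cubesE) blast
  define r where "r = (real CARD('n) + 1) * l"
  have r: "r > 0" using l by (simp add: r_def add_nonneg_pos)
  have sub: "Q \<subseteq> ball a r"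
  proof
    fix y assume y: "y \<in> Q"
    have "\<bar>(y - a) $ i\<bar> \<le> l" for i
      using y ab(2)[of i] unfolding ab(1) by (auto simp: mem_box_cart abs_le_iff algebra_simps dest!: spec[of _ i])
    then have "norm (y - a) \<le> (\<Sum>i::'n\<in>UNIV. l)"
      by (intro order_trans[OF norm_le_l1_cart] sum_mono)
    also have "\<dots> < r" using l by (simp add: r_def algebra_simps)
    finally show "y \<in> ball a r" by (simp add: dist_norm norm_minus_commute)
  qed
  let ?M = "max_fun lebesgue (\<lambda>y. ennreal (norm (g y))) x"
  have "(\<integral>\<^sup>+y\<in>Q. ennreal (norm (g y)) \<partial>lebesgue) \<le> (\<integral>\<^sup>+y\<in>ball a r. ennreal (norm (g y)) \<partial>lebesgue)"
    using sub by (intro nn_integral_mono) (auto simp: indicator_def)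
  also have "\<dots> \<le> ?M * emeasure lebesgue (ball a r)"
    using sub Q(2) r by (intro lebesgue.nn_integral_ball_le_max_fun) auto
  also have "emeasure lebesgue (ball a r) = ?c * ennreal (l ^ CARD('n))"
    using l r cube_ball_ratio_pos[where 'n = 'n]
    by (subst ennreal_mult[symmetric]) (auto simp: emeasure_ball cube_ball_ratio_def r_def power_mult_distrib)
  finally have "avg Q (\<lambda>y. ennreal (norm (g y)))
     \<le> (?c * ?M) * ennreal (l ^ CARD('n)) / ennreal (l ^ CARD('n))"
    unfolding avg_def vol by (intro divide_right_mono_ennreal) (simp only: ac_simps)
  also have "\<dots> = ?c * ?M"
    using l by (intro ennreal_mult_divide_eq) auto
  finally show "avg Q (\<lambda>y. ennreal (norm (g y))) \<le> \<dots>" .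
qed

definition Kolmogorov_const :: "'n::finite itself \<Rightarrow> real \<Rightarrow> real" where
  "Kolmogorov_const _ d = cube_ball_ratio TYPE('n) powr d * (1 + 5 ^ CARD('n) * d / (1 - d))"

lemma Kolmogorov_const_pos: "0 < d \<Longrightarrow> d < 1 \<Longrightarrow> Kolmogorov_const TYPE('n::finite) d > 0"
  using cube_ball_ratio_pos[where 'n = 'n]
  by (auto simp: Kolmogorov_const_def intro!: mult_pos_pos add_pos_nonneg)

lemma Kolmogorov_maximal_function:
  fixes g :: "real ^ 'n::finite \<Rightarrow> complex"
  assumes g: "integrable lebesgue g" and E: "E \<in> sets lebesgue" and d: "0 < d" "d < 1"
  shows "(\<integral>\<^sup>+x\<in>E. epow (maximal_function g x) d \<partial>lebesgue)
    \<le> ennreal (Kolmogorov_const TYPE('n) d) * epow (emeasure lebesgue E) (1 - d) * ennreal (L1_norm g powr d)"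
proof -
  let ?M = "max_fun lebesgue (\<lambda>y. ennreal (norm (g y)))"
  let ?c = "cube_ball_ratio TYPE('n) powr d"
  have [measurable]: "g \<in> borel_measurable lebesgue" using g by (rule borel_measurable_integrable)
  note [measurable] = E lebesgue.measurable_max_fun
  have "(\<integral>\<^sup>+x\<in>E. epow (maximal_function g x) d \<partial>lebesgue)
    \<le> (\<integral>\<^sup>+x. ennreal ?c * (epow (?M x) d * indicator E x) \<partial>lebesgue)"
  proof (intro nn_integral_mono)
    fix x
    have "epow (maximal_function g x) d \<le> epow (ennreal (cube_ball_ratio TYPE('n)) * ?M x) d"
      using d by (intro epow_mono maximal_function_le_max_fun) auto
    also have "\<dots> = ennreal ?c * epow (?M x) d"
      using d cube_ball_ratio_pos[where 'n = 'n] by (simp add: epow_mult epow_ennreal)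
    finally show "epow (maximal_function g x) d * indicator E x \<le> ennreal ?c * (epow (?M x) d * indicator E x)"
      by (auto simp: indicator_def)
  qed
  also have "\<dots> = ennreal ?c * (\<integral>\<^sup>+x\<in>E. epow (?M x) d \<partial>lebesgue)"
    by (rule nn_integral_cmult) measurable
  also have "\<dots> \<le> ennreal ?c * (ennreal (1 + 5 ^ CARD('n) * d / (1 - d)) * epow (emeasure lebesgue E) (1 - d)
      * epow (\<integral>\<^sup>+x. ennreal (norm (g x)) \<partial>lebesgue) d)"
    using lebesgue.Kolmogorov_max_fun[of "\<lambda>y. ennreal (norm (g y))" E d] d E
    by (intro mult_left_mono) auto
  also have "\<dots> = ennreal (Kolmogorov_const TYPE('n) d) * epow (emeasure lebesgue E) (1 - d) * ennreal (L1_norm g powr d)"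
    using d L1_norm_nonneg[of g]
    by (simp add: nn_integral_norm_eq_L1_norm[OF g] epow_ennreal_nonneg Kolmogorov_const_def ennreal_mult'' mult.assoc)
  finally show ?thesis .
qed

text \<open>Kolmogorov's inequality with \<open>d = 1/2\<close> makes the square root integrable
  over balls, hence finite a.e.\<close>

lemma maximal_function_finite_AE:
  fixes g :: "real ^ 'n::finite \<Rightarrow> complex"
  assumes g: "integrable lebesgue g"
  shows "AE x in lebesgue. maximal_function g x < \<infinity>"
proof -
  note [measurable] = measurable_maximal_function[OF g]
  have "AE x in lebesgue. epow (maximal_function g x) (1 / 2) * indicator (ball 0 (real k)) x \<noteq> \<infinity>" for k :: nat
  proof (rule nn_integral_PInf_AE)
    have "(\<integral>\<^sup>+x\<in>ball 0 (real k). epow (maximal_function g x) (1 / 2) \<partial>lebesgue)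
      \<le> ennreal (Kolmogorov_const TYPE('n) (1 / 2)) * epow (emeasure lebesgue (ball (0::real ^ 'n) (real k))) (1 - 1 / 2) * ennreal (L1_norm g powr (1 / 2))"
      by (rule Kolmogorov_maximal_function[OF g]) auto
    also have "\<dots> < \<infinity>"
      using epow_less_top[of "1 - 1 / 2" "emeasure lebesgue (ball (0::real ^ 'n) (real k))"] lebesgue.ball_finite[of "0::real ^ 'n" "real k"]
      by (simp add: ennreal_mult_less_top)
    finally show "(\<integral>\<^sup>+x\<in>ball 0 (real k). epow (maximal_function g x) (1 / 2) \<partial>lebesgue) \<noteq> \<infinity>" by auto
  qed measurable
  then have "AE x in lebesgue. \<forall>k::nat. epow (maximal_function g x) (1 / 2) * indicator (ball 0 (real k)) x \<noteq> \<infinity>"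
    by (subst AE_all_countable) blast
  then show ?thesis
  proof eventually_elim
    case (elim x)
    obtain k :: nat where "norm x < real k" using reals_Archimedean2 by blast
    then have "epow (maximal_function g x) (1 / 2) \<noteq> \<infinity>" using elim[rule_format, of k] by simp
    then show ?case
      using epow_eq_top_iff[of "1 / 2" "maximal_function g x"] by (auto simp: less_top)
  qed
qed

text \<open>Positivity holds at every point: a zero at a single \<open>x\<close> would make
  \<open>g\<close> vanish a.e. on all cubes centred at \<open>x\<close>, and these exhaust the
  space.\<close>

lemma maximal_function_pos:
  fixes g :: "real ^ 'n::finite \<Rightarrow> complex"
  assumes g: "integrable lebesgue g" and pos: "L1_norm g > 0"
  shows "0 < maximal_function g x"
proof (rule ccontr)
  assume "\<not> 0 < maximal_function g x"
  then have 0: "maximal_function g x = 0" by (simp add: zero_less_iff_neq_zero)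
  have [measurable]: "g \<in> borel_measurable lebesgue" using g by (rule borel_measurable_integrable)
  have "AE y in lebesgue. y \<in> ball x (real k) \<longrightarrow> g y = 0" for k :: nat
  proof (cases "k = 0")
    case False
    define a b where "a = x - (\<chi> i. real k)" and "b = x + (\<chi> i. real k)"
    have side: "b $ i - a $ i = 2 * real k" for i by (simp add: a_def b_def)
    have Q: "cbox a b \<in> cubes"
      by (rule cubesI[OF _ side]) (use False in simp)
    have "x \<in> cbox a b" by (simp add: mem_box_cart a_def b_def)
    then have "avg (cbox a b) (\<lambda>y. ennreal (norm (g y))) \<le> maximal_function g x"
      unfolding maximal_function_def using Q by (intro SUP_upper) auto
    then have "(\<integral>\<^sup>+y\<in>cbox a b. ennreal (norm (g y)) \<partial>lebesgue) = 0"
      using 0 avg_mult_cube[OF Q, of "\<lambda>y. ennreal (norm (g y))"] by simp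
    moreover have [measurable]: "cbox a b \<in> sets lebesgue" by simp
    ultimately have "AE y in lebesgue. ennreal (norm (g y)) * indicator (cbox a b) y = 0"
      by (subst (asm) nn_integral_0_iff_AE, measurable)
    then show ?thesis
    proof eventually_elim
      case (elim y)
      show ?case
      proof
        assume "y \<in> ball x (real k)"
        then have "\<bar>(y - x) $ i\<bar> < real k" for i
          using component_le_norm_cart[of "y - x" i] by (simp add: dist_norm norm_minus_commute)
        then have "y \<in> cbox a b"
          by (auto simp: mem_box_cart a_def b_def abs_less_iff) (smt (verit))+
        then show "g y = 0" using elim by simp
      qed
    qed
  qed simp
  then have "AE y in lebesgue. \<forall>k::nat. y \<in> ball x (real k) \<longrightarrow> g y = 0"
    by (subst AE_all_countable) blast
  then have "AE y in lebesgue. norm (g y) = 0"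
  proof eventually_elim
    case (elim y)
    obtain k :: nat where "dist x y < real k" using reals_Archimedean2 by blast
    then show ?case using elim by auto
  qed
  then have "L1_norm g = 0"
    unfolding L1_norm_def by (rule integral_eq_zero_AE)
  then show False using pos by simp
qed

section \<open>The two estimates\<close>

text \<open>This allows negative exponents as long as one factor avoids 0 and
  \<open>\<infinity>\<close>: in the dual weight \<open>u x\<close> does so, while the maximal
  function may take either value.\<close>

lemma epow_mult_finite_right:
  assumes "0 < y" "y < \<infinity>"
  shows "epow (x * y) a = epow x a * epow y a"
proof -
  obtain r where y: "r > 0" "y = ennreal r"
    using assms by (metis ennreal_cases_pos less_irrefl)
  consider "x = 0" "a > 0" | "x = 0" "a < 0" | "x = \<infinity>" "a > 0" | "x = \<infinity>" "a < 0" | "a = 0"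
    | s where "s > 0" "x = ennreal s"
    by (metis ennreal_cases_pos linorder_less_linear)
  then show ?thesis
    by cases (use y in \<open>simp_all add: epow_ennreal ennreal_mult[symmetric] powr_mult ennreal_top_mult\<close>)
qed

lemma maximal_weight_dual:
  fixes x :: "real ^ 'n::finite"
  assumes p: "1 < p" and u: "u x > 0"
  shows "epow (maximal_weight \<alpha> p q g u x) (- (conj_exponent p / p))
    = epow (maximal_function g x) (Theta (real CARD('n)) \<alpha> p q / real CARD('n) * conj_exponent p)
      * epow (ennreal (u x)) (- (conj_exponent p / q))"
proof -
  have "epow (maximal_weight \<alpha> p q g u x) (- (conj_exponent p / p))
    = epow (epow (maximal_function g x) (- (Theta (real CARD('n)) \<alpha> p q * p / real CARD('n)))) (- (conj_exponent p / p))
     * epow (epow (ennreal (u x)) (p / q)) (- (conj_exponent p / p))"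
    unfolding maximal_weight_def using u
    by (intro epow_mult_finite_right epow_pos epow_finite) auto
  then show ?thesis
    using p by (simp add: epow_epow mult.commute)
qed

text \<open>On Q the A_1 condition bounds \<open>u\<close> below by a multiple of its average, so
  \<open>u^(-p'/q)\<close> leaves the dual average as a constant. The remaining power
  \<open>\<theta> p' < 1\<close> of the maximal function is Kolmogorov's case, and all powers of |Q|
  and of the average of \<open>u\<close> cancel.\<close>

lemma Apq_const_le:
  fixes p q \<alpha> :: real and u :: "real ^ 'n::finite \<Rightarrow> real" and g :: "real ^ 'n \<Rightarrow> complex"
  defines "\<theta> \<equiv> Theta (real CARD('n)) \<alpha> p q / real CARD('n)"
  assumes p: "1 < p" "p \<le> q" and \<theta>: "0 < \<theta>" "\<theta> * conj_exponent p < 1"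
    and u: "u \<in> A1" and g: "integrable lebesgue g"
  shows "Apq_const \<alpha> p q (\<lambda>x. ennreal (u x)) (maximal_weight \<alpha> p q g u)
    \<le> ennreal ((enn2real (A1_const u) + 1) powr (1 / q)
        * Kolmogorov_const TYPE('n) (\<theta> * conj_exponent p) powr (1 / conj_exponent p)
        * L1_norm g powr \<theta>)"
  unfolding Apq_const_def \<theta>_def[symmetric]
proof (rule SUP_least)
  fix Q :: "(real ^ 'n) set" assume Q: "Q \<in> cubes"
  define p' where "p' = conj_exponent p"
  have p': "p' > 1" using p by (simp add: p'_def conj_exponent_def)
  define d where "d = \<theta> * p'"
  have d: "0 < d" "d < 1" using \<theta> p' by (auto simp: d_def p'_def)
  define Ck where "Ck = Kolmogorov_const TYPE('n) d"
  have Ck: "Ck > 0" unfolding Ck_def by (rule Kolmogorov_const_pos[OF d])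
  define L where "L = L1_norm g"
  have L: "L \<ge> 0" by (simp add: L_def L1_norm_nonneg)
  \<comment> \<open>The added 1 permits division by \<open>A\<close>.\<close>
  define A where "A = enn2real (A1_const u) + 1"
  have A: "A > 0" by (simp add: A_def add_nonneg_pos)
  have A_ge: "A1_const u \<le> ennreal A"
    using u by (cases "A1_const u") (auto simp: A1_def A_def)
  have w: "weight u" using u by (simp add: A1_def)
  have [measurable]: "u \<in> borel_measurable lebesgue" by (rule weight_measurable[OF w])
  note [measurable] = measurable_maximal_function[OF g]
  from Q obtain a b l where l: "l > 0" and ab: "Q = cbox a b"
    and vol: "emeasure lebesgue Q = ennreal (l ^ CARD('n))"
    by (rule cubesE) blast
  have [measurable]: "Q \<in> sets lebesgue" by (simp add: ab)
  define v where "v = l ^ CARD('n)"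
  have v: "v > 0" using l by (simp add: v_def)
  define U where "U = avg Q (\<lambda>x. ennreal (u x))"
  define W where "W = avg Q (\<lambda>x. epow (maximal_weight \<alpha> p q g u x) (- (p' / p)))"
  have "U * ennreal v < \<infinity>"
    unfolding U_def v_def vol[symmetric] avg_mult_cube[OF Q] unfolding ab
    by (intro weight_nn_integral_finite w compact_cbox)
  then have "U \<noteq> \<infinity>" using v by (auto simp: ennreal_top_mult)
  show "epow (emeasure lebesgue Q) \<theta> * epow U (1 / q) * epow W (1 / p')
     \<le> ennreal ((enn2real (A1_const u) + 1) powr (1 / q) * Kolmogorov_const TYPE('n) (\<theta> * p') powr (1 / p') * L1_norm g powr \<theta>)"
  proof (cases "U = 0")
    \<comment> \<open>A zero average of \<open>u\<close> makes the product 0 even when the dual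
      average is infinite.\<close>
    case True
    then show ?thesis using p by simp
  next
    case False
    then obtain m where m: "m > 0" "U = ennreal m"
      using \<open>U \<noteq> \<infinity>\<close> by (metis ennreal_cases_pos)
    define c where "c = (m / A) powr (- (p' / q))"
    have c: "c > 0" using m A by (simp add: c_def)
    have "(\<integral>\<^sup>+x\<in>Q. epow (maximal_weight \<alpha> p q g u x) (- (p' / p)) \<partial>lebesgue)
      \<le> (\<integral>\<^sup>+x. ennreal c * (epow (maximal_function g x) d * indicator Q x) \<partial>lebesgue)"
    proof (rule nn_integral_mono_AE)
      show "AE x in lebesgue. epow (maximal_weight \<alpha> p q g u x) (- (p' / p)) * indicator Q x
         \<le> ennreal c * (epow (maximal_function g x) d * indicator Q x)"
        using A1_AE[OF u Q]
      proof eventually_elim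
        case (elim x)
        show ?case
        proof (cases "x \<in> Q")
          case True
          then have "ennreal m \<le> A1_const u * ennreal (u x)"
            using elim m by (simp add: U_def)
          also have "\<dots> \<le> ennreal A * ennreal (u x)"
            by (intro mult_right_mono A_ge) auto
          also have "\<dots> = ennreal (A * u x)" using A by (simp add: ennreal_mult')
          finally have le: "ennreal m \<le> ennreal (A * u x)" .
          then have "0 < A * u x"
            using m by (metis ennreal_eq_0_iff ennreal_less_zero_iff leD le_zero_eq linorder_not_le not_less_iff_gr_or_eq)
          then have ux: "u x > 0" using A by (simp add: zero_less_mult_iff)
          have "m \<le> A * u x"
            using le \<open>0 < A * u x\<close> by (subst (asm) ennreal_le_iff) auto
          then have "m / A \<le> u x" using A by (simp add: field_simps)
          then have "u x powr (- (p' / q)) \<le> c"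
            unfolding c_def using m A p p' by (intro powr_mono2') auto
          then have "epow (ennreal (u x)) (- (p' / q)) \<le> ennreal c"
            using ux by (simp add: epow_ennreal ennreal_leI)
          then have "epow (maximal_function g x) d * epow (ennreal (u x)) (- (p' / q))
             \<le> epow (maximal_function g x) d * ennreal c"
            by (rule mult_left_mono) simp
          then show ?thesis
            using True maximal_weight_dual[of p u x \<alpha> q g, folded \<theta>_def p'_def] p(1) ux
            by (simp add: d_def mult.commute)
        qed simp
      qed
    qed
    also have "\<dots> = ennreal c * (\<integral>\<^sup>+x\<in>Q. epow (maximal_function g x) d \<partial>lebesgue)"
      by (rule nn_integral_cmult) measurable
    also have "\<dots> \<le> ennreal c * (ennreal Ck * epow (emeasure lebesgue Q) (1 - d) * ennreal (L powr d))"
      unfolding Ck_def L_def by (intro mult_left_mono Kolmogorov_maximal_function g d) auto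
    also have "\<dots> = ennreal (c * (Ck * v powr (1 - d) * L powr d))"
      unfolding vol v_def[symmetric] using c Ck v by (simp add: epow_ennreal ennreal_mult)
    finally have "W \<le> ennreal (c * (Ck * v powr (1 - d) * L powr d)) / ennreal v"
      unfolding W_def avg_def vol v_def[symmetric] by (rule divide_right_mono_ennreal)
    also have "\<dots> = ennreal (c * (Ck * v powr (1 - d) * L powr d) / v)"
      using v c Ck by (intro divide_ennreal) auto
    also have "c * (Ck * v powr (1 - d) * L powr d) / v = c * Ck * v powr (- d) * L powr d"
      using v by (simp add: powr_diff powr_minus field_simps)
    finally have "epow W (1 / p') \<le> epow (ennreal (c * Ck * v powr (- d) * L powr d)) (1 / p')"
      using p' by (intro epow_mono) auto
    also have "\<dots> = ennreal ((c * Ck * v powr (- d) * L powr d) powr (1 / p'))"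
      using p' c Ck by (intro epow_ennreal_nonneg) auto
    also have "(c * Ck * v powr (- d) * L powr d) powr (1 / p')
      = c powr (1 / p') * Ck powr (1 / p') * v powr (- \<theta>) * L powr \<theta>"
      using c Ck v p' by (simp add: powr_mult powr_powr d_def)
    also have "c powr (1 / p') = m powr (- (1 / q)) * A powr (1 / q)"
      using m A p' by (simp add: c_def powr_powr powr_divide powr_minus field_simps)
    finally have W: "epow W (1 / p') \<le> ennreal (m powr (- (1 / q)) * A powr (1 / q) * Ck powr (1 / p') * v powr (- \<theta>) * L powr \<theta>)" .
    have "epow (emeasure lebesgue Q) \<theta> * epow U (1 / q) * epow W (1 / p')
      \<le> ennreal (v powr \<theta>) * ennreal (m powr (1 / q))
        * ennreal (m powr (- (1 / q)) * A powr (1 / q) * Ck powr (1 / p') * v powr (- \<theta>) * L powr \<theta>)"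
      using W m v unfolding vol v_def[symmetric] by (simp add: epow_ennreal mult_left_mono)
    also have "\<dots> = ennreal (v powr \<theta> * m powr (1 / q)
        * (m powr (- (1 / q)) * A powr (1 / q) * Ck powr (1 / p') * v powr (- \<theta>) * L powr \<theta>))"
      by (simp add: ennreal_mult)
    also have "v powr \<theta> * m powr (1 / q)
        * (m powr (- (1 / q)) * A powr (1 / q) * Ck powr (1 / p') * v powr (- \<theta>) * L powr \<theta>)
      = A powr (1 / q) * Ck powr (1 / p') * L powr \<theta>"
    proof -
      have "v powr \<theta> * v powr (- \<theta>) = 1" "m powr (1 / q) * m powr (- (1 / q)) = 1"
        using v m by (simp_all add: powr_add[symmetric])
      then show ?thesis by algebra
    qed
    finally show ?thesis
      by (simp add: A_def Ck_def L_def d_def)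
  qed
qed

text \<open>Where the integral does not converge absolutely, both sides are
  \<open>\<infinity>\<close>; a bound on the Riesz potential therefore includes convergence.\<close>

lemma abs_frac_integral_le:
  fixes f :: "real ^ 'n::finite \<Rightarrow> complex"
  assumes [measurable]: "f \<in> borel_measurable lebesgue"
  shows "abs_frac_integral \<alpha> f x
    \<le> riesz_potential \<alpha> (\<lambda>y. ennreal (norm (f y))) x"
proof -
  have "(\<lambda>y. norm (x - y) powr (real CARD('n) - \<alpha>)) \<in> borel_measurable lebesgue"
    by (rule measurable_completion) measurable
  then have meas: "frac_kernel_prod \<alpha> f x \<in> borel_measurable lebesgue"
    unfolding frac_kernel_prod_def[abs_def] by measurable
  have eq: "ennreal (norm (frac_kernel_prod \<alpha> f x y))
    = ennreal (norm (f y)) * ennreal (1 / norm (x - y) powr (real CARD('n) - \<alpha>))" for y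
    by (simp add: frac_kernel_prod_def norm_divide ennreal_mult[symmetric])
  show ?thesis
  proof (cases "integrable lebesgue (frac_kernel_prod \<alpha> f x)")
    case True
    have "ennreal (norm (frac_integral \<alpha> f x)) \<le> (\<integral>\<^sup>+y. ennreal (norm (frac_kernel_prod \<alpha> f x y)) \<partial>lebesgue)"
      unfolding frac_integral_def using True by (rule integral_norm_bound_ennreal)
    then show ?thesis
      using True by (simp add: abs_frac_integral_def eq)
  next
    case False
    then have "(\<integral>\<^sup>+y. ennreal (norm (frac_kernel_prod \<alpha> f x y)) \<partial>lebesgue) = \<infinity>"
      using meas by (auto simp: integrable_iff_bounded not_less top_unique)
    then show ?thesis by (simp add: eq)
  qed
qed

lemma weighted_const_pos:
  assumes "1 < p" "p \<le> q" "1 < s" "s < p" "0 < \<alpha>" "K > 0" "Ck > 0"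
  shows "weighted_const TYPE('n::finite) \<alpha> p q s K Ck > 0"
proof -
  have "2 powr (- \<alpha>) < 1"
    using assms powr_less_mono[of "- \<alpha>" 0 2] by auto
  moreover have "strong_const (q / (q - 1)) (K * 5 ^ CARD('n)) > 0" "strong_const (p / s) (K * 5 ^ CARD('n)) > 0"
    using assms by (intro strong_const_pos; simp)+
  moreover have "level_ratio TYPE('n) > 0"
    using dyadic_vol_pos[where 'n = 'n] by (auto simp: level_ratio_def intro!: add_pos_pos)
  ultimately show ?thesis
    using assms dyadic_vol_pos[where 'n = 'n] unfolding weighted_const_def
    by (intro mult_pos_pos divide_pos_pos) (auto simp: powr_gt_zero)
qed

text \<open>The degenerate cases are separated off here, so that the weighted bound is applied only
  with a nontrivial weight, positive \<open>L1_norm g\<close> and finite right-hand norm.\<close>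

lemma weighted_norm_frac_integral_le:
  fixes p q \<alpha> s :: real and u :: "real ^ 'n::finite \<Rightarrow> real" and f g :: "real ^ 'n \<Rightarrow> complex"
  defines "n \<equiv> real CARD('n)"
  defines "\<theta> \<equiv> Theta n \<alpha> p q / n"
  assumes p: "1 < p" "p \<le> q" and \<alpha>: "0 < \<alpha>" "\<alpha> < n" and \<theta>: "0 < \<theta>"
    and s: "1 < s" "s < p" "\<theta> * (s / (s - 1)) < 1"
    and u: "u \<in> A1" and g: "integrable lebesgue g" and f: "f \<in> borel_measurable lebesgue"
    and nondeg: "\<not> (L1_norm g = 0 \<and> weighted_norm p (\<lambda>x. ennreal (norm (f x))) (maximal_weight \<alpha> p q g u) = \<infinity>)"
  shows "weighted_norm q (abs_frac_integral \<alpha> f) (\<lambda>x. ennreal (u x))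
    \<le> ennreal (weighted_const TYPE('n) \<alpha> p q s (ball_const TYPE('n) (A1_const u))
          (Kolmogorov_const TYPE('n) (\<theta> * (s / (s - 1)))) * L1_norm g powr \<theta>)
      * weighted_norm p (\<lambda>x. ennreal (norm (f x))) (maximal_weight \<alpha> p q g u)"
    (is "?L \<le> ennreal (?C * _) * ?W")
proof -
  define R where "R = (\<integral>\<^sup>+x. epow (ennreal (norm (f x))) p * maximal_weight \<alpha> p q g u x \<partial>lebesgue)"
  define F where "F x = riesz_potential \<alpha> (\<lambda>y. ennreal (norm (f y))) x" for x
  have W: "?W = epow R (1 / p)" by (simp add: weighted_norm_def R_def)
  have n: "n > 0" by (simp add: n_def)
  have L_le: "?L \<le> epow (\<integral>\<^sup>+x. epow (F x) q * ennreal (u x) \<partial>lebesgue) (1 / q)"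
    unfolding weighted_norm_def F_def using p f
    by (intro epow_mono nn_integral_mono mult_right_mono abs_frac_integral_le) auto
  have w: "weight u" using u by (simp add: A1_def)
  note [measurable] = weight_measurable[OF w] measurable_maximal_function[OF g] f
  have d: "0 < \<theta> * (s / (s - 1))" using \<theta> s by simp
  have Ck: "Kolmogorov_const TYPE('n) (\<theta> * (s / (s - 1))) > 0"
    by (rule Kolmogorov_const_pos[OF d s(3)])
  have C: "?C > 0"
    using p s \<alpha> Ck by (intro weighted_const_pos ball_const_pos) auto
  show ?thesis
  proof (cases "AE x in lebesgue. ennreal (u x) = 0")
    case True
    then have "AE x in lebesgue. epow (F x) q * ennreal (u x) = 0"
      by eventually_elim simp
    then have "(\<integral>\<^sup>+x. epow (F x) q * ennreal (u x) \<partial>lebesgue) = (\<integral>\<^sup>+x. 0 \<partial>(lebesgue :: (real ^ 'n) measure))"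
      by (rule nn_integral_cong_AE)
    then show ?thesis using L_le p by simp
  next
    case False
    interpret A1_weight "\<lambda>x. ennreal (u x)" "ball_const TYPE('n) (A1_const u)"
      by (rule A1_weight_of_A1[OF u False])
    show ?thesis
    proof (cases "L1_norm g = 0")
      \<comment> \<open>If \<open>g = 0\<close> a.e., the maximal function vanishes identically and
        its negative power is \<open>\<infinity>\<close>. A finite right-hand norm then forces
        \<open>f = 0\<close> a.e., so the left side is 0 as well.\<close>
      case True
      then have "?W \<noteq> \<infinity>" using nondeg by blast
      then have "R \<noteq> \<infinity>" using p epow_eq_top_iff[of "1 / p" R] by (auto simp: W)
      have g0: "AE x in lebesgue. ennreal (norm (g x)) = 0"
        using nn_integral_norm_eq_L1_norm[OF g] True borel_measurable_integrable[OF g]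
        by (subst nn_integral_0_iff_AE[symmetric]) auto
      have "avg Q (\<lambda>y. ennreal (norm (g y))) = 0" for Q
      proof -
        have "(\<integral>\<^sup>+x\<in>Q. ennreal (norm (g x)) \<partial>lebesgue) = (\<integral>\<^sup>+x. 0 \<partial>(lebesgue :: (real ^ 'n) measure))"
          using g0 by (intro nn_integral_cong_AE) auto
        then show ?thesis by (simp add: avg_def)
      qed
      then have mf: "maximal_function g x = 0" for x
        unfolding maximal_function_def by (simp add: bot_ennreal[symmetric] SUP_bot)
      have "Theta n \<alpha> p q > 0" using \<theta> n by (simp add: \<theta>_def zero_less_divide_iff)
      then have neg: "- (Theta (real CARD('n)) \<alpha> p q * p / real CARD('n)) < 0"
        using p n by (simp add: n_def)
      have "AE x in lebesgue. epow (ennreal (norm (f x))) p * maximal_weight \<alpha> p q g u x \<noteq> \<infinity>"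
        using \<open>R \<noteq> \<infinity>\<close> unfolding R_def maximal_weight_def by (intro nn_integral_PInf_AE) auto
      then have "AE x in lebesgue. f x = 0"
        using AE_w_pos
      proof eventually_elim
        case (elim x)
        have "epow (ennreal (u x)) (p / q) > 0"
          using elim by (intro epow_pos) auto
        then have "maximal_weight \<alpha> p q g u x = \<infinity>"
          unfolding maximal_weight_def mf using neg by (simp add: ennreal_top_mult)
        then have "epow (ennreal (norm (f x))) p = 0"
          using elim by (auto simp: ennreal_mult_top split: if_splits)
        then show ?case using p by (simp add: epow_eq_0_iff)
      qed
      then have "F x = (\<integral>\<^sup>+y. 0 \<partial>(lebesgue :: (real ^ 'n) measure))" for x
        unfolding F_def by (intro nn_integral_cong_AE) auto
      then show ?thesis using L_le p by simp
    next
      case False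
      then have G: "L1_norm g > 0" using L1_norm_nonneg[of g] by simp
      show ?thesis
      proof (cases "R = \<infinity>")
        case True
        then show ?thesis using C G p by (simp add: W ennreal_mult_top)
      next
        case R: False
        have R_eq: "R = (\<integral>\<^sup>+x. epow (ennreal (norm (f x))) p * (epow (maximal_function g x) (- \<theta> * p) * epow (ennreal (u x)) (p / q)) \<partial>lebesgue)"
          by (simp add: R_def maximal_weight_def \<theta>_def n_def mult.commute)
        have "AE x in lebesgue. 0 < maximal_function g x \<and> maximal_function g x < \<infinity>"
          using maximal_function_finite_AE[OF g] maximal_function_pos[OF g G] by simp
        moreover have "1 / p - 1 / q + \<theta> = \<alpha> / n"
          using n by (simp add: \<theta>_def Theta_def field_simps)
        ultimately have "epow (\<integral>\<^sup>+x. epow (F x) q * ennreal (u x) \<partial>lebesgue) (1 / q)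
          \<le> ennreal (?C * L1_norm g powr \<theta>) * epow R (1 / p)"
          unfolding F_def R_eq
          by (intro frac_integral_weighted_bound[where N = "maximal_function g"] p s \<alpha>[unfolded n_def] G Ck
              Kolmogorov_maximal_function[OF g _ d s(3)])
             (use R in \<open>auto simp: n_def R_eq less_top\<close>)
        then show ?thesis using L_le W by (auto intro: order_trans)
      qed
    qed
  qed
qed

text \<open>Each constant is a function of the A_1 constant, fixed before \<open>u\<close>,
  \<open>g\<close> and \<open>f\<close>. The excluded case is the one where the right side would be
  the undetermined product \<open>0 * \<infinity>\<close>, which equals 0 in
  \<open>ennreal\<close>.\<close>

theorem theorem5p1:
  fixes p q \<alpha> :: real
  defines "n \<equiv> real CARD('n::finite)"
  assumes "1 < p" and "p \<le> q" and "0 < \<alpha>" and "\<alpha> < n"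
    and "Theta n \<alpha> p q > 0" and "conj_exponent p * Theta n \<alpha> p q < n"
  shows
    "(\<exists>C :: ennreal \<Rightarrow> real. (\<forall>t. C t > 0) \<and>
       (\<forall>(u :: real ^ 'n \<Rightarrow> real) (g :: real ^ 'n \<Rightarrow> complex).
          u \<in> A1 \<and> integrable lebesgue g \<longrightarrow>
            Apq_const \<alpha> p q (\<lambda>x. ennreal (u x)) (maximal_weight \<alpha> p q g u) < \<infinity> \<and>
            Apq_const \<alpha> p q (\<lambda>x. ennreal (u x)) (maximal_weight \<alpha> p q g u)
              \<le> ennreal (C (A1_const u) * L1_norm g powr (Theta n \<alpha> p q / n))))
     \<and>
     (\<exists>C :: ennreal \<Rightarrow> real. (\<forall>t. C t > 0) \<and>
       (\<forall>(u :: real ^ 'n \<Rightarrow> real) (g :: real ^ 'n \<Rightarrow> complex) (f :: real ^ 'n \<Rightarrow> complex).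
          u \<in> A1 \<and> integrable lebesgue g \<and> f \<in> borel_measurable lebesgue \<and>
          \<not> (L1_norm g = 0 \<and>
             weighted_norm p (\<lambda>x. ennreal (norm (f x))) (maximal_weight \<alpha> p q g u) = \<infinity>) \<longrightarrow>
            weighted_norm q (abs_frac_integral \<alpha> f) (\<lambda>x. ennreal (u x))
              \<le> ennreal (C (A1_const u) * L1_norm g powr (Theta n \<alpha> p q / n))
                 * weighted_norm p (\<lambda>x. ennreal (norm (f x))) (maximal_weight \<alpha> p q g u)))"
proof -
  define \<theta> where "\<theta> = Theta n \<alpha> p q / n"
  define p' where "p' = conj_exponent p"
  have n: "n > 0" by (simp add: n_def)
  have \<theta>: "\<theta> > 0" "\<theta> * p' < 1"
    using assms n by (simp_all add: \<theta>_def p'_def field_simps)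
  have p': "p' > 1" using assms by (simp add: p'_def conj_exponent_def)
  text \<open>The exponent conjugate to \<open>s\<close> lies between \<open>p'\<close> and \<open>n / \<Theta>(\<alpha>)\<close>.\<close>
  define s' where "s' = (p' + 1 / \<theta>) / 2"
  have "p' < 1 / \<theta>" using \<theta> by (simp add: field_simps)
  then have s': "p' < s'" "s' < 1 / \<theta>" by (simp_all add: s'_def)
  define s where "s = s' / (s' - 1)"
  have ss: "s / (s - 1) = s'" using s' p' by (simp add: s_def field_simps)
  have s: "1 < s" using s' p' by (simp add: s_def)
  have "s' > 1" using s' p' by simp
  \<comment> \<open>In this form the conjugate exponent is visibly decreasing, so
    \<open>p' < s'\<close> gives \<open>s < p\<close>.\<close>
  then have "s = 1 + 1 / (s' - 1)" by (simp add: s_def field_simps)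
  moreover have "p = 1 + 1 / (p' - 1)"
    using \<open>1 < p\<close> by (simp add: p'_def conj_exponent_def field_simps)
  ultimately have "s < p" using s' p' by (simp add: frac_less2)
  have \<theta>s: "\<theta> * (s / (s - 1)) < 1" using s' \<theta> by (simp add: ss field_simps)
  define C1 where "C1 = (\<lambda>t. (enn2real t + 1) powr (1 / q) * Kolmogorov_const TYPE('n) (\<theta> * p') powr (1 / p'))"
  define C2 where "C2 = (\<lambda>t. weighted_const TYPE('n) \<alpha> p q s (ball_const TYPE('n) t)
          (Kolmogorov_const TYPE('n) (\<theta> * (s / (s - 1)))))"
  have C1_pos: "C1 t > 0" for t
  proof -
    have "Kolmogorov_const TYPE('n) (\<theta> * p') > 0"
      using \<theta> p' by (intro Kolmogorov_const_pos) auto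
    moreover have "enn2real t + 1 > 0" by (simp add: add_nonneg_pos)
    ultimately show ?thesis unfolding C1_def by simp
  qed
  have Apq: "Apq_const \<alpha> p q (\<lambda>x. ennreal (u x)) (maximal_weight \<alpha> p q g u)
      \<le> ennreal (C1 (A1_const u) * L1_norm g powr \<theta>)"
    if "u \<in> A1" "integrable lebesgue g" for u and g :: "real ^ 'n \<Rightarrow> complex"
    using Apq_const_le[of p q \<alpha> u g] that assms \<theta>
    by (simp add: C1_def \<theta>_def n_def p'_def)
  have C2_pos: "C2 t > 0" for t
    unfolding C2_def using assms s \<open>s < p\<close> \<theta> \<theta>s
    by (intro weighted_const_pos Kolmogorov_const_pos ball_const_pos) auto
  have wn: "weighted_norm q (abs_frac_integral \<alpha> f) (\<lambda>x. ennreal (u x))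
      \<le> ennreal (C2 (A1_const u) * L1_norm g powr \<theta>)
        * weighted_norm p (\<lambda>x. ennreal (norm (f x))) (maximal_weight \<alpha> p q g u)"
    if "u \<in> A1" "integrable lebesgue g" "f \<in> borel_measurable lebesgue"
      "\<not> (L1_norm g = 0 \<and> weighted_norm p (\<lambda>x. ennreal (norm (f x))) (maximal_weight \<alpha> p q g u) = \<infinity>)"
    for u and f g :: "real ^ 'n \<Rightarrow> complex"
    using weighted_norm_frac_integral_le[of p q \<alpha> s u g f] that assms s \<open>s < p\<close> \<theta> \<theta>s
    unfolding C2_def \<theta>_def n_def by blast
  show ?thesis
    unfolding \<theta>_def[symmetric]
  proof (intro conjI, goal_cases)
    case 1
    show ?case
      using C1_pos Apq le_less_trans[OF Apq] by (intro exI[of _ C1]) simp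
  next
    case 2
    show ?case
      using C2_pos wn by (blast intro: exI[of _ C2])
  qed
qed

end
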